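(* For every $z=(z_1,z_2)\in\Omega=(-\pi,\pi)\times\mathbb{R}$, the indicator function $$I(z)=\sum_{l=1}^N\Big|\sum_{j:\beta_j>0}\beta_j\Big(u_j^+(l)\,\overline{g_j^+(z)}+u_j^-(l)\,\overline{g_j^-(z)}\Big)\Big|^p$$ satisfies $$I(z)=\Big(\frac{k^2}{8\pi}\Big)^p\sum_{l=1}^N\Big|\int_D\big[J_0(k|z-y|)+w_\alpha(z,y)\big]\,q(y)\,u(y,l)\,dy\Big|^p,$$ where $J_0$ is the Bessel function of the first kind of order $0$ and $$w_\alpha(z,y):=\sum_{j\in\mathbb{Z}\setminus\{0\}}e^{-i2\pi j\alpha}\,J_0\Big(k\sqrt{(z_1-y_1+2j\pi)^2+(z_2-y_2)^2}\Big).$$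
   Context: Let $k>0$, $\alpha\in\mathbb{R}$, $p\in\mathbb{N}=\{1,2,\dots\}$ and let $N\ge 1$ be an integer (the number of incident fields). A function $f$ on $\mathbb{R}^2$ is $\alpha$-quasiperiodic (in $x_1$) if $f(x_1+2\pi j,x_2)=e^{i2\pi j\alpha}f(x_1,x_2)$ for all $j\in\mathbb{Z}$ and $(x_1,x_2)\in\mathbb{R}^2$. Medium: $n$ is a bounded function on $\mathbb{R}^2$, $2\pi$-periodic in $x_1$, equal to $1$ outside the periodic medium, which is bounded in the $x_2$-direction. The contrast is $q=n-1$. Put $\Omega=(-\pi,\pi)\times\mathbb{R}$, $D=\operatorname{supp}(q)\cap\Omega$, and fix $h>0$ with $h>\sup\{|x_2|:(x_1,x_2)\in D\}$. For $j\in\mathbb{Z}$ set $\alpha_j=\alpha+j$, and $\beta_j=\sqrt{k^2-\alpha_j^2}$ if $k^2\ge\alpha_j^2$, $\beta_j=i\sqrt{\alpha_j^2-k^2}$ if $k^2<\alpha_j^2$. It is assumed that $\beta_j\ne0$ for all $j\in\mathbb{Z}$. The condition "$\beta_j>0$" means $\beta_j$ is real and positive, i.e. $k^2>\alpha_j^2$; this holds for only finitely many $j$. Scattering problem: for $l=1,\dots,N$, $u_{in}(\cdot,l)$ is an $\alpha$-quasiperiodic incident field, $u_{sc}(\cdot,l)$ is the corresponding scattered field, and $u(\cdot,l)=u_{in}(\cdot,l)+u_{sc}(\cdot,l)$ is the total field. The scattered field $u_{sc}(\cdot,l)$ is $\alpha$-quasiperiodic and solves $$\Delta u_{sc}(\cdot,l)+k^2u_{sc}(\cdot,l)=-k^2q\,u(\cdot,l)\quad\text{in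 }\mathbb{R}^2$$ (in the usual weak sense, $u_{sc}(\cdot,l)\in H^1_{loc}(\mathbb{R}^2)$, with $u(\cdot,l)\in L^2(D)$), together with the Rayleigh expansion (radiation) condition $$u_{sc}(x,l)=\sum_{j\in\mathbb{Z}}u_j^+(l)\,e^{i\alpha_jx_1+i\beta_j(x_2-h)}\ \ (x_2\ge h),\qquad u_{sc}(x,l)=\sum_{j\in\mathbb{Z}}u_j^-(l)\,e^{i\alpha_jx_1-i\beta_j(x_2+h)}\ \ (x_2\le -h).$$ The complex numbers $u_j^\pm(l)$ are the Rayleigh coefficients of $u_{sc}(\cdot,l)$. This scattering problem is equivalent to the Lippmann–Schwinger equation $u_{sc}(x,l)=k^2\int_DG(x,y)q(y)u(y,l)\,dy$, where $G$ is the $\alpha$-quasiperiodic Green function $$G(x,y)=\frac{i}{4\pi}\sum_{j\in\mathbb{Z}}\frac1{\beta_j}e^{i\alpha_j(x_1-y_1)+i\beta_j|x_2-y_2|},\qquad x,y\in\Omega,\ x_2\ne y_2.$$ For $j\in\mathbb{Z}$ and $z=(z_1,z_2)\in\Omega$, $$g_j^\pm(z)=\frac{i}{4\pi\beta_j}e^{-i\alpha_jz_1\mp i\beta_j(z_2\mp h)},$$ with upper signs for $g_j^+$ and lower signs for $g_j^-$. The (in general only conditionally convergent) series over $j\in\mathbb{Z}\setminus\{0\}$ is understood as the limit as $M\to\infty$ of the partial sums over $0<|j|\le M$. *)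

theory Defs
  imports "HOL-Analysis.Analysis"
begin

definition supp :: "('a::topological_space \<Rightarrow> 'b::zero) \<Rightarrow> 'a set" where
  "supp f = closure {x. f x \<noteq> 0}"

text \<open>Measurability and integration are with respect to the completed Lebesgue measure.
  Functions are not identified when they agree almost everywhere.\<close>

definition L2_on :: "'a::euclidean_space set \<Rightarrow> ('a \<Rightarrow> complex) \<Rightarrow> bool" where
  "L2_on S f \<longleftrightarrow> f \<in> borel_measurable (lebesgue_on S) \<and>
     integrable (lebesgue_on S) (\<lambda>x. (cmod (f x))\<^sup>2)"

definition L2_loc :: "('a::euclidean_space \<Rightarrow> complex) \<Rightarrow> bool" where
  "L2_loc f \<longleftrightarrow> (\<forall>K. compact K \<longrightarrow> L2_on K f)"

definition dir_deriv :: "'a::euclidean_space \<Rightarrow> ('a \<Rightarrow> complex) \<Rightarrow> 'a \<Rightarrow> complex" where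
  "dir_deriv v f = (\<lambda>x. frechet_derivative f (at x) v)"

primrec C_k :: "nat \<Rightarrow> ('a::euclidean_space \<Rightarrow> complex) \<Rightarrow> bool" where
  "C_k 0 f \<longleftrightarrow> continuous_on UNIV f"
| "C_k (Suc m) f \<longleftrightarrow> (\<forall>x. f differentiable (at x)) \<and> (\<forall>b\<in>Basis. C_k m (dir_deriv b f))"

definition test_function :: "('a::euclidean_space \<Rightarrow> complex) \<Rightarrow> bool" where
  "test_function \<phi> \<longleftrightarrow> (\<forall>m. C_k m \<phi>) \<and> compact (supp \<phi>)"

text \<open>The function \<open>g b\<close> is the weak partial derivative in the direction of the basis vector \<open>b\<close>;
  the values of \<open>g\<close> outside \<open>Basis\<close> are irrelevant.\<close>

definition weak_gradient ::
  "('a::euclidean_space \<Rightarrow> complex) \<Rightarrow> ('a \<Rightarrow> 'a \<Rightarrow> complex) \<Rightarrow> bool" where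
  "weak_gradient f g \<longleftrightarrow> (\<forall>b\<in>Basis. L2_loc (g b) \<and>
     (\<forall>\<phi>. test_function \<phi> \<longrightarrow>
        (LINT x|lebesgue. f x * dir_deriv b \<phi> x) = - (LINT x|lebesgue. g b x * \<phi> x)))"

definition H1_loc :: "('a::euclidean_space \<Rightarrow> complex) \<Rightarrow> bool" where
  "H1_loc f \<longleftrightarrow> L2_loc f \<and> (\<exists>g. weak_gradient f g)"

text \<open>Weak form of \<open>\<Delta>f + k\<^sup>2 f = F\<close> in the whole space. Since weak gradients are unique up to
  null sets, it is immaterial which one is used.\<close>

definition weak_helmholtz ::
  "real \<Rightarrow> ('a::euclidean_space \<Rightarrow> complex) \<Rightarrow> ('a \<Rightarrow> complex) \<Rightarrow> bool" where
  "weak_helmholtz k f F \<longleftrightarrow> H1_loc f \<and>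
     (\<exists>g. weak_gradient f g \<and>
       (\<forall>\<phi>. test_function \<phi> \<longrightarrow>
         (LINT x|lebesgue. (\<Sum>b\<in>Basis. g b x * dir_deriv b \<phi> x) - of_real (k\<^sup>2) * f x * \<phi> x)
           = - (LINT x|lebesgue. F x * \<phi> x)))"

definition quasiperiodic :: "real \<Rightarrow> (real \<times> real \<Rightarrow> complex) \<Rightarrow> bool" where
  "quasiperiodic \<alpha> f \<longleftrightarrow>
     (\<forall>j::int. \<forall>x1 x2. f (x1 + 2 * pi * of_int j, x2)
        = exp (\<i> * of_real (2 * pi * of_int j * \<alpha>)) * f (x1, x2))"

definition Omega :: "(real \<times> real) set" where
  "Omega = {-pi<..<pi} \<times> UNIV"

definition contrast :: "(real \<times> real \<Rightarrow> complex) \<Rightarrow> real \<times> real \<Rightarrow> complex" where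
  "contrast n x = n x - 1"

definition scatterer :: "(real \<times> real \<Rightarrow> complex) \<Rightarrow> (real \<times> real) set" where
  "scatterer n = supp (contrast n) \<inter> Omega"

definition periodic_medium :: "(real \<times> real \<Rightarrow> complex) \<Rightarrow> bool" where
  "periodic_medium n \<longleftrightarrow>
     n \<in> borel_measurable lebesgue \<and> bounded (range n) \<and>
     (\<forall>x1 x2. n (x1 + 2 * pi, x2) = n (x1, x2)) \<and>
     (\<exists>H. \<forall>x1 x2. \<bar>x2\<bar> > H \<longrightarrow> n (x1, x2) = 1)"

definition alpha_j :: "real \<Rightarrow> int \<Rightarrow> real" where
  "alpha_j \<alpha> j = \<alpha> + of_int j"

definition beta_j :: "real \<Rightarrow> real \<Rightarrow> int \<Rightarrow> complex" where
  "beta_j k \<alpha> j =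
     (if k\<^sup>2 \<ge> (alpha_j \<alpha> j)\<^sup>2 then of_real (sqrt (k\<^sup>2 - (alpha_j \<alpha> j)\<^sup>2))
      else \<i> * of_real (sqrt ((alpha_j \<alpha> j)\<^sup>2 - k\<^sup>2)))"

definition propagating :: "real \<Rightarrow> real \<Rightarrow> int set" where
  "propagating k \<alpha> = {j. beta_j k \<alpha> j \<in> \<real> \<and> Re (beta_j k \<alpha> j) > 0}"

text \<open>The expansions are required pointwise and with unconditional (equivalently, absolute)
  convergence.\<close>

definition rayleigh_expansion ::
  "real \<Rightarrow> real \<Rightarrow> real \<Rightarrow> (real \<times> real \<Rightarrow> complex) \<Rightarrow> (int \<Rightarrow> complex) \<Rightarrow> (int \<Rightarrow> complex) \<Rightarrow> bool"
where
  "rayleigh_expansion k \<alpha> h v up um \<longleftrightarrow>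
     (\<forall>x1 x2. x2 \<ge> h \<longrightarrow>
        ((\<lambda>j. up j * exp (\<i> * of_real (alpha_j \<alpha> j * x1)
                          + \<i> * beta_j k \<alpha> j * of_real (x2 - h))) has_sum v (x1, x2)) UNIV) \<and>
     (\<forall>x1 x2. x2 \<le> - h \<longrightarrow>
        ((\<lambda>j. um j * exp (\<i> * of_real (alpha_j \<alpha> j * x1)
                          - \<i> * beta_j k \<alpha> j * of_real (x2 + h))) has_sum v (x1, x2)) UNIV)"

text \<open>Scattered field \<open>us\<close> for the incident field \<open>ui\<close>, with Rayleigh coefficients \<open>up\<close> (above)
  and \<open>um\<close> (below).\<close>

definition scattering_solution ::
  "real \<Rightarrow> real \<Rightarrow> real \<Rightarrow> (real \<times> real \<Rightarrow> complex) \<Rightarrow> (real \<times> real \<Rightarrow> complex) \<Rightarrow>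
   (real \<times> real \<Rightarrow> complex) \<Rightarrow> (int \<Rightarrow> complex) \<Rightarrow> (int \<Rightarrow> complex) \<Rightarrow> bool"
where
  "scattering_solution k \<alpha> h n ui us up um \<longleftrightarrow>
     quasiperiodic \<alpha> us \<and>
     L2_on (scatterer n) (\<lambda>x. ui x + us x) \<and>
     weak_helmholtz k us (\<lambda>x. - of_real (k\<^sup>2) * contrast n x * (ui x + us x)) \<and>
     rayleigh_expansion k \<alpha> h us up um"

definition g_plus :: "real \<Rightarrow> real \<Rightarrow> real \<Rightarrow> int \<Rightarrow> real \<times> real \<Rightarrow> complex" where
  "g_plus k \<alpha> h j z = \<i> / (4 * of_real pi * beta_j k \<alpha> j) *
     exp (- \<i> * of_real (alpha_j \<alpha> j * fst z) - \<i> * beta_j k \<alpha> j * of_real (snd z - h))"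

definition g_minus :: "real \<Rightarrow> real \<Rightarrow> real \<Rightarrow> int \<Rightarrow> real \<times> real \<Rightarrow> complex" where
  "g_minus k \<alpha> h j z = \<i> / (4 * of_real pi * beta_j k \<alpha> j) *
     exp (- \<i> * of_real (alpha_j \<alpha> j * fst z) + \<i> * beta_j k \<alpha> j * of_real (snd z + h))"

definition imaging_indicator ::
  "real \<Rightarrow> real \<Rightarrow> real \<Rightarrow> nat \<Rightarrow> nat \<Rightarrow> (int \<Rightarrow> nat \<Rightarrow> complex) \<Rightarrow> (int \<Rightarrow> nat \<Rightarrow> complex) \<Rightarrow>
   real \<times> real \<Rightarrow> real"
where
  "imaging_indicator k \<alpha> h p N up um z =
     (\<Sum>l=1..N. cmod (\<Sum>j\<in>propagating k \<alpha>. beta_j k \<alpha> j *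
        (up j l * cnj (g_plus k \<alpha> h j z) + um j l * cnj (g_minus k \<alpha> h j z))) ^ p)"

definition bessel_J :: "nat \<Rightarrow> real \<Rightarrow> real" where
  "bessel_J \<nu> x = (\<Sum>m. (-1) ^ m / (fact m * fact (m + \<nu>)) * (x / 2) ^ (2 * m + \<nu>))"

definition w_partial ::
  "real \<Rightarrow> real \<Rightarrow> real \<times> real \<Rightarrow> real \<times> real \<Rightarrow> nat \<Rightarrow> complex" where
  "w_partial k \<alpha> z y M =
     (\<Sum>j\<in>{j::int. 0 < \<bar>j\<bar> \<and> \<bar>j\<bar> \<le> int M}. exp (- \<i> * of_real (2 * pi * of_int j * \<alpha>)) *
        of_real (bessel_J 0
          (k * sqrt ((fst z - fst y + 2 * of_int j * pi)\<^sup>2 + (snd z - snd y)\<^sup>2))))"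

definition w_alpha :: "real \<Rightarrow> real \<Rightarrow> real \<times> real \<Rightarrow> real \<times> real \<Rightarrow> complex" where
  "w_alpha k \<alpha> z y = lim (w_partial k \<alpha> z y)"

end

theory Submission
  imports Defs
begin

text \<open>Testing the weak Helmholtz equation with \<open>e\<^bsup>-i\<alpha>\<^sub>jx\<^sub>1 \<mp> i\<beta>\<^sub>jx\<^sub>2\<^esup>\<close>, cut off in \<open>x\<^sub>2\<close> outside the medium,
  isolates a single Rayleigh coefficient: on the one side only the \<open>j\<close>-th mode survives integration
  over a period and a Wronskian remains, on the other side the integral of \<open>-k\<^sup>2qu\<close> against the plane
  wave. Hence \<open>u\<^sub>j\<^sup>\<plusminus> = k\<^sup>2 \<integral>\<^sub>D g\<^sub>j\<^sup>\<plusminus> q u\<close> for every propagating \<open>j\<close>, without the Green function. Inserting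
  this in the indicator leaves the kernel
  \<open>\<Sum> e\<^bsup>i\<alpha>\<^sub>j(z\<^sub>1-y\<^sub>1)\<^esup> cos (\<beta>\<^sub>j(z\<^sub>2-y\<^sub>2)) / (\<pi>\<beta>\<^sub>j)\<close>, summed over the propagating \<open>j\<close>.
  Since \<open>J\<^sub>0(k\<surd>(x\<^sup>2+s\<^sup>2))\<close> is the Fourier transform in \<open>x\<close> of \<open>cos (s\<surd>(k\<^sup>2-\<xi>\<^sup>2)) / (\<pi>\<surd>(k\<^sup>2-\<xi>\<^sup>2))\<close> on
  \<open>(-k,k)\<close>, Poisson summation identifies this kernel with \<open>J\<^sub>0 + w\<^sub>\<alpha>\<close>. The density is smooth at the
  frequencies \<open>\<alpha>\<^sub>j\<close> because \<open>\<beta>\<^sub>j \<noteq> 0\<close>, so Dini's test gives convergence of the symmetric partial sums.\<close>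

section \<open>The Riemann--Lebesgue lemma and Poisson summation\<close>

text \<open>The transform of J_0 blows up like an inverse square root at the frequencies
  \<open>k\<close> and \<open>- k\<close>. Correspondingly J_0 decays too slowly for the series to
  converge absolutely in general, and the usual Poisson formula for rapidly decaying functions does
  not apply. What remains is a pointwise argument: the frequency axis is cut into unit intervals
  centred at the numbers \<open>alpha_j\<close>, so that a singularity may sit anywhere in an
  interval except at its centre. Away from the centre integrability suffices, which is why the
  Riemann--Lebesgue lemma is wanted for L1 functions. A plane wave with vertical exponent
  \<open>v\<close>, where \<open>v\<^sup>2 = - \<beta>\<^sup>2\<close>, gives one linear relation
  between the upper and the lower coefficient; each of the two roots makes one of them drop out. The
  constant \<open>k\<^sup>2 / (8 * pi)\<close>: the source term carries the square of
  \<open>k\<close>, each product of two factors \<open>g\<close> carries 1/(16 pi^2 beta^2), the two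
  phases add up to twice a cosine, and the weight beta leaves 1/(8 pi) in front of cos/(pi
  beta).\<close>

text \<open>Truncation that keeps the argument of a complex number. It is continuous, so it carries
  pointwise convergence over to the truncated functions.\<close>

definition radial_clamp :: "real \<Rightarrow> complex \<Rightarrow> complex" where
  "radial_clamp R w = of_real (R / max R (cmod w)) * w"

lemma radial_clamp_eq: "R > 0 \<Longrightarrow> cmod w \<le> R \<Longrightarrow> radial_clamp R w = w"
  by (simp add: radial_clamp_def max_def)

lemma norm_radial_clamp_le:
  assumes "R > 0"
  shows "cmod (radial_clamp R w) \<le> R" "cmod (radial_clamp R w) \<le> cmod w"
proof -
  have "cmod (radial_clamp R w) = R * cmod w / max R (cmod w)"
    using assms unfolding radial_clamp_def norm_mult norm_of_real by simp
  also have "\<dots> = min R (cmod w)"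
    using assms by (auto simp: max_def min_def)
  finally show "cmod (radial_clamp R w) \<le> R" "cmod (radial_clamp R w) \<le> cmod w"
    by auto
qed

lemma continuous_on_radial_clamp: "R > 0 \<Longrightarrow> continuous_on UNIV (radial_clamp R)"
  unfolding radial_clamp_def[abs_def]
  by (intro continuous_intros) (auto simp: max_def split: if_splits)

text \<open>Three approximations, each costing at most e/3: truncate \<open>f\<close>, replace the
  truncation by a continuous function, replace that by a polynomial. Truncating first turns the
  second step into a bounded limit.\<close>

lemma L1_polynomial_approx:
  fixes f :: "real \<Rightarrow> complex"
  assumes f: "integrable (lebesgue_on {a..b}) f" and "e > 0"
  obtains p where "polynomial_function p"
    "(LINT x|lebesgue_on {a..b}. cmod (f x - p x)) < e"
proof -
  let ?M = "lebesgue_on {a..b}"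
  interpret finite_measure ?M
    by (rule finite_measureI) (simp add: emeasure_restrict_space emeasure_lborel_Icc_eq)
  have meas [measurable]: "f \<in> borel_measurable ?M"
    using f by auto
  have clamp [measurable]: "radial_clamp R \<in> borel_measurable borel" if "R > 0" for R
    using continuous_on_radial_clamp[OF that] by (rule borel_measurable_continuous_onI)
  have "(\<lambda>n. LINT x|?M. cmod (f x - radial_clamp (Suc n) (f x))) \<longlonglongrightarrow> (LINT x|?M. 0)"
  proof (rule integral_dominated_convergence[where w = "\<lambda>x. 2 * cmod (f x)"])
    show "(\<lambda>x. cmod (f x - radial_clamp (Suc n) (f x))) \<in> borel_measurable ?M" for n
    proof -
      have [measurable]: "radial_clamp (Suc n) \<in> borel_measurable borel" by (rule clamp) simp
      show ?thesis by measurable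
    qed
    show "AE x in ?M. (\<lambda>n. cmod (f x - radial_clamp (Suc n) (f x))) \<longlonglongrightarrow> 0"
    proof (rule AE_I2)
      fix x
      obtain n0 where "cmod (f x) \<le> real n0" using real_arch_simple by blast
      then have "eventually (\<lambda>n. cmod (f x - radial_clamp (Suc n) (f x)) = 0) sequentially"
        by (intro eventually_sequentiallyI[of n0]) (simp add: radial_clamp_eq)
      then show "(\<lambda>n. cmod (f x - radial_clamp (Suc n) (f x))) \<longlonglongrightarrow> 0"
        by (rule tendsto_eventually)
    qed
    show "AE x in ?M. norm (cmod (f x - radial_clamp (Suc n) (f x))) \<le> 2 * cmod (f x)" for n
    proof (rule AE_I2)
      fix x
      show "norm (cmod (f x - radial_clamp (Suc n) (f x))) \<le> 2 * cmod (f x)"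
        using norm_triangle_ineq4[of "f x" "radial_clamp (Suc n) (f x)"]
          norm_radial_clamp_le(2)[of "Suc n" "f x"] by simp
    qed
  qed (use f in auto)
  then have "eventually (\<lambda>n. (LINT x|?M. cmod (f x - radial_clamp (Suc n) (f x))) < e/3) sequentially"
    using \<open>e > 0\<close> by (intro order_tendstoD) auto
  then obtain n0 where n0: "(LINT x|?M. cmod (f x - radial_clamp (Suc n0) (f x))) < e/3"
    by (auto simp: eventually_sequentially)
  define R where "R = real (Suc n0)"
  have "R > 0" by (simp add: R_def)
  note clamp [OF this, measurable]
  define F where "F = (\<lambda>x. radial_clamp R (f x))"
  have F [measurable]: "F \<in> borel_measurable ?M"
    unfolding F_def by measurable
  have 1: "(LINT x|?M. cmod (f x - F x)) < e/3"
    using n0 by (simp add: F_def R_def)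
  \<comment> \<open>\<open>measurable_on\<close> supplies continuous functions converging off a
    negligible set, but no bound on them.\<close>
  have "f measurable_on {a..b}"
    by (simp add: measurable_on_iff_borel_measurable)
  then obtain N g where N: "negligible N" and g: "\<And>n. continuous_on UNIV (g n)"
    and lim: "\<And>x. x \<notin> N \<Longrightarrow> (\<lambda>n. g n x) \<longlonglongrightarrow> (if x \<in> {a..b} then f x else 0)"
    unfolding measurable_on_def by metis
  \<comment> \<open>Clamping the approximants with the same \<open>R\<close> makes them converge to
    \<open>F\<close> and yields the dominating constant \<open>2 * R\<close>.\<close>
  define G where "G = (\<lambda>n x. radial_clamp R (g n x))"
  have contG: "continuous_on UNIV (G n)" for n
    unfolding G_def using continuous_on_compose2[OF continuous_on_radial_clamp[OF \<open>R > 0\<close>] g] by auto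
  have G [measurable]: "G n \<in> borel_measurable ?M" for n
    using borel_measurable_continuous_onI[OF contG] by (simp add: measurable_completion measurable_restrict_space1)
  have AEN: "AE x in ?M. x \<notin> N \<and> x \<in> {a..b}"
  proof (rule AE_I'[where N = "N \<inter> {a..b}"])
    have "negligible (N \<inter> {a..b})" using N negligible_subset by blast
    then show "N \<inter> {a..b} \<in> null_sets ?M"
      by (simp add: null_sets_restrict_space negligible_iff_null_sets)
  qed (auto simp: space_restrict_space)
  have "(\<lambda>n. LINT x|?M. cmod (F x - G n x)) \<longlonglongrightarrow> (LINT x|?M. 0)"
  proof (rule integral_dominated_convergence[where w = "\<lambda>x. 2 * R"])
    show "AE x in ?M. (\<lambda>n. cmod (F x - G n x)) \<longlonglongrightarrow> 0"
      using AEN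
    proof eventually_elim
      case (elim x)
      then have "(\<lambda>n. g n x) \<longlonglongrightarrow> f x" using lim[of x] by auto
      then have "(\<lambda>n. G n x) \<longlonglongrightarrow> F x"
        unfolding F_def G_def using continuous_on_tendsto_compose[OF continuous_on_radial_clamp[OF \<open>R > 0\<close>]]
        by auto
      then show ?case
        using tendsto_norm[OF tendsto_diff[OF tendsto_const[of "F x"]], of "\<lambda>n. G n x" "F x"] by simp
    qed
    show "AE x in ?M. norm (cmod (F x - G n x)) \<le> 2 * R" for n
    proof (rule AE_I2)
      fix x
      show "norm (cmod (F x - G n x)) \<le> 2 * R"
        using norm_triangle_ineq4[of "F x" "G n x"] norm_radial_clamp_le(1)[OF \<open>R > 0\<close>, of "f x"]
          norm_radial_clamp_le(1)[OF \<open>R > 0\<close>, of "g n x"] by (simp add: F_def G_def)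
    qed
  qed auto
  then have "eventually (\<lambda>n. (LINT x|?M. cmod (F x - G n x)) < e/3) sequentially"
    using \<open>e > 0\<close> by (intro order_tendstoD) auto
  then obtain n1 where n1: "(LINT x|?M. cmod (F x - G n1 x)) < e/3"
    by (auto simp: eventually_sequentially)
  \<comment> \<open>The 1 added to the length keeps the denominator positive for a degenerate
    interval.\<close>
  define \<epsilon> where "\<epsilon> = e / (3 * (\<bar>b - a\<bar> + 1))"
  have "\<epsilon> > 0" unfolding \<epsilon>_def using \<open>e > 0\<close> by (intro divide_pos_pos mult_pos_pos) auto
  then obtain p where p: "polynomial_function p" "\<And>x. x \<in> {a..b} \<Longrightarrow> norm (G n1 x - p x) < \<epsilon>"
    using Stone_Weierstrass_polynomial_function[of "{a..b}" "G n1" \<epsilon>]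
      continuous_on_subset[OF contG] by (auto)
  have pm [measurable]: "p \<in> borel_measurable ?M"
    using borel_measurable_continuous_onI[OF continuous_on_polymonial_function[OF p(1)]]
    by (simp add: measurable_completion measurable_restrict_space1)
  have iF: "integrable ?M (\<lambda>x. cmod (f x - F x))"
  proof (rule Bochner_Integration.integrable_bound[where f = "\<lambda>x. 2 * cmod (f x)"])
    show "AE x in ?M. norm (cmod (f x - F x)) \<le> norm (2 * cmod (f x))"
    proof (rule AE_I2)
      fix x
      show "norm (cmod (f x - F x)) \<le> norm (2 * cmod (f x))"
        using norm_triangle_ineq4[of "f x" "F x"] norm_radial_clamp_le(2)[OF \<open>R > 0\<close>, of "f x"]
        by (simp add: F_def)
    qed
  qed (use f in auto)
  have iG: "integrable ?M (\<lambda>x. cmod (F x - G n1 x))"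
  proof (rule integrable_const_bound[where B = "2 * R"])
    show "AE x in ?M. norm (cmod (F x - G n1 x)) \<le> 2 * R"
    proof (rule AE_I2)
      fix x
      show "norm (cmod (F x - G n1 x)) \<le> 2 * R"
        using norm_triangle_ineq4[of "F x" "G n1 x"] norm_radial_clamp_le(1)[OF \<open>R > 0\<close>, of "f x"]
          norm_radial_clamp_le(1)[OF \<open>R > 0\<close>, of "g n1 x"] by (simp add: F_def G_def)
    qed
  qed auto
  have ip: "integrable ?M (\<lambda>x. cmod (G n1 x - p x))"
    using p(2) by (intro integrable_const_bound[where B = \<epsilon>]) (auto intro!: AE_I2 simp: less_imp_le)
  have "(LINT x|?M. cmod (G n1 x - p x)) \<le> (LINT x|?M. \<epsilon>)"
    by (rule integral_mono[OF ip]) (use p(2) in \<open>auto simp: less_imp_le\<close>)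
  also have "\<dots> \<le> \<epsilon> * \<bar>b - a\<bar>"
    using \<open>\<epsilon> > 0\<close> by (cases "a \<le> b") (simp_all add: measure_restrict_space)
  also have "\<dots> \<le> e/3"
  proof -
    have "\<epsilon> * \<bar>b - a\<bar> \<le> \<epsilon> * (\<bar>b - a\<bar> + 1)"
      using \<open>\<epsilon> > 0\<close> by (intro mult_left_mono) auto
    also have "\<dots> = e / 3"
    proof -
      have "e / (3 * d) * d = e / 3" if "d \<noteq> 0" for d using that by simp
      moreover have "\<bar>b - a\<bar> + 1 \<noteq> 0" by linarith
      ultimately show ?thesis unfolding \<epsilon>_def by blast
    qed
    finally show ?thesis .
  qed
  finally have 3: "(LINT x|?M. cmod (G n1 x - p x)) \<le> e/3" .
  have "(LINT x|?M. cmod (f x - p x)) \<le>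
      (LINT x|?M. (cmod (f x - F x) + cmod (F x - G n1 x)) + cmod (G n1 x - p x))"
  proof (rule integral_mono_AE')
    show "integrable ?M (\<lambda>x. (cmod (f x - F x) + cmod (F x - G n1 x)) + cmod (G n1 x - p x))"
      using iF iG ip by simp
    show "AE x in ?M. cmod (f x - p x) \<le> cmod (f x - F x) + cmod (F x - G n1 x) + cmod (G n1 x - p x)"
    proof (rule AE_I2)
      fix x
      show "cmod (f x - p x) \<le> cmod (f x - F x) + cmod (F x - G n1 x) + cmod (G n1 x - p x)"
        using norm_triangle_ineq[of "f x - F x" "F x - p x"] norm_triangle_ineq[of "F x - G n1 x" "G n1 x - p x"]
        by simp
    qed
  qed auto
  also have "\<dots> < e" using 1 n1 3 iF iG ip by simp
  finally show ?thesis using that p(1) by blast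
qed

text \<open>For a polynomial one integration by parts gives decay of order
  \<open>1 / \<bar>\<mu>\<bar>\<close>; the L1 error of the approximation is not enlarged by a
  factor of modulus one.\<close>

lemma riemann_lebesgue:
  fixes f :: "real \<Rightarrow> complex"
  assumes f: "integrable (lebesgue_on {a..b}) f" and "e > 0"
  shows "\<exists>L. \<forall>\<mu>. \<bar>\<mu>\<bar> \<ge> L \<longrightarrow>
    cmod (LINT x|lebesgue_on {a..b}. f x * exp (\<i> * of_real (\<mu> * x))) < e"
proof (cases "a \<le> b")
  case False
  then show ?thesis using \<open>e > 0\<close> by (simp add: lebesgue_integral_eq_integral)
next
  case True
  let ?M = "lebesgue_on {a..b}"
  obtain p where p: "polynomial_function p" and fp: "(LINT x|?M. cmod (f x - p x)) < e / 2"
    using L1_polynomial_approx[OF f, of "e / 2"] \<open>e > 0\<close> by auto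
  obtain p' where p': "polynomial_function p'" and dp: "\<And>x. (p has_vector_derivative p' x) (at x)"
    using has_vector_derivative_polynomial_function[OF p] by blast
  have contp: "continuous_on UNIV p" "continuous_on UNIV p'"
    using p p' continuous_on_polymonial_function by blast+
  obtain P where P: "\<And>x. x \<in> {a..b} \<Longrightarrow> cmod (p x) \<le> P"
    using compact_imp_bounded[OF compact_continuous_image[OF continuous_on_subset[OF contp(1) subset_UNIV] compact_Icc[of a b]]]
    unfolding bounded_iff by (metis image_eqI)
  obtain P' where P': "\<And>x. x \<in> {a..b} \<Longrightarrow> cmod (p' x) \<le> P'"
    using compact_imp_bounded[OF compact_continuous_image[OF continuous_on_subset[OF contp(2) subset_UNIV] compact_Icc[of a b]]]
    unfolding bounded_iff by (metis image_eqI)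
  have nonneg: "0 \<le> P" "0 \<le> P'"
    using P[of a] P'[of a] True norm_ge_zero[of "p a"] norm_ge_zero[of "p' a"]
    by (auto intro: order_trans[OF norm_ge_zero])
  have bound: "cmod (LINT x|?M. p x * exp (\<i> * of_real (\<mu> * x))) \<le> (2 * P + P' * (b - a)) / \<bar>\<mu>\<bar>"
    if "\<mu> \<noteq> 0" for \<mu>
  proof -
    let ?E = "\<lambda>x. exp (\<i> * of_real (\<mu> * x)) :: complex"
    let ?q = "\<lambda>x. p' x * ?E x / (\<i> * of_real \<mu>)"
    \<comment> \<open>The antiderivative is \<open>p x * ?E x / (\<i> * of_real \<mu>)\<close>;
      \<open>?q\<close> is the term that the integration by parts leaves over.\<close>
    have ftc: "((\<lambda>x. ?q x + p x * ?E x) has_integral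
        (p b * ?E b / (\<i> * of_real \<mu>) - p a * ?E a / (\<i> * of_real \<mu>))) {a..b}"
    proof (rule fundamental_theorem_of_calculus[OF True])
      fix x
      have "((\<lambda>x. exp (\<i> * of_real \<mu> * of_real x)) has_vector_derivative
          \<i> * of_real \<mu> * exp (\<i> * of_real \<mu> * of_real x)) (at x within {a..b})"
        by (rule has_vector_derivative_real_field derivative_eq_intros refl | simp)+
      then have "(?E has_vector_derivative (\<i> * of_real \<mu> * ?E x)) (at x within {a..b})"
        by (simp add: mult.assoc)
      then have "((\<lambda>x. p x * ?E x / (\<i> * of_real \<mu>)) has_vector_derivative
          (p x * (\<i> * of_real \<mu> * ?E x) + p' x * ?E x) / (\<i> * of_real \<mu>)) (at x within {a..b})"
        by (intro has_vector_derivative_divide has_vector_derivative_mult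
            has_vector_derivative_at_within[OF dp])
      then show "((\<lambda>x. p x * ?E x / (\<i> * of_real \<mu>)) has_vector_derivative ?q x + p x * ?E x)
          (at x within {a..b})"
        using that by (simp add: field_simps)
    qed
    have cq: "continuous_on {a..b} ?q" and cpE: "continuous_on {a..b} (\<lambda>x. p x * ?E x)"
      using that by (auto intro!: continuous_intros continuous_on_subset[OF contp(1)] continuous_on_subset[OF contp(2)])
    have "norm (integral {a..b} ?q) \<le> integral {a..b} (\<lambda>x. P' / \<bar>\<mu>\<bar>)"
    proof (rule Henstock_Kurzweil_Integration.integral_norm_bound_integral)
      show "?q integrable_on {a..b}" using cq by (rule integrable_continuous_interval)
      show "norm (?q x) \<le> P' / \<bar>\<mu>\<bar>" if "x \<in> {a..b}" for x
        using P'[OF that] by (simp add: norm_mult norm_divide divide_right_mono)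
    qed auto
    then have q: "norm (integral {a..b} ?q) \<le> P' / \<bar>\<mu>\<bar> * (b - a)"
      using True by (simp add: mult.commute)
    have "LINT x|?M. p x * ?E x = integral {a..b} (\<lambda>x. p x * ?E x)"
      by (intro lebesgue_integral_eq_integral continuous_imp_integrable_real cpE) auto
    also have "\<dots> = p b * ?E b / (\<i> * of_real \<mu>) - p a * ?E a / (\<i> * of_real \<mu>) - integral {a..b} ?q"
      using has_integral_diff[OF ftc integrable_integral[OF integrable_continuous_interval[OF cq]]]
      by (simp add: integral_unique)
    also have "cmod \<dots> \<le> cmod (p b * ?E b / (\<i> * of_real \<mu>)) + cmod (p a * ?E a / (\<i> * of_real \<mu>))
        + cmod (integral {a..b} ?q)"
      by (intro order_trans[OF norm_triangle_ineq4] add_right_mono norm_triangle_ineq4)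
    also have "\<dots> \<le> P / \<bar>\<mu>\<bar> + P / \<bar>\<mu>\<bar> + P' / \<bar>\<mu>\<bar> * (b - a)"
      using P[of a] P[of b] True q
      by (intro add_mono) (simp_all add: norm_mult norm_divide divide_right_mono)
    also have "\<dots> = (2 * P + P' * (b - a)) / \<bar>\<mu>\<bar>"
      by (simp add: add_divide_distrib)
    finally show ?thesis .
  qed
  \<comment> \<open>The summand 1 makes \<open>L\<close> positive even if both bounds vanish, so
    that \<open>L \<le> \<bar>\<mu>\<bar>\<close> excludes \<open>\<mu> = 0\<close>.\<close>
  define L where "L = (2 * P + P' * (b - a) + 1) / (e / 2)"
  have "L > 0" unfolding L_def using nonneg True \<open>e > 0\<close> by (intro divide_pos_pos add_nonneg_pos) auto
  have meas: "p \<in> borel_measurable ?M"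
    using borel_measurable_continuous_onI[OF contp(1)]
    by (simp add: measurable_completion measurable_restrict_space1)
  have ip: "integrable ?M p"
    by (rule continuous_imp_integrable_real[OF continuous_on_subset[OF contp(1)]]) simp
  have iE: "integrable ?M (\<lambda>x. g x * exp (\<i> * of_real (\<mu> * x)))" if g: "integrable ?M g" for g :: "real \<Rightarrow> complex" and \<mu>
  proof (rule Bochner_Integration.integrable_bound[OF g])
    have "continuous_on UNIV (\<lambda>x. exp (\<i> * of_real (\<mu> * x)) :: complex)"
      by (intro continuous_intros)
    then have "(\<lambda>x. exp (\<i> * of_real (\<mu> * x)) :: complex) \<in> borel_measurable ?M"
      using borel_measurable_continuous_onI
      by (simp add: measurable_completion measurable_restrict_space1)
    then show "(\<lambda>x. g x * exp (\<i> * of_real (\<mu> * x))) \<in> borel_measurable ?M"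
      using g by (intro borel_measurable_times) auto
  qed (auto simp: norm_mult)
  show ?thesis
  proof (intro exI[of _ L] allI impI)
    fix \<mu> :: real assume \<mu>: "L \<le> \<bar>\<mu>\<bar>"
    let ?E = "\<lambda>x. exp (\<i> * of_real (\<mu> * x)) :: complex"
    have "\<mu> \<noteq> 0" "\<bar>\<mu>\<bar> > 0" using \<mu> \<open>L > 0\<close> by auto
    have "LINT x|?M. f x * ?E x = LINT x|?M. ((f x - p x) * ?E x + p x * ?E x)"
      by (simp add: algebra_simps)
    also have "\<dots> = (LINT x|?M. (f x - p x) * ?E x) + (LINT x|?M. p x * ?E x)"
      by (intro Bochner_Integration.integral_add iE ip Bochner_Integration.integrable_diff f)
    also have "cmod \<dots> \<le> cmod (LINT x|?M. (f x - p x) * ?E x) + cmod (LINT x|?M. p x * ?E x)"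
      by (rule norm_triangle_ineq)
    also have "\<dots> \<le> (LINT x|?M. cmod ((f x - p x) * ?E x)) + (2 * P + P' * (b - a)) / \<bar>\<mu>\<bar>"
      by (intro add_mono integral_norm_bound bound \<open>\<mu> \<noteq> 0\<close>)
    also have "\<dots> < e / 2 + e / 2"
    proof (rule add_less_le_mono)
      have "2 * P + P' * (b - a) + 1 \<le> \<bar>\<mu>\<bar> * (e / 2)"
        using \<mu> \<open>e > 0\<close> unfolding L_def by (subst (asm) pos_divide_le_eq) auto
      then show "(2 * P + P' * (b - a)) / \<bar>\<mu>\<bar> \<le> e / 2"
        using \<open>\<bar>\<mu>\<bar> > 0\<close> by (subst pos_divide_le_eq) (auto simp: mult.commute)
    qed (use fp in \<open>simp add: norm_mult\<close>)
    finally show "cmod (LINT x|?M. f x * ?E x) < e" by simp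
  qed
qed


section \<open>Dini's test on a unit interval and Poisson summation\<close>

text \<open>A crude constant is enough: multiplied by 2, the right side is the modulus of exp(2 pi i
  t) - 1, the denominator in Dini's test, and the left side is the distance to the centre.\<close>

lemma abs_sin_pi_ge:
  fixes t :: real
  assumes "\<bar>t\<bar> \<le> 1 / 2"
  shows "\<bar>t\<bar> / 2 \<le> \<bar>sin (pi * t)\<bar>"
proof -
  have pos: "x / 2 \<le> sin (pi * x)" if "0 \<le> x" "x \<le> 1 / 2" for x :: real
  \<comment> \<open>Up to 1/3 the cosine is at least 1/2, so \<open>sin (pi * y) - y / 2\<close>
    increases; beyond it the sine is at least 1/2 while \<open>x / 2\<close> is at most 1/4.\<close>
  proof (cases "x \<le> 1 / 3")
    case True
    define g where "g = (\<lambda>y. sin (pi * y) - y / 2)"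
    have "g 0 \<le> g x"
    proof (rule DERIV_nonneg_imp_nondecreasing[OF \<open>0 \<le> x\<close>])
      fix y assume y: "0 \<le> y" "y \<le> x"
      have "(g has_real_derivative pi * cos (pi * y) - 1 / 2) (at y)"
        unfolding g_def by (auto intro!: derivative_eq_intros)
      moreover have "pi * cos (pi * y) - 1 / 2 \<ge> 0"
      proof -
        have "pi * y \<le> pi * (1 / 3)" using y True by (intro mult_left_mono) auto
        then have "cos (pi / 3) \<le> cos (pi * y)"
          using y by (intro cos_monotone_0_pi_le) auto
        then have "1 / 2 \<le> cos (pi * y)" by (simp add: cos_60)
        then have "1 * (1 / 2) \<le> pi * cos (pi * y)"
          using pi_gt3 by (intro mult_mono) auto
        then show ?thesis by simp
      qed
      ultimately show "\<exists>d. (g has_real_derivative d) (at y) \<and> 0 \<le> d" by blast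
    qed
    then show ?thesis by (simp add: g_def)
  next
    case False
    have "pi * (1 / 3) \<le> pi * x" "pi * x \<le> pi * (1 / 2)"
      using False that by (intro mult_left_mono; simp)+
    then have "sin (pi / 6) \<le> sin (pi * x)"
      by (intro sin_monotone_2pi_le) auto
    then show ?thesis using that by (simp add: sin_30)
  qed
  show ?thesis
  proof (cases "0 \<le> t")
    case True
    then have "\<bar>t\<bar> / 2 \<le> sin (pi * t)" using pos[of t] assms by simp
    then show ?thesis by linarith
  next
    case False
    then have "\<bar>t\<bar> / 2 \<le> sin (pi * (- t))" using pos[of "- t"] assms by simp
    also have "\<dots> \<le> \<bar>sin (pi * t)\<bar>" by simp
    finally show ?thesis .
  qed
qed

lemma sum_int_telescope:
  fixes F :: "int \<Rightarrow> complex"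
  shows "(\<Sum>j\<in>{- int M..int M}. F (j + 1) - F j) = F (int M + 1) - F (- int M)"
proof (induction M)
  case (Suc M)
  have "{- int (Suc M)..int (Suc M)} = insert (- int M - 1) (insert (int M + 1) {- int M..int M})"
    by auto
  then have "(\<Sum>j\<in>{- int (Suc M)..int (Suc M)}. F (j + 1) - F j) =
      (F (- int M - 1 + 1) - F (- int M - 1)) + ((F (int M + 1 + 1) - F (int M + 1)) +
        (\<Sum>j\<in>{- int M..int M}. F (j + 1) - F j))"
    by simp
  also have "\<dots> = F (int M + 1 + 1) - F (- int M - 1)"
    unfolding Suc.IH by simp
  also have "int M + 1 + 1 = int (Suc M) + 1" by simp
  also have "- int M - 1 = - int (Suc M)" by simp
  finally show ?case .
qed simp

lemma integral_exp_period:
  fixes c :: real and j :: int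
  shows "((\<lambda>x. exp (\<i> * of_real (2 * pi * of_int j * (x - c)))) has_integral (if j = 0 then 1 else 0))
    {c - 1 / 2..c + 1 / 2}"
proof (cases "j = 0")
  case True
  then show ?thesis using has_integral_const_real[of "1 :: complex" "c - 1 / 2" "c + 1 / 2"] by simp
next
  case False
  let ?E = "\<lambda>x. exp (\<i> * of_real (2 * pi * of_int j * (x - c))) :: complex"
  let ?k = "\<i> * of_real (2 * pi * of_int j)"
  have k: "?k \<noteq> 0" using False by simp
  have "(?E has_integral (?E (c + 1 / 2) / ?k - ?E (c - 1 / 2) / ?k)) {c - 1 / 2..c + 1 / 2}"
  proof (rule fundamental_theorem_of_calculus)
    fix x
    have "((\<lambda>x. exp (?k * of_real (x - c))) has_vector_derivative ?k * exp (?k * of_real (x - c))) (at x within {c - 1 / 2..c + 1 / 2})"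
      by (rule has_vector_derivative_real_field derivative_eq_intros refl | simp)+
    then have "((\<lambda>x. exp (?k * of_real (x - c)) / ?k) has_vector_derivative ?k * exp (?k * of_real (x - c)) / ?k) (at x within {c - 1 / 2..c + 1 / 2})"
      by (rule has_vector_derivative_divide)
    then show "((\<lambda>x. ?E x / ?k) has_vector_derivative ?E x) (at x within {c - 1 / 2..c + 1 / 2})"
      using k by (simp add: mult.assoc)
  qed simp
  moreover have "?E (c + 1 / 2) = ?E (c - 1 / 2)"
  proof -
    have "?E (c + 1 / 2) = exp (\<i> * of_real (2 * pi * of_int j * (- 1 / 2)) + of_real (2 * of_int j * pi) * \<i>)"
      by (rule arg_cong[where f = exp]) (simp add: algebra_simps)
    also have "\<dots> = exp (\<i> * of_real (2 * pi * of_int j * (- 1 / 2)))"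
      unfolding exp_add using exp_integer_2pi[of "of_int j"] by simp
    also have "\<dots> = ?E (c - 1 / 2)" by (rule arg_cong[where f = exp]) simp
    finally show ?thesis .
  qed
  ultimately show ?thesis using False by simp
qed

text \<open>Chernoff's argument: dividing \<open>f - f(c)\<close> by \<open>e\<^bsup>2\<pi>i(x-c)\<^esup> - 1\<close> leaves an integrable function, for
  which the partial sums telescope.\<close>

lemma dini_interval:
  fixes f :: "real \<Rightarrow> complex"
  assumes f: "integrable (lebesgue_on {c - 1 / 2..c + 1 / 2}) f"
    and "\<delta> > 0" and B: "\<And>x. \<bar>x - c\<bar> < \<delta> \<Longrightarrow> cmod (f x - f c) \<le> B * \<bar>x - c\<bar>"
  shows "(\<lambda>M. \<Sum>j\<in>{- int M..int M}. LINT x|lebesgue_on {c - 1 / 2..c + 1 / 2}.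
    f x * exp (\<i> * of_real (2 * pi * of_int j * (x - c)))) \<longlonglongrightarrow> f c"
proof -
  let ?J = "{c - 1 / 2..c + 1 / 2}"
  let ?M = "lebesgue_on ?J"
  define E where "E = (\<lambda>(j::int) x. exp (\<i> * of_real (2 * pi * of_int j * (x - c))) :: complex)"
  interpret finite_measure ?M
    by (rule finite_measureI) (simp add: emeasure_restrict_space emeasure_lborel_Icc_eq)
  \<comment> \<open>Evaluating the Lipschitz bound at \<open>c + \<delta> / 2\<close> forces
    \<open>B\<close> to be nonnegative.\<close>
  have "0 \<le> B * (\<delta> / 2)"
    using order_trans[OF norm_ge_zero B[of "c + \<delta> / 2"]] \<open>\<delta> > 0\<close> by simp
  then have B0: "B \<ge> 0" using \<open>\<delta> > 0\<close> by (simp add: zero_le_mult_iff)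
  have meas [measurable]: "f \<in> borel_measurable ?M" using f by auto
  have contE: "continuous_on UNIV (E j)" for j
    unfolding E_def by (intro continuous_intros)
  have mE [measurable]: "E j \<in> borel_measurable ?M" for j
    using borel_measurable_continuous_onI[OF contE]
    by (simp add: measurable_completion measurable_restrict_space1)
  have nE: "cmod (E j x) = 1" for j x by (simp add: E_def)
  have iE: "integrable ?M (\<lambda>x. g x * E j x)" if g: "integrable ?M g" for g j
    by (rule Bochner_Integration.integrable_bound[OF g]) (use g in \<open>auto simp: norm_mult nE\<close>)
  have E_add: "E (i + j) x = E i x * E j x" for i j x
    unfolding E_def exp_add[symmetric] by (rule arg_cong[where f = exp]) (simp add: algebra_simps)
  have E1: "\<bar>x - c\<bar> \<le> cmod (E 1 x - 1)" if "x \<in> ?J" for x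
  proof -
    have "cmod (E 1 x - 1) = 2 * \<bar>sin (pi * (x - c))\<bar>"
      unfolding E_def dist_exp_i_1 by simp
    then show ?thesis using abs_sin_pi_ge[of "x - c"] that by (simp add: abs_le_iff) argo
  qed
  \<comment> \<open>Numerator and denominator both vanish at \<open>c\<close>, where division by
    zero gives \<open>Q c = 0\<close>; by \<open>E1\<close> the denominator has no other zero in the
    interval.\<close>
  define Q where "Q = (\<lambda>x. (f x - f c) / (E 1 x - 1))"
  have Qm [measurable]: "Q \<in> borel_measurable ?M" unfolding Q_def by measurable
  have Q: "f x - f c = Q x * (E 1 x - 1)" if "x \<in> ?J" for x
    using E1[OF that] by (cases "x = c") (auto simp: Q_def)
  have iQ: "integrable ?M Q"
  proof (rule Bochner_Integration.integrable_bound)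
    \<comment> \<open>Near \<open>c\<close> the quotient is bounded by \<open>B\<close>, at distance
      at least \<open>\<delta>\<close> by the second summand.\<close>
    show "integrable ?M (\<lambda>x. B + cmod (f x - f c) / \<delta>)"
      using f by auto
    show "AE x in ?M. norm (Q x) \<le> norm (B + cmod (f x - f c) / \<delta>)"
    proof (rule AE_I2)
      fix x assume "x \<in> space ?M"
      then have x: "x \<in> ?J" by simp
      have nn: "0 \<le> cmod (f x - f c) / \<delta>" using \<open>\<delta> > 0\<close> by simp
      have "norm (Q x) \<le> B + cmod (f x - f c) / \<delta>"
      proof (cases "x = c")
        case True
        then show ?thesis using B0 by (simp add: Q_def)
      next
        case False
        then have pos: "0 < \<bar>x - c\<bar>" by simp
        have "norm (Q x) = cmod (f x - f c) / cmod (E 1 x - 1)" by (simp add: Q_def norm_divide)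
        also have "\<dots> \<le> cmod (f x - f c) / \<bar>x - c\<bar>"
          using E1[OF x] pos order.strict_trans2[OF pos E1[OF x]]
          by (intro divide_left_mono mult_pos_pos) simp_all
        also have "\<dots> \<le> B + cmod (f x - f c) / \<delta>"
        proof (cases "\<bar>x - c\<bar> < \<delta>")
          case True
          then have "cmod (f x - f c) / \<bar>x - c\<bar> \<le> B" using B[of x] pos by (simp add: pos_divide_le_eq)
          then show ?thesis using nn by linarith
        next
          case False
          then have "cmod (f x - f c) / \<bar>x - c\<bar> \<le> cmod (f x - f c) / \<delta>"
            using \<open>\<delta> > 0\<close> pos by (intro divide_left_mono mult_pos_pos) simp_all
          then show ?thesis using B0 by linarith
        qed
        finally show ?thesis .
      qed
      then show "norm (Q x) \<le> norm (B + cmod (f x - f c) / \<delta>)" by simp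
    qed
  qed simp
  \<comment> \<open>Stated for any frequencies growing in modulus, since the telescoped sum ends
    both in \<open>int M + 1\<close> and in \<open>- int M\<close>.\<close>
  have lim: "(\<lambda>M. LINT x|?M. Q x * E (s M) x) \<longlonglongrightarrow> 0"
    if s: "\<And>M. \<bar>s M\<bar> \<ge> int M" for s :: "nat \<Rightarrow> int"
  proof (rule LIMSEQ_I)
    fix r :: real assume "0 < r"
    from riemann_lebesgue[OF iQ this] obtain L where
      L: "\<And>\<mu>. \<bar>\<mu>\<bar> \<ge> L \<Longrightarrow> cmod (LINT x|?M. Q x * exp (\<i> * of_real (\<mu> * x))) < r" by blast
    show "\<exists>no. \<forall>n\<ge>no. norm ((LINT x|?M. Q x * E (s n) x) - 0) < r"
    proof (intro exI[of _ "nat \<lceil>L\<rceil>"] allI impI)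
      fix n assume n: "nat \<lceil>L\<rceil> \<le> n"
      let ?\<mu> = "2 * pi * of_int (s n) :: real"
      have "L \<le> real n" using n by linarith
      also have "\<dots> \<le> of_int \<bar>s n\<bar>" using s[of n] by linarith
      also have "\<dots> \<le> \<bar>?\<mu>\<bar>" using pi_gt3 mult_right_mono[of 1 "2 * pi" "of_int \<bar>s n\<bar>"] by (simp add: abs_mult)
      finally have "L \<le> \<bar>?\<mu>\<bar>" .
      \<comment> \<open>The centre contributes a factor of modulus one that does not depend on
        \<open>x\<close>.\<close>
      have "E (s n) x = exp (\<i> * of_real (?\<mu> * x)) * exp (\<i> * of_real (- ?\<mu> * c))" for x
        unfolding E_def exp_add[symmetric] by (rule arg_cong[where f = exp]) (simp add: algebra_simps)
      then have "(LINT x|?M. Q x * E (s n) x) =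
          (LINT x|?M. Q x * exp (\<i> * of_real (?\<mu> * x)) * exp (\<i> * of_real (- ?\<mu> * c)))"
        by (simp add: mult.assoc)
      also have "\<dots> = (LINT x|?M. Q x * exp (\<i> * of_real (?\<mu> * x))) * exp (\<i> * of_real (- ?\<mu> * c))"
        by (rule integral_mult_left_zero)
      also have "cmod \<dots> = cmod (LINT x|?M. Q x * exp (\<i> * of_real (?\<mu> * x)))"
        unfolding norm_mult norm_exp_i_times by simp
      also have "\<dots> < r" by (rule L) fact
      finally show "norm ((LINT x|?M. Q x * E (s n) x) - 0) < r" by simp
    qed
  qed
  have eq: "(\<Sum>j\<in>{- int M..int M}. LINT x|?M. f x * E j x) =
      f c + ((LINT x|?M. Q x * E (int M + 1) x) - (LINT x|?M. Q x * E (- int M) x))" for M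
  proof -
    \<comment> \<open>Substituting \<open>f x = f c + Q x * (E 1 x - 1)\<close> turns the
      coefficient into a difference of consecutive coefficients of \<open>Q\<close>; the constant
      \<open>f c\<close> is seen by \<open>j = 0\<close> only.\<close>
    have "(LINT x|?M. f x * E j x) =
        f c * (if j = 0 then 1 else 0) + ((LINT x|?M. Q x * E (j + 1) x) - (LINT x|?M. Q x * E j x))" for j
    proof -
      have "(LINT x|?M. f x * E j x) = (LINT x|?M. f c * E j x + (Q x * E (j + 1) x - Q x * E j x))"
      proof (rule Bochner_Integration.integral_cong[OF refl])
        fix x assume "x \<in> space ?M"
        then have "f x = f c + Q x * (E 1 x - 1)" using Q[of x] by (simp add: algebra_simps)
        then show "f x * E j x = f c * E j x + (Q x * E (j + 1) x - Q x * E j x)"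
          unfolding E_add by algebra
      qed
      also have "\<dots> = (LINT x|?M. f c * E j x) + ((LINT x|?M. Q x * E (j + 1) x) - (LINT x|?M. Q x * E j x))"
        using iE[of "\<lambda>_. f c" j] iE[OF iQ] by simp
      also have "(LINT x|?M. f c * E j x) = f c * (LINT x|?M. E j x)"
        by (rule integral_mult_right_zero)
      also have "(LINT x|?M. E j x) = integral ?J (E j)"
        by (intro lebesgue_integral_eq_integral continuous_imp_integrable_real
            continuous_on_subset[OF contE]) auto
      also have "\<dots> = (if j = 0 then 1 else 0)"
        unfolding E_def by (rule integral_unique[OF integral_exp_period])
      finally show ?thesis .
    qed
    then have "(\<Sum>j\<in>{- int M..int M}. LINT x|?M. f x * E j x) =
        (\<Sum>j\<in>{- int M..int M}. f c * (if j = 0 then 1 else 0)) +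
        (\<Sum>j\<in>{- int M..int M}. (LINT x|?M. Q x * E (j + 1) x) - (LINT x|?M. Q x * E j x))"
      by (simp only: sum.distrib)
    also have "(\<Sum>j\<in>{- int M..int M}. f c * (if j = 0 then 1 else 0)) = f c"
      by (simp add: if_distrib[where f = "\<lambda>x. f c * x"] cong: if_cong)
    finally show ?thesis
      by (simp only: sum_int_telescope[where F = "\<lambda>j. LINT x|?M. Q x * E j x"])
  qed
  have "(\<lambda>M. f c + ((LINT x|?M. Q x * E (int M + 1) x) - (LINT x|?M. Q x * E (- int M) x))) \<longlonglongrightarrow> f c + (0 - 0)"
    by (intro tendsto_intros lim) auto
  then show ?thesis unfolding eq[symmetric] by (simp add: E_def)
qed

text \<open>The interval is cut into \<open>n\<close> unit intervals centred at
  \<open>a + real m\<close>. The exponentials have period one, so they can be recentred on each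
  piece, and Dini's test returns the value of \<open>H\<close> at the centre. In effect
  \<open>H\<close> is periodized without forming the periodization.\<close>

lemma poisson_partial_sums:
  fixes H :: "real \<Rightarrow> complex" and a :: real and n :: nat
  assumes H: "integrable (lebesgue_on {a - 1 / 2..a - 1 / 2 + real n}) H"
    and lip: "\<And>m. m < n \<Longrightarrow> \<exists>\<delta> B. \<delta> > 0 \<and>
      (\<forall>x. \<bar>x - (a + real m)\<bar> < \<delta> \<longrightarrow> cmod (H x - H (a + real m)) \<le> B * \<bar>x - (a + real m)\<bar>)"
  shows "(\<lambda>M. \<Sum>j\<in>{- int M..int M}. LINT x|lebesgue_on {a - 1 / 2..a - 1 / 2 + real n}.
    H x * exp (\<i> * of_real (2 * pi * of_int j * (x - a)))) \<longlonglongrightarrow> (\<Sum>m<n. H (a + real m))"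
  using assms
proof (induction n)
  case 0
  \<comment> \<open>For \<open>n = 0\<close> the interval is not empty but a single point, hence a
    null set.\<close>
  have "(LINT x|lebesgue_on {a - 1 / 2}. g x) = 0" for g :: "real \<Rightarrow> complex"
    by (intro integral_eq_zero_null_sets) (auto simp: null_sets_restrict_space)
  then show ?case by simp
next
  case (Suc n)
  let ?e = "\<lambda>j x. exp (\<i> * of_real (2 * pi * of_int j * (x - a))) :: complex"
  let ?A = "{a - 1 / 2..a - 1 / 2 + real n}"
  let ?c = "a + real n"
  let ?J = "{?c - 1 / 2..?c + 1 / 2}"
  let ?U = "{a - 1 / 2..a - 1 / 2 + real (Suc n)}"
  have sub: "?A \<subseteq> ?U" "?J \<subseteq> ?U" by auto
  have iA: "integrable (lebesgue_on ?A) H" "integrable (lebesgue_on ?J) H"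
    using sub by (auto intro: integrable_subinterval[OF Suc.prems(1)])
  have ie: "integrable (lebesgue_on ?U) (\<lambda>x. H x * ?e j x)" for j
  proof (rule Bochner_Integration.integrable_bound[OF Suc.prems(1)])
    have "continuous_on UNIV (?e j)"
      by (intro continuous_intros)
    then have "?e j \<in> borel_measurable (lebesgue_on ?U)"
      using borel_measurable_continuous_onI
      by (simp add: measurable_completion measurable_restrict_space1)
    then show "(\<lambda>x. H x * ?e j x) \<in> borel_measurable (lebesgue_on ?U)"
      using Suc.prems(1) by (intro borel_measurable_times) auto
  qed (auto simp: norm_mult)
  have split: "(LINT x|lebesgue_on ?U. H x * ?e j x) =
      (LINT x|lebesgue_on ?A. H x * ?e j x) +
      (LINT x|lebesgue_on ?J. H x * exp (\<i> * of_real (2 * pi * of_int j * (x - ?c))))" for j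
  proof -
    have 1: "(LINT x|lebesgue_on ?U. H x * ?e j x) = (LINT x|lebesgue_on ?A. H x * ?e j x) +
        (LINT x|lebesgue_on {a - 1 / 2 + real n..a - 1 / 2 + real (Suc n)}. H x * ?e j x)"
      by (rule Equivalence_Measurable_On_Borel.integral_combine[OF ie]) auto
    have 2: "{a - 1 / 2 + real n..a - 1 / 2 + real (Suc n)} = ?J"
      by (auto simp: algebra_simps)
    have 3: "?e j x = exp (\<i> * of_real (2 * pi * of_int j * (x - ?c)))" for x
    proof -
      \<comment> \<open>Moving the centre by \<open>n\<close> changes the phase by
        \<open>2 * pi * j * n\<close>, a whole number of turns.\<close>
      have "?e j x = exp (\<i> * of_real (2 * pi * of_int j * (x - ?c)) + of_real (2 * of_int (j * int n) * pi) * \<i>)"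
        by (rule arg_cong[where f = exp]) (simp add: algebra_simps)
      also have "\<dots> = exp (\<i> * of_real (2 * pi * of_int j * (x - ?c)))"
        unfolding exp_add using exp_integer_2pi[of "of_int (j * int n)"] by simp
      finally show ?thesis .
    qed
    show ?thesis using 1 unfolding 2 by (simp only: 3)
  qed
  have "(\<lambda>M. \<Sum>j\<in>{- int M..int M}. LINT x|lebesgue_on ?A. H x * ?e j x) \<longlonglongrightarrow> (\<Sum>m<n. H (a + real m))"
    by (rule Suc.IH) (use iA Suc.prems(2) in auto)
  moreover obtain \<delta> B where "\<delta> > 0" "\<And>x. \<bar>x - ?c\<bar> < \<delta> \<Longrightarrow> cmod (H x - H ?c) \<le> B * \<bar>x - ?c\<bar>"
    using Suc.prems(2)[of n] by auto
  then have "(\<lambda>M. \<Sum>j\<in>{- int M..int M}. LINT x|lebesgue_on ?J.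
      H x * exp (\<i> * of_real (2 * pi * of_int j * (x - ?c)))) \<longlonglongrightarrow> H ?c"
    by (rule dini_interval[OF iA(2)])
  ultimately show ?case unfolding split sum.distrib sum.lessThan_Suc by (rule tendsto_add)
qed

section \<open>The Fourier representation of the Bessel function\<close>

text \<open>Recursion in \<open>n\<close>: with \<open>L = x cos \<theta> + s sin \<theta>\<close> one has \<open>L'' = -L\<close> and \<open>L\<^sup>2 + L'\<^sup>2 = x\<^sup>2 + s\<^sup>2\<close>, and the
  derivative of \<open>L' L\<^bsup>2n+1\<^esup>\<close> integrates to zero over a period.\<close>

lemma integral_linear_trig_even_power:
  fixes x s :: real
  shows "((\<lambda>\<theta>. (x * cos \<theta> + s * sin \<theta>) ^ (2 * n)) has_integral
    2 * pi * fact (2 * n) / (4 ^ n * (fact n)\<^sup>2) * (x\<^sup>2 + s\<^sup>2) ^ n) {- pi..pi}"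
proof (induction n)
  case 0
  show ?case using has_integral_const_real[of "1 :: real" "- pi" pi] by simp
next
  case (Suc n)
  define L where "L = (\<lambda>\<theta>. x * cos \<theta> + s * sin \<theta>)"
  define L' where "L' = (\<lambda>\<theta>. s * cos \<theta> - x * sin \<theta>)"
  define I where "I = 2 * pi * fact (2 * n) / (4 ^ n * (fact n)\<^sup>2) * (x\<^sup>2 + s\<^sup>2) ^ n"
  have "((\<lambda>\<theta>. real (2 * n + 1) * (x\<^sup>2 + s\<^sup>2) * L \<theta> ^ (2 * n) - real (2 * n + 2) * L \<theta> ^ (2 * n + 2)) has_integral
      (L' pi * L pi ^ (2 * n + 1) - L' (- pi) * L (- pi) ^ (2 * n + 1))) {- pi..pi}"
  proof (rule fundamental_theorem_of_calculus)
    fix \<theta>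
    have pyth: "(L' \<theta>)\<^sup>2 = x\<^sup>2 + s\<^sup>2 - (L \<theta>)\<^sup>2"
    proof -
      have "(L \<theta>)\<^sup>2 + (L' \<theta>)\<^sup>2 = (x\<^sup>2 + s\<^sup>2) * ((sin \<theta>)\<^sup>2 + (cos \<theta>)\<^sup>2)"
        unfolding L_def L'_def by algebra
      then show ?thesis by simp
    qed
    have "((\<lambda>\<theta>. L' \<theta> * L \<theta> ^ (2 * n + 1)) has_real_derivative
        L' \<theta> * (real (2 * n + 1) * L \<theta> ^ (2 * n) * L' \<theta>) - L \<theta> * L \<theta> ^ (2 * n + 1)) (at \<theta>)"
      unfolding L_def L'_def by (rule derivative_eq_intros refl | simp)+ (simp add: algebra_simps)
    also have "L' \<theta> * (real (2 * n + 1) * L \<theta> ^ (2 * n) * L' \<theta>) - L \<theta> * L \<theta> ^ (2 * n + 1) =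
        real (2 * n + 1) * L \<theta> ^ (2 * n) * (L' \<theta>)\<^sup>2 - L \<theta> ^ (2 * n + 2)"
      by (simp add: power2_eq_square algebra_simps)
    also have "\<dots> = real (2 * n + 1) * (x\<^sup>2 + s\<^sup>2) * L \<theta> ^ (2 * n) - real (2 * n + 2) * L \<theta> ^ (2 * n + 2)"
      unfolding pyth power_add[of _ "2 * n" 2] by (simp add: algebra_simps)
    finally show "((\<lambda>\<theta>. L' \<theta> * L \<theta> ^ (2 * n + 1)) has_vector_derivative
        real (2 * n + 1) * (x\<^sup>2 + s\<^sup>2) * L \<theta> ^ (2 * n) - real (2 * n + 2) * L \<theta> ^ (2 * n + 2))
        (at \<theta> within {- pi..pi})"
      by (simp add: has_real_derivative_iff_has_vector_derivative[symmetric] has_field_derivative_at_within)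
  qed simp
  moreover have "L' pi * L pi ^ (2 * n + 1) - L' (- pi) * L (- pi) ^ (2 * n + 1) = 0"
    by (simp add: L_def L'_def)
  ultimately have "((\<lambda>\<theta>. real (2 * n + 1) * (x\<^sup>2 + s\<^sup>2) * L \<theta> ^ (2 * n) - real (2 * n + 2) * L \<theta> ^ (2 * n + 2)) has_integral 0) {- pi..pi}"
    by simp
  moreover have "((\<lambda>\<theta>. L \<theta> ^ (2 * n)) has_integral I) {- pi..pi}"
    using Suc.IH by (simp add: L_def I_def)
  ultimately have "((\<lambda>\<theta>. real (2 * n + 2) * L \<theta> ^ (2 * n + 2)) has_integral real (2 * n + 1) * (x\<^sup>2 + s\<^sup>2) * I) {- pi..pi}"
    using has_integral_diff[OF has_integral_mult_right, of "\<lambda>\<theta>. L \<theta> ^ (2 * n)" I "{- pi..pi}" _ 0 "real (2 * n + 1) * (x\<^sup>2 + s\<^sup>2)"]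
    by fastforce
  from has_integral_mult_right[OF this, of "1 / real (2 * n + 2)"]
  have "((\<lambda>\<theta>. L \<theta> ^ (2 * n + 2)) has_integral real (2 * n + 1) * (x\<^sup>2 + s\<^sup>2) * I / real (2 * n + 2)) {- pi..pi}"
    by (simp del: of_nat_Suc of_nat_add of_nat_mult add: field_simps)
  moreover have "real (2 * n + 1) * (x\<^sup>2 + s\<^sup>2) * I / real (2 * n + 2) =
      2 * pi * fact (2 * Suc n) / (4 ^ Suc n * (fact (Suc n))\<^sup>2) * (x\<^sup>2 + s\<^sup>2) ^ Suc n"
  proof -
    \<comment> \<open>Consecutive constants have the ratio (2n+1)/(2n+2), because 4 (n+1)^2 =
      (2n+2)^2.\<close>
    have f1: "fact (2 * Suc n) = real (2 * n + 2) * (real (2 * n + 1) * fact (2 * n))"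
      by simp
    have f2: "(fact (Suc n) :: real)\<^sup>2 * 4 = (real (2 * n + 2))\<^sup>2 * (fact n)\<^sup>2"
      by (simp add: power2_eq_square algebra_simps)
    have "2 * pi * fact (2 * Suc n) / (4 ^ Suc n * (fact (Suc n))\<^sup>2) =
        2 * pi * fact (2 * Suc n) / (4 ^ n * ((fact (Suc n))\<^sup>2 * 4))" by (simp add: mult_ac)
    also have "\<dots> = real (2 * n + 1) / real (2 * n + 2) * (2 * pi * fact (2 * n) / (4 ^ n * (fact n)\<^sup>2))"
      unfolding f1 f2 by (simp add: power2_eq_square divide_simps del: of_nat_add of_nat_mult of_nat_Suc)
    finally have e: "2 * pi * fact (2 * Suc n) / (4 ^ Suc n * (fact (Suc n))\<^sup>2) =
        real (2 * n + 1) / real (2 * n + 2) * (2 * pi * fact (2 * n) / (4 ^ n * (fact n)\<^sup>2))" .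
    have "a * r * (Y * r ^ n) / b = a / b * Y * r ^ Suc n" for a b r Y :: real
      by simp
    then show ?thesis unfolding I_def e .
  qed
  ultimately show ?case by (simp add: L_def)
qed

text \<open>The cosine series can be integrated term by term, and the even moments depend on
  \<open>x\<close> and \<open>s\<close> through \<open>x\<^sup>2 + s\<^sup>2\<close> alone. The
  factor \<open>fact (2 * n)\<close> cancels, which leaves the power series in
  \<open>bessel_J\<close>.\<close>

lemma bessel_J0_circle_integral:
  fixes x s :: real
  shows "((\<lambda>\<theta>. cos (x * cos \<theta> + s * sin \<theta>)) has_integral
    2 * pi * bessel_J 0 (sqrt (x\<^sup>2 + s\<^sup>2))) {- pi..pi}"
proof -
  define L where "L = (\<lambda>\<theta>. x * cos \<theta> + s * sin \<theta>)"
  define R where "R = \<bar>x\<bar> + \<bar>s\<bar>"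
  define c where "c = (\<lambda>n. (- 1) ^ n / fact (2 * n) :: real)"
  define f where "f = (\<lambda>N \<theta>. \<Sum>n<N. c n * L \<theta> ^ (2 * n))"
  have LR: "\<bar>L \<theta>\<bar> \<le> R" for \<theta>
  proof -
    have "\<bar>L \<theta>\<bar> \<le> \<bar>x\<bar> * \<bar>cos \<theta>\<bar> + \<bar>s\<bar> * \<bar>sin \<theta>\<bar>"
      unfolding L_def by (metis abs_mult abs_triangle_ineq)
    also have "\<dots> \<le> R" unfolding R_def
      by (intro add_mono mult_left_le abs_cos_le_one abs_sin_le_one) auto
    finally show ?thesis .
  qed
  have "summable (\<lambda>n. inverse (fact n) * R ^ n)" by (rule summable_exp)
  then have sm: "summable (\<lambda>n. inverse (fact (2 * n)) * R ^ (2 * n))"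
    using summable_reindex[of "\<lambda>n. inverse (fact n) * R ^ n" "\<lambda>n. 2 * n"]
    by (auto simp: o_def inj_on_def R_def)
  \<comment> \<open>This is cosh R, a bound for all partial sums at all angles.\<close>
  define K where "K = (\<Sum>n. inverse (fact (2 * n)) * R ^ (2 * n))"
  have int_f: "(f N has_integral (\<Sum>n<N. c n * (2 * pi * fact (2 * n) / (4 ^ n * (fact n)\<^sup>2) * (x\<^sup>2 + s\<^sup>2) ^ n))) {- pi..pi}" for N
    unfolding f_def L_def by (intro has_integral_sum has_integral_mult_right integral_linear_trig_even_power) auto
  have lim: "(\<lambda>N. f N \<theta>) \<longlonglongrightarrow> cos (L \<theta>)" for \<theta>
    using cos_paired[of "L \<theta>"] unfolding sums_def f_def c_def .
  have bound: "norm (f N \<theta>) \<le> K" for N \<theta>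
  proof -
    have "norm (f N \<theta>) \<le> (\<Sum>n<N. \<bar>c n * L \<theta> ^ (2 * n)\<bar>)"
      unfolding f_def real_norm_def by (rule sum_abs)
    also have "\<dots> \<le> (\<Sum>n<N. inverse (fact (2 * n)) * R ^ (2 * n))"
    proof (rule sum_mono)
      fix n
      have "\<bar>L \<theta>\<bar> ^ (2 * n) \<le> R ^ (2 * n)" using LR by (intro power_mono) auto
      moreover have "\<bar>c n\<bar> = inverse (fact (2 * n))"
        by (simp add: c_def abs_mult power_abs divide_inverse)
      ultimately show "\<bar>c n * L \<theta> ^ (2 * n)\<bar> \<le> inverse (fact (2 * n)) * R ^ (2 * n)"
        unfolding abs_mult power_abs by (simp add: mult_left_mono)
    qed
    also have "\<dots> \<le> K" unfolding K_def by (rule sum_le_suminf[OF sm]) (auto simp: R_def)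
    finally show ?thesis .
  qed
  have int: "(\<lambda>\<theta>. cos (L \<theta>)) integrable_on {- pi..pi}"
    unfolding L_def by (intro integrable_continuous_interval continuous_intros)
  have "(\<lambda>N. integral {- pi..pi} (f N)) \<longlonglongrightarrow> integral {- pi..pi} (\<lambda>\<theta>. cos (L \<theta>))"
    by (rule dominated_convergence[where h = "\<lambda>_. K"])
      (use int_f lim bound in \<open>auto intro: has_integral_integrable\<close>)
  then have "(\<lambda>n. c n * (2 * pi * fact (2 * n) / (4 ^ n * (fact n)\<^sup>2) * (x\<^sup>2 + s\<^sup>2) ^ n)) sums
      integral {- pi..pi} (\<lambda>\<theta>. cos (L \<theta>))"
    unfolding sums_def integral_unique[OF int_f] .
  moreover have "c n * (2 * pi * fact (2 * n) / (4 ^ n * (fact n)\<^sup>2) * (x\<^sup>2 + s\<^sup>2) ^ n) =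
      2 * pi * ((- 1) ^ n / (fact n * fact (n + 0)) * (sqrt (x\<^sup>2 + s\<^sup>2) / 2) ^ (2 * n + 0))" for n
  proof -
    have "(sqrt (x\<^sup>2 + s\<^sup>2) / 2) ^ (2 * n + 0) = (x\<^sup>2 + s\<^sup>2) ^ n / 4 ^ n"
      by (simp add: power_mult power_divide)
    then show ?thesis by (simp add: c_def power2_eq_square field_simps)
  qed
  ultimately have "(\<lambda>n. 2 * pi * ((- 1) ^ n / (fact n * fact (n + 0)) * (sqrt (x\<^sup>2 + s\<^sup>2) / 2) ^ (2 * n + 0))) sums
      integral {- pi..pi} (\<lambda>\<theta>. cos (L \<theta>))" by simp
  from sums_mult[OF this, of "1 / (2 * pi)"]
  have "(\<lambda>n. (- 1) ^ n / (fact n * fact (n + 0)) * (sqrt (x\<^sup>2 + s\<^sup>2) / 2) ^ (2 * n + 0)) sums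
      (integral {- pi..pi} (\<lambda>\<theta>. cos (L \<theta>)) / (2 * pi))" by simp
  then have "bessel_J 0 (sqrt (x\<^sup>2 + s\<^sup>2)) = integral {- pi..pi} (\<lambda>\<theta>. cos (L \<theta>)) / (2 * pi)"
    unfolding bessel_J_def by (rule sums_unique[symmetric])
  then show ?thesis using integrable_integral[OF int] by (simp add: L_def)
qed

text \<open>Folding the circle by the reflection \<theta> to -\<theta> turns the cosine of a sum
  into twice a product of cosines; the imaginary part is odd under \<theta> to pi - \<theta> and
  integrates to zero.\<close>

lemma bessel_J0_half_circle_integral:
  fixes x s :: real
  shows "((\<lambda>\<theta>. exp (\<i> * of_real (x * cos \<theta>)) * of_real (cos (s * sin \<theta>))) has_integral
    of_real (pi * bessel_J 0 (sqrt (x\<^sup>2 + s\<^sup>2)))) {0..pi}"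
proof -
  define C where "C = (\<lambda>\<theta>. cos (x * cos \<theta> + s * sin \<theta>))"
  have C: "C integrable_on {a..b}" "(\<lambda>\<theta>. C (- \<theta>)) integrable_on {a..b}" for a b
    unfolding C_def by (intro integrable_continuous_interval continuous_intros)+
  have "integral {- pi..pi} C = integral {- pi..0} C + integral {0..pi} C"
    by (rule Henstock_Kurzweil_Integration.integral_combine[symmetric]) (use C in auto)
  also have "integral {- pi..0} C = integral {0..pi} (\<lambda>\<theta>. C (- \<theta>))"
    using Henstock_Kurzweil_Integration.integral_reflect_real[of pi 0 "\<lambda>\<theta>. C (- \<theta>)"] by simp
  also have "integral {0..pi} (\<lambda>\<theta>. C (- \<theta>)) + integral {0..pi} C = integral {0..pi} (\<lambda>\<theta>. C (- \<theta>) + C \<theta>)"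
    by (rule Henstock_Kurzweil_Integration.integral_add[symmetric]) (rule C)+
  also have "(\<lambda>\<theta>. C (- \<theta>) + C \<theta>) = (\<lambda>\<theta>. 2 * (cos (x * cos \<theta>) * cos (s * sin \<theta>)))"
    by (simp add: C_def fun_eq_iff cos_add cos_diff)
  also have "integral {0..pi} \<dots> = 2 * integral {0..pi} (\<lambda>\<theta>. cos (x * cos \<theta>) * cos (s * sin \<theta>))"
    by simp
  finally have "integral {0..pi} (\<lambda>\<theta>. cos (x * cos \<theta>) * cos (s * sin \<theta>)) = pi * bessel_J 0 (sqrt (x\<^sup>2 + s\<^sup>2))"
    using integral_unique[OF bessel_J0_circle_integral[of x s]] by (simp add: C_def)
  moreover have "(\<lambda>\<theta>. cos (x * cos \<theta>) * cos (s * sin \<theta>)) integrable_on {0..pi}"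
    by (intro integrable_continuous_interval continuous_intros)
  ultimately have re: "((\<lambda>\<theta>. cos (x * cos \<theta>) * cos (s * sin \<theta>)) has_integral pi * bessel_J 0 (sqrt (x\<^sup>2 + s\<^sup>2))) {0..pi}"
    by (metis integrable_integral)
  define S where "S = (\<lambda>\<theta>. sin (x * cos \<theta>) * cos (s * sin \<theta>))"
  have S: "S integrable_on {0..pi}"
    unfolding S_def by (intro integrable_continuous_interval continuous_intros)
  \<comment> \<open>A reflection at 0 followed by a shift by \<open>pi\<close> reflects the interval
    at its midpoint.\<close>
  have "integral {0..pi} S = integral {- pi..0} (\<lambda>\<theta>. S (- \<theta>))"
    using Henstock_Kurzweil_Integration.integral_reflect_real[of pi 0 S] by simp
  also have "\<dots> = integral {0..pi} (\<lambda>\<theta>. S (pi - \<theta>))"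
    using integral_shift_Icc_real[of 0 pi "\<lambda>\<theta>. S (- \<theta>)" "- pi"] by (simp add: o_def)
  also have "(\<lambda>\<theta>. S (pi - \<theta>)) = (\<lambda>\<theta>. - S \<theta>)"
    by (simp add: S_def fun_eq_iff)
  finally have "integral {0..pi} S = 0" by simp
  then have im: "(S has_integral 0) {0..pi}" using S by (metis integrable_integral)
  have "((\<lambda>\<theta>. of_real (cos (x * cos \<theta>) * cos (s * sin \<theta>)) + \<i> * of_real (S \<theta>)) has_integral
      of_real (pi * bessel_J 0 (sqrt (x\<^sup>2 + s\<^sup>2))) + \<i> * of_real 0) {0..pi}"
    by (intro has_integral_add has_integral_mult_right has_integral_of_real re im)
  then show ?thesis
    by (simp add: S_def exp_Euler cos_of_real sin_of_real algebra_simps flip: of_real_mult)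
qed

section \<open>The density on the frequency axis and its Poisson sum\<close>

lemma propagating_iff:
  assumes "k > 0"
  shows "j \<in> propagating k \<alpha> \<longleftrightarrow> \<bar>alpha_j \<alpha> j\<bar> < k"
proof -
  have "\<bar>alpha_j \<alpha> j\<bar> < k \<longleftrightarrow> (alpha_j \<alpha> j)\<^sup>2 < k\<^sup>2"
    using abs_le_square_iff[of k "alpha_j \<alpha> j"] assms by (auto simp flip: not_le)
  moreover have "beta_j k \<alpha> j \<in> \<real> \<and> Re (beta_j k \<alpha> j) > 0 \<longleftrightarrow> (alpha_j \<alpha> j)\<^sup>2 < k\<^sup>2"
    by (auto simp: beta_j_def complex_is_Real_iff)
  ultimately show ?thesis by (simp add: propagating_def)
qed

lemma beta_j_propagating:
  assumes "k > 0" "j \<in> propagating k \<alpha>"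
  shows "beta_j k \<alpha> j = of_real (sqrt (k\<^sup>2 - (alpha_j \<alpha> j)\<^sup>2))" "k\<^sup>2 - (alpha_j \<alpha> j)\<^sup>2 > 0"
proof -
  have "(alpha_j \<alpha> j)\<^sup>2 < k\<^sup>2"
    using assms propagating_iff[OF assms(1)] power_strict_mono[of "\<bar>alpha_j \<alpha> j\<bar>" k 2] by simp
  then show "beta_j k \<alpha> j = of_real (sqrt (k\<^sup>2 - (alpha_j \<alpha> j)\<^sup>2))" "k\<^sup>2 - (alpha_j \<alpha> j)\<^sup>2 > 0"
    by (auto simp: beta_j_def)
qed

text \<open>At a propagating frequency \<open>alpha_j \<alpha> j\<close> the value is the cosine of
  \<open>s\<close> times \<open>beta_j\<close>, divided by \<open>beta_j\<close>. The extension by 0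
  allows sampling at all shifted frequencies, of which only the propagating ones then count.\<close>

definition bessel_density :: "real \<Rightarrow> real \<Rightarrow> real \<Rightarrow> complex" where
  "bessel_density k s \<xi> =
     (if \<bar>\<xi>\<bar> < k then of_real (cos (s * sqrt (k\<^sup>2 - \<xi>\<^sup>2)) / sqrt (k\<^sup>2 - \<xi>\<^sup>2)) else 0)"

text \<open>The substitution \<open>\<xi> = k * cos \<theta>\<close> removes the singularity:
  \<open>sqrt (k\<^sup>2 - \<xi>\<^sup>2)\<close> becomes \<open>k * sin \<theta>\<close>, which is
  also the modulus of the Jacobian. The half-circle integral remains.\<close>

lemma bessel_J0_fourier:
  assumes "k > 0"
  shows "(\<lambda>\<xi>. bessel_density k s \<xi> * exp (\<i> * of_real (\<xi> * x))) absolutely_integrable_on {- k<..<k}"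
    "integral {- k<..<k} (\<lambda>\<xi>. bessel_density k s \<xi> * exp (\<i> * of_real (\<xi> * x))) =
      of_real (pi * bessel_J 0 (k * sqrt (x\<^sup>2 + s\<^sup>2)))"
proof -
  let ?f = "\<lambda>\<xi>. bessel_density k s \<xi> * exp (\<i> * of_real (\<xi> * x))"
  let ?S = "{0<..<pi}"
  let ?g = "\<lambda>\<theta>. k * cos \<theta>"
  let ?F = "\<lambda>\<theta>. exp (\<i> * of_real (k * x * cos \<theta>)) * of_real (cos (k * s * sin \<theta>)) :: complex"
  have lt: "\<bar>?g \<theta>\<bar> < k" if "\<theta> \<in> ?S" for \<theta>
  proof -
    have "cos \<theta> < cos 0" "cos pi < cos \<theta>"
      using that by (intro cos_monotone_0_pi; simp)+
    then have "\<bar>cos \<theta>\<bar> < 1" by auto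
    then show ?thesis using assms by (simp add: abs_mult)
  qed
  have img: "?g ` ?S = {- k<..<k}"
  proof (intro set_eqI iffI)
    fix y assume "y \<in> ?g ` ?S"
    then have "\<bar>y\<bar> < k" using lt by auto
    then show "y \<in> {- k<..<k}" by auto
  next
    fix y assume "y \<in> {- k<..<k}"
    then have y: "- 1 < y / k" "y / k < 1" using assms by (auto simp: field_simps)
    then have "0 < arccos (y / k)" "arccos (y / k) < pi" using arccos_lt_bounded by blast+
    moreover have "y = k * cos (arccos (y / k))" using y assms by (simp add: cos_arccos)
    ultimately show "y \<in> ?g ` ?S" by auto
  qed
  have eq: "\<bar>- k * sin \<theta>\<bar> *\<^sub>R ?f (?g \<theta>) = ?F \<theta>" if "\<theta> \<in> ?S" for \<theta>
  proof -
    have sin: "sin \<theta> > 0" using that by (intro sin_gt_zero) auto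
    have "k\<^sup>2 - (k * cos \<theta>)\<^sup>2 = (k * sin \<theta>)\<^sup>2"
      by (simp add: power_mult_distrib sin_squared_eq algebra_simps)
    then have sq: "sqrt (k\<^sup>2 - (k * cos \<theta>)\<^sup>2) = k * sin \<theta>"
      using sin assms by simp
    have "bessel_density k s (k * cos \<theta>) = of_real (cos (s * (k * sin \<theta>)) / (k * sin \<theta>))"
      using lt[OF that] unfolding bessel_density_def sq by simp
    then show ?thesis
      using sin assms by (simp add: scaleR_conv_of_real abs_mult mult_ac)
  qed
  have F: "(?F has_integral of_real (pi * bessel_J 0 (k * sqrt (x\<^sup>2 + s\<^sup>2)))) {0..pi}"
  proof -
    have "sqrt ((k * x)\<^sup>2 + (k * s)\<^sup>2) = sqrt (k\<^sup>2 * (x\<^sup>2 + s\<^sup>2))"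
      by (simp add: power_mult_distrib algebra_simps)
    also have "\<dots> = k * sqrt (x\<^sup>2 + s\<^sup>2)" using assms by (simp add: real_sqrt_mult)
    finally show ?thesis using bessel_J0_half_circle_integral[of "k * x" "k * s"] by simp
  qed
  have "?F absolutely_integrable_on {0..pi}"
    by (intro absolutely_integrable_continuous_real continuous_intros)
  \<comment> \<open>At the end points the left side of \<open>eq\<close> is 0 while
    \<open>?F\<close> is not, hence the passage to the open interval.\<close>
  then have "?F absolutely_integrable_on ?S"
    by (simp add: absolutely_integrable_on_Icc_iff_Ioo)
  then have 1: "(\<lambda>\<theta>. \<bar>- k * sin \<theta>\<bar> *\<^sub>R ?f (?g \<theta>)) absolutely_integrable_on ?S"
    by (rule absolutely_integrable_spike[where S = "{}"]) (use eq in auto)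
  have "integral ?S (\<lambda>\<theta>. \<bar>- k * sin \<theta>\<bar> *\<^sub>R ?f (?g \<theta>)) = integral ?S ?F"
    using eq by (intro Henstock_Kurzweil_Integration.integral_cong)
  also have "\<dots> = integral {0..pi} ?F"
    by (rule integral_open_interval_real[symmetric])
  also have "\<dots> = of_real (pi * bessel_J 0 (k * sqrt (x\<^sup>2 + s\<^sup>2)))"
    using F by (rule integral_unique)
  finally have 2: "integral ?S (\<lambda>\<theta>. \<bar>- k * sin \<theta>\<bar> *\<^sub>R ?f (?g \<theta>)) = of_real (pi * bessel_J 0 (k * sqrt (x\<^sup>2 + s\<^sup>2)))" .
  have "?f absolutely_integrable_on (?g ` ?S) \<and> integral (?g ` ?S) ?f = of_real (pi * bessel_J 0 (k * sqrt (x\<^sup>2 + s\<^sup>2)))"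
  proof (subst has_absolute_integral_change_of_variables_real[symmetric, where h = "\<lambda>\<theta>. - k * sin \<theta>"])
    show "inj_on ?g ?S"
      using assms by (auto simp: inj_on_def intro: cos_inj_pi)
    show "(?g has_field_derivative - k * sin \<theta>) (at \<theta> within ?S)" for \<theta>
      by (auto intro!: derivative_eq_intros)
  qed (use 1 2 in auto)
  then show "?f absolutely_integrable_on {- k<..<k}"
    "integral {- k<..<k} ?f = of_real (pi * bessel_J 0 (k * sqrt (x\<^sup>2 + s\<^sup>2)))"
    unfolding img by auto
qed

lemma LINT_bessel_density:
  assumes "k > 0" and sub: "{- k<..<k} \<subseteq> {A..B}"
  shows "integrable (lebesgue_on {A..B}) (\<lambda>\<xi>. bessel_density k s \<xi> * exp (\<i> * of_real (\<xi> * x)))"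
    "(LINT \<xi>|lebesgue_on {A..B}. bessel_density k s \<xi> * exp (\<i> * of_real (\<xi> * x))) =
      of_real (pi * bessel_J 0 (k * sqrt (x\<^sup>2 + s\<^sup>2)))"
proof -
  let ?f = "\<lambda>\<xi>. bessel_density k s \<xi> * exp (\<i> * of_real (\<xi> * x))"
  have ind: "indicat_real {A..B} \<xi> *\<^sub>R ?f \<xi> = indicat_real {- k<..<k} \<xi> *\<^sub>R ?f \<xi>" for \<xi>
  proof (cases "\<bar>\<xi>\<bar> < k")
    case True
    then have "\<xi> \<in> {- k<..<k}" by auto
    then show ?thesis using sub by (simp add: subset_iff)
  qed (simp add: bessel_density_def)
  have "integrable lebesgue (\<lambda>\<xi>. indicat_real {A..B} \<xi> *\<^sub>R ?f \<xi>)"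
    unfolding ind using bessel_J0_fourier(1)[OF assms(1)] unfolding set_integrable_def .
  then show "integrable (lebesgue_on {A..B}) ?f"
    by (simp add: integrable_restrict_space)
  have "(LINT \<xi>|lebesgue_on {A..B}. ?f \<xi>) = (LINT \<xi>|lebesgue. indicat_real {A..B} \<xi> *\<^sub>R ?f \<xi>)"
    by (simp add: integral_restrict_space)
  also have "\<dots> = (LINT \<xi>:{- k<..<k}|lebesgue. ?f \<xi>)"
    unfolding ind set_lebesgue_integral_def ..
  also have "\<dots> = integral {- k<..<k} ?f"
    by (rule set_lebesgue_integral_eq_integral(2)[OF bessel_J0_fourier(1)[OF assms(1)]])
  finally show "(LINT \<xi>|lebesgue_on {A..B}. ?f \<xi>) = of_real (pi * bessel_J 0 (k * sqrt (x\<^sup>2 + s\<^sup>2)))"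
    using bessel_J0_fourier(2)[OF assms(1)] by simp
qed

text \<open>Beyond \<open>k\<close> in modulus the density vanishes near \<open>c\<close>; inside it
  is differentiable at \<open>c\<close>. Near the excluded points it is unbounded; in the
  application they are the frequencies with \<open>beta_j k \<alpha> j = 0\<close>.\<close>

lemma bessel_density_lipschitz:
  assumes "k > 0" "\<bar>c\<bar> \<noteq> k"
  shows "\<exists>\<delta> B. \<delta> > 0 \<and> (\<forall>\<xi>. \<bar>\<xi> - c\<bar> < \<delta> \<longrightarrow>
    cmod (bessel_density k s \<xi> * exp (\<i> * of_real (\<xi> * x)) - bessel_density k s c * exp (\<i> * of_real (c * x)))
      \<le> B * \<bar>\<xi> - c\<bar>)"
proof (cases "\<bar>c\<bar> < k")
  case False
  then have "\<bar>c\<bar> - k > 0" using assms by auto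
  moreover have "bessel_density k s \<xi> = 0" if "\<bar>\<xi> - c\<bar> < \<bar>c\<bar> - k" for \<xi>
    using that False by (auto simp: bessel_density_def)
  moreover have "bessel_density k s c = 0" using False by (simp add: bessel_density_def)
  ultimately show ?thesis by (intro exI[of _ "\<bar>c\<bar> - k"] exI[of _ 0]) auto
next
  case True
  let ?h = "\<lambda>\<xi>. of_real (cos (s * sqrt (k\<^sup>2 - \<xi>\<^sup>2)) / sqrt (k\<^sup>2 - \<xi>\<^sup>2)) * exp (\<i> * of_real (\<xi> * x)) :: complex"
  have pos: "k\<^sup>2 - c\<^sup>2 > 0"
    using power_strict_mono[OF True, of 2] by simp
  have "\<exists>D. ((\<lambda>\<xi>. cos (s * sqrt (k\<^sup>2 - \<xi>\<^sup>2)) / sqrt (k\<^sup>2 - \<xi>\<^sup>2)) has_real_derivative D) (at c)"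
    using pos by (auto intro!: derivative_eq_intros exI)
  then obtain D1 where "((\<lambda>\<xi>. cos (s * sqrt (k\<^sup>2 - \<xi>\<^sup>2)) / sqrt (k\<^sup>2 - \<xi>\<^sup>2)) has_real_derivative D1) (at c)"
    by blast
  then have D1: "((\<lambda>\<xi>. of_real (cos (s * sqrt (k\<^sup>2 - \<xi>\<^sup>2)) / sqrt (k\<^sup>2 - \<xi>\<^sup>2)) :: complex) has_vector_derivative of_real D1) (at c)"
    by (intro has_vector_derivative_of_real) (simp add: has_real_derivative_iff_has_vector_derivative)
  have "((\<lambda>\<xi>. exp (\<i> * of_real x * of_real \<xi>)) has_vector_derivative \<i> * of_real x * exp (\<i> * of_real x * of_real c)) (at c)"
    by (rule has_vector_derivative_real_field derivative_eq_intros refl | simp)+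
  then have "((\<lambda>\<xi>. exp (\<i> * of_real (\<xi> * x))) has_vector_derivative \<i> * of_real x * exp (\<i> * of_real x * of_real c)) (at c)"
    by (simp add: mult_ac)
  from has_vector_derivative_mult[OF D1 this] obtain D where D: "(?h has_vector_derivative D) (at c)"
    by blast
  then obtain \<delta> where "\<delta> > 0" and \<delta>: "\<And>\<xi>. \<bar>\<xi> - c\<bar> < \<delta> \<Longrightarrow> cmod (?h \<xi> - ?h c - (\<xi> - c) *\<^sub>R D) \<le> 1 * \<bar>\<xi> - c\<bar>"
    unfolding has_vector_derivative_def has_derivative_at_alt real_norm_def
    by (metis zero_less_one)
  show ?thesis
  \<comment> \<open>The second entry of the minimum keeps \<open>\<xi>\<close> where the density is
    given by \<open>?h\<close>; the slope is that of the derivative plus 1 for the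
    remainder.\<close>
  proof (rule exI[of _ "min \<delta> (k - \<bar>c\<bar>)"], rule exI[of _ "1 + cmod D"], intro conjI allI impI)
    fix \<xi> assume \<xi>: "\<bar>\<xi> - c\<bar> < min \<delta> (k - \<bar>c\<bar>)"
    then have "\<bar>\<xi>\<bar> < k" by auto
    have "cmod (?h \<xi> - ?h c) \<le> cmod (?h \<xi> - ?h c - (\<xi> - c) *\<^sub>R D) + cmod ((\<xi> - c) *\<^sub>R D)"
      by (rule norm_triangle_sub[of "?h \<xi> - ?h c" "(\<xi> - c) *\<^sub>R D", unfolded add.commute[of "cmod ((\<xi> - c) *\<^sub>R D)"]])
    also have "\<dots> \<le> 1 * \<bar>\<xi> - c\<bar> + cmod ((\<xi> - c) *\<^sub>R D)"
      using \<delta>[of \<xi>] \<xi> by (intro add_right_mono) auto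
    also have "\<dots> = (1 + cmod D) * \<bar>\<xi> - c\<bar>"
      unfolding norm_scaleR real_norm_def by algebra
    finally show "cmod (bessel_density k s \<xi> * exp (\<i> * of_real (\<xi> * x)) - bessel_density k s c * exp (\<i> * of_real (c * x)))
      \<le> (1 + cmod D) * \<bar>\<xi> - c\<bar>"
      using \<open>\<bar>\<xi>\<bar> < k\<close> True by (simp add: bessel_density_def)
  qed (use \<open>\<delta> > 0\<close> True in auto)
qed

text \<open>Multiplying the density by exp(2 pi i j \<xi>) shifts the argument of its transform by 2
  pi j, which produces the translates of J_0; measuring frequencies from \<open>\<alpha>\<close>
  produces the quasiperiodicity factors.\<close>

lemma bessel_quasiperiodic_sum:
  assumes "k > 0" and beta: "\<And>j. beta_j k \<alpha> j \<noteq> 0"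
  shows "(\<lambda>M. \<Sum>j\<in>{- int M..int M}. exp (- \<i> * of_real (2 * pi * of_int j * \<alpha>)) *
      of_real (bessel_J 0 (k * sqrt ((t + 2 * of_int j * pi)\<^sup>2 + s\<^sup>2)))) \<longlonglongrightarrow>
    (\<Sum>j\<in>propagating k \<alpha>. exp (\<i> * of_real (alpha_j \<alpha> j * t)) * cos (beta_j k \<alpha> j * of_real s) / (of_real pi * beta_j k \<alpha> j))"
proof -
  \<comment> \<open>Large enough for the \<open>2 * L + 1\<close> unit intervals around
    \<open>\<alpha> - L\<close>, ..., \<open>\<alpha> + L\<close> to cover the support of the
    density, and for all propagating indices to lie between \<open>- L\<close> and
    \<open>L\<close>.\<close>
  define L where "L = nat \<lceil>\<bar>\<alpha>\<bar> + k\<rceil> + 1"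
  have L: "\<bar>\<alpha>\<bar> + k \<le> real L" unfolding L_def by linarith
  let ?n = "2 * L + 1"
  let ?a = "\<alpha> - real L"
  let ?I = "{?a - 1 / 2..?a - 1 / 2 + real ?n}"
  let ?H = "\<lambda>\<xi>. bessel_density k s \<xi> * exp (\<i> * of_real (\<xi> * t))"
  have sub: "{- k<..<k} \<subseteq> ?I" using L by auto
  have ne: "\<bar>alpha_j \<alpha> j\<bar> \<noteq> k" for j
    using beta[of j] by (auto simp: beta_j_def)
  have shift: "?a + real m = alpha_j \<alpha> (int m - int L)" for m
    by (simp add: alpha_j_def)
  have "(\<lambda>M. \<Sum>j\<in>{- int M..int M}. LINT \<xi>|lebesgue_on ?I.
    ?H \<xi> * exp (\<i> * of_real (2 * pi * of_int j * (\<xi> - ?a)))) \<longlonglongrightarrow> (\<Sum>m<?n. ?H (?a + real m))"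
  proof (rule poisson_partial_sums)
    show "integrable (lebesgue_on ?I) ?H"
      by (rule LINT_bessel_density(1)[OF \<open>k > 0\<close> sub])
  next
    fix m
    show "\<exists>\<delta> B. \<delta> > 0 \<and> (\<forall>x. \<bar>x - (?a + real m)\<bar> < \<delta> \<longrightarrow> cmod (?H x - ?H (?a + real m)) \<le> B * \<bar>x - (?a + real m)\<bar>)"
      by (rule bessel_density_lipschitz[OF \<open>k > 0\<close>]) (simp only: shift ne not_False_eq_True)
  qed
  moreover have "(LINT \<xi>|lebesgue_on ?I. ?H \<xi> * exp (\<i> * of_real (2 * pi * of_int j * (\<xi> - ?a)))) =
      of_real pi * (exp (- \<i> * of_real (2 * pi * of_int j * \<alpha>)) *
      of_real (bessel_J 0 (k * sqrt ((t + 2 * of_int j * pi)\<^sup>2 + s\<^sup>2))))" for j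
  proof -
    have "?H \<xi> * exp (\<i> * of_real (2 * pi * of_int j * (\<xi> - ?a))) =
        exp (- \<i> * of_real (2 * pi * of_int j * \<alpha>)) *
        (bessel_density k s \<xi> * exp (\<i> * of_real (\<xi> * (t + 2 * of_int j * pi))))" for \<xi>
    proof -
      \<comment> \<open>The base point \<open>?a\<close> differs from \<open>\<alpha>\<close> by the
        integer \<open>L\<close>, which costs only a multiple of 2 pi in the phase.\<close>
      have "exp (\<i> * of_real (\<xi> * t)) * exp (\<i> * of_real (2 * pi * of_int j * (\<xi> - ?a))) =
          exp (- \<i> * of_real (2 * pi * of_int j * \<alpha>) + \<i> * of_real (\<xi> * (t + 2 * of_int j * pi)) +
            of_real (2 * of_int (j * int L) * pi) * \<i>)"
        unfolding exp_add[symmetric] by (rule arg_cong[where f = exp]) (simp add: algebra_simps)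
      also have "\<dots> = exp (- \<i> * of_real (2 * pi * of_int j * \<alpha>)) * exp (\<i> * of_real (\<xi> * (t + 2 * of_int j * pi)))"
        unfolding exp_add using exp_integer_2pi[of "of_int (j * int L)"] by simp
      finally have e: "exp (\<i> * of_real (\<xi> * t)) * exp (\<i> * of_real (2 * pi * of_int j * (\<xi> - ?a))) =
          exp (- \<i> * of_real (2 * pi * of_int j * \<alpha>)) * exp (\<i> * of_real (\<xi> * (t + 2 * of_int j * pi)))" .
      show ?thesis unfolding mult.assoc[of "bessel_density k s \<xi>"] e by (rule mult.left_commute)
    qed
    then have "(LINT \<xi>|lebesgue_on ?I. ?H \<xi> * exp (\<i> * of_real (2 * pi * of_int j * (\<xi> - ?a)))) =
        exp (- \<i> * of_real (2 * pi * of_int j * \<alpha>)) *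
        (LINT \<xi>|lebesgue_on ?I. bessel_density k s \<xi> * exp (\<i> * of_real (\<xi> * (t + 2 * of_int j * pi))))"
      by (simp only: integral_mult_right_zero)
    then show ?thesis
      unfolding LINT_bessel_density(2)[OF \<open>k > 0\<close> sub] by (simp add: mult_ac)
  qed
  moreover have "(\<Sum>m<?n. ?H (?a + real m)) = of_real pi * (\<Sum>j\<in>propagating k \<alpha>.
      exp (\<i> * of_real (alpha_j \<alpha> j * t)) * cos (beta_j k \<alpha> j * of_real s) / (of_real pi * beta_j k \<alpha> j))"
  proof -
    have "(\<Sum>m<?n. ?H (?a + real m)) = (\<Sum>j\<in>{- int L..int L}. ?H (alpha_j \<alpha> j))"
      unfolding shift
      by (rule sum.reindex_bij_witness[where i = "\<lambda>j. nat (j + int L)" and j = "\<lambda>m. int m - int L"]) auto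
    also have "\<dots> = (\<Sum>j\<in>propagating k \<alpha>. ?H (alpha_j \<alpha> j))"
    proof (rule sum.mono_neutral_right)
      show "propagating k \<alpha> \<subseteq> {- int L..int L}"
      proof
        fix j assume "j \<in> propagating k \<alpha>"
        then have "\<bar>\<alpha> + of_int j\<bar> < k" using propagating_iff[OF \<open>k > 0\<close>] by (simp add: alpha_j_def)
        then have "\<bar>real_of_int j\<bar> \<le> real L" using L by linarith
        then show "j \<in> {- int L..int L}" by auto
      qed
    qed (use propagating_iff[OF \<open>k > 0\<close>] in \<open>auto simp: bessel_density_def\<close>)
    also have "\<dots> = (\<Sum>j\<in>propagating k \<alpha>. of_real pi * (exp (\<i> * of_real (alpha_j \<alpha> j * t)) * cos (beta_j k \<alpha> j * of_real s) / (of_real pi * beta_j k \<alpha> j)))"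
    proof (rule sum.cong[OF refl])
      fix j assume j: "j \<in> propagating k \<alpha>"
      have "cos (beta_j k \<alpha> j * of_real s) = of_real (cos (s * sqrt (k\<^sup>2 - (alpha_j \<alpha> j)\<^sup>2)))"
        unfolding beta_j_propagating(1)[OF \<open>k > 0\<close> j] of_real_mult[symmetric] cos_of_real by (simp only: mult.commute)
      moreover have "\<bar>alpha_j \<alpha> j\<bar> < k" using j propagating_iff[OF \<open>k > 0\<close>] by simp
      ultimately show "?H (alpha_j \<alpha> j) = of_real pi * (exp (\<i> * of_real (alpha_j \<alpha> j * t)) * cos (beta_j k \<alpha> j * of_real s) / (of_real pi * beta_j k \<alpha> j))"
        unfolding bessel_density_def using beta_j_propagating(1)[OF \<open>k > 0\<close> j] by simp
    qed
    finally show ?thesis by (simp only: sum_distrib_left)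
  qed
  ultimately have "(\<lambda>M. of_real pi * (\<Sum>j\<in>{- int M..int M}. exp (- \<i> * of_real (2 * pi * of_int j * \<alpha>)) *
      of_real (bessel_J 0 (k * sqrt ((t + 2 * of_int j * pi)\<^sup>2 + s\<^sup>2))))) \<longlonglongrightarrow>
    of_real pi * (\<Sum>j\<in>propagating k \<alpha>. exp (\<i> * of_real (alpha_j \<alpha> j * t)) * cos (beta_j k \<alpha> j * of_real s) / (of_real pi * beta_j k \<alpha> j))"
    by (simp only: sum_distrib_left)
  from tendsto_mult_left[OF this, of "1 / of_real pi"] show ?thesis by simp
qed

text \<open>The term with index 0 is J_0 of \<open>k * norm (z - y)\<close>; adding it completes the
  punctured partial sums to the symmetric ones. Convergence is recorded too, because
  \<open>lim\<close> also has a value on divergent sequences.\<close>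

lemma w_partial_limit:
  assumes "k > 0" and beta: "\<And>j. beta_j k \<alpha> j \<noteq> 0"
  defines "K \<equiv> \<lambda>z y. \<Sum>j\<in>propagating k \<alpha>. exp (\<i> * of_real (alpha_j \<alpha> j * (fst z - fst y))) *
    cos (beta_j k \<alpha> j * of_real (snd z - snd y)) / (of_real pi * beta_j k \<alpha> j)"
  shows "convergent (w_partial k \<alpha> z y)"
    "of_real (bessel_J 0 (k * norm (z - y))) + w_alpha k \<alpha> z y = K z y"
proof -
  have J0: "k * sqrt ((fst z - fst y)\<^sup>2 + (snd z - snd y)\<^sup>2) = k * norm (z - y)"
    by (simp add: norm_prod_def)
  have "w_partial k \<alpha> z y M = (\<Sum>j\<in>{- int M..int M}. exp (- \<i> * of_real (2 * pi * of_int j * \<alpha>)) *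
      of_real (bessel_J 0 (k * sqrt ((fst z - fst y + 2 * of_int j * pi)\<^sup>2 + (snd z - snd y)\<^sup>2))))
      - of_real (bessel_J 0 (k * norm (z - y)))" for M
  proof -
    have "{- int M..int M} = insert 0 {j. 0 < \<bar>j\<bar> \<and> \<bar>j\<bar> \<le> int M}" by auto
    moreover have "finite {j. 0 < \<bar>j\<bar> \<and> \<bar>j\<bar> \<le> int M}"
      by (rule finite_subset[of _ "{- int M..int M}"]) auto
    ultimately show ?thesis by (simp add: w_partial_def J0)
  qed
  then have "w_partial k \<alpha> z y = (\<lambda>M. (\<Sum>j\<in>{- int M..int M}. exp (- \<i> * of_real (2 * pi * of_int j * \<alpha>)) *
      of_real (bessel_J 0 (k * sqrt ((fst z - fst y + 2 * of_int j * pi)\<^sup>2 + (snd z - snd y)\<^sup>2))))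
      - of_real (bessel_J 0 (k * norm (z - y))))"
    by (rule ext)
  then have "w_partial k \<alpha> z y \<longlonglongrightarrow> K z y - of_real (bessel_J 0 (k * norm (z - y)))"
    unfolding K_def
    by (simp only:) (rule tendsto_diff[OF bessel_quasiperiodic_sum[OF assms(1,2)] tendsto_const])
  then show "convergent (w_partial k \<alpha> z y)"
    "of_real (bessel_J 0 (k * norm (z - y))) + w_alpha k \<alpha> z y = K z y"
    by (auto simp: convergent_def w_alpha_def dest: limI)
qed

section \<open>Smooth cutoff functions\<close>

text \<open>One-dimensional counterpart of \<^const>\<open>C_k\<close>.\<close>

primrec D_k :: "nat \<Rightarrow> (real \<Rightarrow> complex) \<Rightarrow> bool" where
  "D_k 0 f \<longleftrightarrow> continuous_on UNIV f"
| "D_k (Suc m) f \<longleftrightarrow> (\<exists>f'. (\<forall>x. (f has_vector_derivative f' x) (at x)) \<and> D_k m f')"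

definition smooth :: "(real \<Rightarrow> complex) \<Rightarrow> bool" where
  "smooth f \<longleftrightarrow> (\<forall>m. D_k m f)"

lemma D_k_SucI: "(\<And>x. (f has_vector_derivative f' x) (at x)) \<Longrightarrow> D_k m f' \<Longrightarrow> D_k (Suc m) f"
  by auto

lemma has_vector_derivative_imp_continuous_on:
  "(\<And>x. (f has_vector_derivative f' x) (at x)) \<Longrightarrow> continuous_on UNIV f"
  by (intro continuous_at_imp_continuous_on ballI) (rule has_vector_derivative_continuous)

lemma D_k_imp_continuous: "D_k m f \<Longrightarrow> continuous_on UNIV f"
  by (cases m) (auto intro: has_vector_derivative_imp_continuous_on)

lemma D_k_Suc: "D_k (Suc m) f \<Longrightarrow> D_k m f"
proof (induction m arbitrary: f)
  case 0
  then show ?case using D_k_imp_continuous[of 1 f] by simp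
next
  case (Suc m)
  then obtain f' where "\<forall>x. (f has_vector_derivative f' x) (at x)" "D_k (Suc m) f'"
    using D_k.simps(2)[of "Suc m" f] by blast
  then show ?case using Suc.IH[of f'] by auto
qed

lemma D_k_add: "D_k m f \<Longrightarrow> D_k m g \<Longrightarrow> D_k m (\<lambda>x. f x + g x)"
proof (induction m arbitrary: f g)
  case 0
  then show ?case by (auto intro: continuous_on_add)
next
  case (Suc m)
  from Suc.prems obtain f' g' where
    "\<And>x. (f has_vector_derivative f' x) (at x)" "D_k m f'"
    "\<And>x. (g has_vector_derivative g' x) (at x)" "D_k m g'" by auto
  then show ?case
    by (auto intro!: exI[of _ "\<lambda>x. f' x + g' x"] has_vector_derivative_add Suc.IH)
qed

lemma D_k_mult: "D_k m f \<Longrightarrow> D_k m g \<Longrightarrow> D_k m (\<lambda>x. f x * g x)"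
proof (induction m arbitrary: f g)
  case 0
  then show ?case by (auto intro: continuous_on_mult)
next
  case (Suc m)
  from Suc.prems obtain f' g' where d:
    "\<And>x. (f has_vector_derivative f' x) (at x)" "D_k m f'"
    "\<And>x. (g has_vector_derivative g' x) (at x)" "D_k m g'" by auto
  have "D_k m (\<lambda>x. f x * g' x + f' x * g x)"
    by (rule D_k_add[OF Suc.IH[OF D_k_Suc[OF Suc.prems(1)] d(4)] Suc.IH[OF d(2) D_k_Suc[OF Suc.prems(2)]]])
  then show ?case
    using d by (auto intro!: exI[of _ "\<lambda>x. f x * g' x + f' x * g x"] has_vector_derivative_mult)
qed

lemma D_k_const: "D_k m (\<lambda>x. c)"
  by (induction m arbitrary: c) (auto intro!: exI[of _ "\<lambda>_. 0"])

lemma D_k_inverse: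
  assumes "\<And>x. f x \<noteq> 0"
  shows "D_k m f \<Longrightarrow> D_k m (\<lambda>x. inverse (f x))"
proof (induction m)
  case 0
  then show ?case using assms by (auto intro: continuous_on_inverse)
next
  case (Suc m)
  from Suc.prems obtain f' where d: "\<And>x. (f has_vector_derivative f' x) (at x)" "D_k m f'" by auto
  have inv: "D_k m (\<lambda>x. inverse (f x))" by (rule Suc.IH[OF D_k_Suc[OF Suc.prems]])
  have 1: "D_k m (\<lambda>x. (- 1) * (f' x * (inverse (f x) * inverse (f x))))"
    by (rule D_k_mult[OF D_k_const D_k_mult[OF d(2) D_k_mult[OF inv inv]]])
  have der: "((\<lambda>x. inverse (f x)) has_vector_derivative (- 1) * (f' x * (inverse (f x) * inverse (f x)))) (at x)" for x
  proof -
    have "(inverse has_field_derivative - (inverse (f x) * inverse (f x))) (at (f x))"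
      using DERIV_inverse[OF assms[of x], of UNIV] by (simp add: power2_eq_square)
    from field_vector_diff_chain_at[OF d(1) this] show ?thesis by (simp add: o_def mult_ac)
  qed
  show ?case
    by (rule D_k_SucI[where f' = "\<lambda>x. (- 1) * (f' x * (inverse (f x) * inverse (f x)))"]) (rule der, rule 1)
qed

lemma D_k_exp: "D_k m (\<lambda>x. exp (c * of_real x))"
proof (induction m)
  case 0
  then show ?case by (auto intro!: continuous_intros)
next
  case (Suc m)
  have "((\<lambda>x. exp (c * of_real x)) has_vector_derivative c * exp (c * of_real x)) (at x)" for x
    by (rule has_vector_derivative_real_field derivative_eq_intros refl | simp)+
  then show ?case
    by (rule D_k_SucI[where f' = "\<lambda>x. c * exp (c * of_real x)"]) (rule D_k_mult[OF D_k_const Suc])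
qed

lemma D_k_shift: "D_k m f \<Longrightarrow> D_k m (\<lambda>x. f (x + c))"
proof (induction m arbitrary: f)
  case 0
  then show ?case by (auto intro!: continuous_on_compose2[of UNIV f] continuous_intros)
next
  case (Suc m)
  from Suc.prems obtain f' where d: "\<And>x. (f has_vector_derivative f' x) (at x)" "D_k m f'" by auto
  have "((\<lambda>x. f (x + c)) has_vector_derivative f' (x + c)) (at x)" for x
  proof -
    have "((\<lambda>x. x + c) has_vector_derivative 1) (at x)"
      by (auto intro!: derivative_eq_intros)
    from vector_diff_chain_at[OF this d(1)] show ?thesis by (simp add: o_def)
  qed
  then show ?case
    by (rule D_k_SucI[where f' = "\<lambda>x. f' (x + c)"]) (rule Suc.IH[OF d(2)])
qed

lemma D_k_reflect: "D_k m f \<Longrightarrow> D_k m (\<lambda>x. f (- x))"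
proof (induction m arbitrary: f)
  case 0
  then show ?case by (auto intro!: continuous_on_compose2[of UNIV f] continuous_intros)
next
  case (Suc m)
  from Suc.prems obtain f' where d: "\<And>x. (f has_vector_derivative f' x) (at x)" "D_k m f'" by auto
  have "((\<lambda>x. f (- x)) has_vector_derivative (- 1) * f' (- x)) (at x)" for x
  proof -
    have "((\<lambda>x. - x) has_vector_derivative (- 1)) (at x)"
      by (auto intro!: derivative_eq_intros)
    from vector_diff_chain_at[OF this d(1)] show ?thesis by (simp add: o_def)
  qed
  then show ?case
    by (rule D_k_SucI[where f' = "\<lambda>x. (- 1) * f' (- x)"]) (rule D_k_mult[OF D_k_const Suc.IH[OF d(2)]])
qed

lemma smooth_intros:
  "smooth (\<lambda>x. c)"
  "smooth (\<lambda>x. exp (c * of_real x))"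
  "smooth f \<Longrightarrow> smooth g \<Longrightarrow> smooth (\<lambda>x. f x + g x)"
  "smooth f \<Longrightarrow> smooth g \<Longrightarrow> smooth (\<lambda>x. f x * g x)"
  "smooth f \<Longrightarrow> (\<And>x. f x \<noteq> 0) \<Longrightarrow> smooth (\<lambda>x. inverse (f x))"
  "smooth f \<Longrightarrow> smooth (\<lambda>x. f (x + a))"
  "smooth f \<Longrightarrow> smooth (\<lambda>x. f (- x))"
  by (simp_all add: smooth_def D_k_const D_k_exp D_k_add D_k_mult D_k_inverse D_k_shift D_k_reflect)

lemma smooth_continuous: "smooth f \<Longrightarrow> continuous_on UNIV f"
  using D_k_imp_continuous smooth_def by blast

text \<open>\<open>D_k\<close> may use a different witness for each order; uniqueness of derivatives
  identifies them, so one \<open>f'\<close> serves all orders.\<close>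

lemma smooth_derivative:
  assumes "smooth f"
  obtains f' where "\<And>x. (f has_vector_derivative f' x) (at x)" "smooth f'"
proof -
  have "D_k (Suc 0) f" using assms unfolding smooth_def by blast
  then obtain f' where f': "\<And>x. (f has_vector_derivative f' x) (at x)" by auto
  have "D_k m f'" for m
  proof -
    have "D_k (Suc m) f" using assms unfolding smooth_def by blast
    then obtain g where g: "\<And>x. (f has_vector_derivative g x) (at x)" "D_k m g" by auto
    have "g = f'" using g(1) f' by (intro ext) (rule vector_derivative_unique_at)
    then show ?thesis using g(2) by simp
  qed
  then show ?thesis using f' that unfolding smooth_def by blast
qed

section \<open>Flat functions and the smooth step\<close>

text \<open>The polynomial factor makes the family closed under differentiation;
  \<open>exp_flat 1\<close> is the classical flat function.\<close>

definition exp_flat :: "real poly \<Rightarrow> real \<Rightarrow> real" where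
  "exp_flat p x = (if x > 0 then poly p (1 / x) * exp (- 1 / x) else 0)"

lemma poly_times_exp_minus_tendsto_0: "((\<lambda>t. poly p t * exp (- t)) \<longlongrightarrow> 0) at_top" for p :: "real poly"
proof -
  have "((\<lambda>t. \<Sum>i\<le>degree p. coeff p i * (t ^ i / exp t)) \<longlongrightarrow> (\<Sum>i\<le>degree p. coeff p i * 0)) at_top"
    by (intro tendsto_sum tendsto_mult tendsto_const tendsto_power_div_exp_0)
  then show ?thesis
    by (simp add: poly_altdef sum_distrib_right exp_minus divide_inverse mult.assoc)
qed

lemma exp_flat_tendsto_0: "(exp_flat p \<longlongrightarrow> 0) (at 0)"
proof (rule filterlim_split_at)
  have "eventually (\<lambda>x. exp_flat p x = 0) (at_left 0)"
    by (auto simp: eventually_at_filter exp_flat_def)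
  then show "(exp_flat p \<longlongrightarrow> 0) (at_left 0)"
    by (rule tendsto_eventually)
next
  have "((\<lambda>x. poly p (1 / x) * exp (- (1 / x))) \<longlongrightarrow> 0) (at_right 0)"
    by (rule filterlim_compose[OF poly_times_exp_minus_tendsto_0, of "\<lambda>x. 1 / x"])
      (simp add: filterlim_inverse_at_top_right divide_inverse)
  moreover have "eventually (\<lambda>x. poly p (1 / x) * exp (- (1 / x)) = exp_flat p x) (at_right 0)"
    by (auto simp: eventually_at_filter exp_flat_def)
  ultimately show "(exp_flat p \<longlongrightarrow> 0) (at_right 0)"
    by (rule Lim_transform_eventually)
qed

text \<open>With t = 1/x the chain rule contributes -t^2, and the derivative of p(t) exp(-t) is
  (p'(t) - p(t)) exp(-t); hence the factor \<open>[:0, 0, 1:]\<close> and the difference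
  \<open>p - pderiv p\<close>.\<close>

lemma exp_flat_derivative:
  "(exp_flat p has_real_derivative exp_flat ([:0, 0, 1:] * (p - pderiv p)) x) (at x)"
proof -
  consider "x > 0" | "x < 0" | "x = 0" by linarith
  then show ?thesis
  proof cases
    case 1
    have inv: "((\<lambda>x. 1 / x) has_real_derivative - (1 / x * (1 / x))) (at x)"
      using DERIV_inverse[of x UNIV] 1 by (simp add: inverse_eq_divide power2_eq_square)
    have "((\<lambda>t. poly p t * exp (- t)) has_real_derivative
        poly (pderiv p) t * exp (- t) + (- exp (- t)) * poly p t) (at t)" for t
      by (rule DERIV_mult[OF poly_DERIV]) (auto intro!: derivative_eq_intros)
    from DERIV_chain2[OF this inv]
    have "((\<lambda>x. poly p (1 / x) * exp (- (1 / x))) has_real_derivative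
        exp_flat ([:0, 0, 1:] * (p - pderiv p)) x) (at x)"
      using 1 by (simp add: exp_flat_def algebra_simps diff_divide_distrib)
    then show ?thesis
      using 1 by (elim has_field_derivative_transform_within_open[where S = "{0<..}"])
        (auto simp: exp_flat_def)
  next
    case 2
    have "((\<lambda>x. 0) has_real_derivative exp_flat ([:0, 0, 1:] * (p - pderiv p)) x) (at x)"
      using 2 by (simp add: exp_flat_def)
    then show ?thesis
      using 2 by (elim has_field_derivative_transform_within_open[where S = "{..<0}"])
        (auto simp: exp_flat_def)
  next
    case 3
    \<comment> \<open>Dividing by \<open>h\<close> multiplies the polynomial by its variable, so the
      difference quotient at 0 belongs to the family again.\<close>
    have "eventually (\<lambda>h. exp_flat (pCons 0 p) h = (exp_flat p (0 + h) - exp_flat p 0) / h) (at 0)"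
      by (auto simp: eventually_at_filter exp_flat_def)
    from Lim_transform_eventually[OF exp_flat_tendsto_0 this]
    show ?thesis unfolding 3 by (simp add: DERIV_def exp_flat_def)
  qed
qed

lemma D_k_exp_flat: "D_k m (\<lambda>x. of_real (exp_flat p x))"
proof (induction m arbitrary: p)
  case 0
  have "continuous_on UNIV (exp_flat p)"
    using exp_flat_derivative by (intro DERIV_continuous_on) (auto intro: has_field_derivative_at_within)
  then show ?case by (auto intro: continuous_intros)
next
  case (Suc m)
  have "((\<lambda>x. complex_of_real (exp_flat p x)) has_vector_derivative of_real (exp_flat ([:0, 0, 1:] * (p - pderiv p)) x)) (at x)" for x
    using exp_flat_derivative[of p x]
    by (intro has_vector_derivative_of_real) (simp add: has_real_derivative_iff_has_vector_derivative)
  then show ?case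
    by (rule D_k_SucI[where f' = "\<lambda>x. of_real (exp_flat ([:0, 0, 1:] * (p - pderiv p)) x)"]) (rule Suc.IH)
qed

text \<open>The step is E(x) / (E(x) + E(1 - x)); at every point x or 1 - x is positive, so the
  denominator does not vanish.\<close>

lemma smooth_step_exists:
  obtains \<Theta> where "smooth \<Theta>" "\<And>x. x \<le> 0 \<Longrightarrow> \<Theta> x = 0" "\<And>x. x \<ge> 1 \<Longrightarrow> \<Theta> x = 1"
proof -
  define E where "E = (\<lambda>x. complex_of_real (exp_flat 1 x))"
  define S where "S = (\<lambda>x. E x + E (- x + 1))"
  have E: "smooth E" unfolding smooth_def E_def using D_k_exp_flat by blast
  have "smooth (\<lambda>x. E (- (x + (- 1))))"
    by (rule smooth_intros(6)[OF smooth_intros(7)[OF E]])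
  then have "smooth S" unfolding S_def using smooth_intros(3)[OF E] by simp
  moreover have "S x \<noteq> 0" for x
  proof -
    have "exp_flat 1 x + exp_flat 1 (- x + 1) > 0"
      by (auto simp: exp_flat_def add_pos_nonneg add_nonneg_pos)
    then have "complex_of_real (exp_flat 1 x + exp_flat 1 (- x + 1)) \<noteq> 0"
      unfolding of_real_eq_0_iff by linarith
    then show ?thesis unfolding S_def E_def by simp
  qed
  ultimately have "smooth (\<lambda>x. E x * inverse (S x))"
    using E by (intro smooth_intros)
  then show ?thesis
  proof (rule that)
    show "E x * inverse (S x) = 0" if "x \<le> 0" for x
      using that by (simp add: E_def exp_flat_def)
    show "E x * inverse (S x) = 1" if "x \<ge> 1" for x
      using that by (simp add: S_def E_def exp_flat_def)
  qed
qed

section \<open>Test functions of product form\<close>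

lemma has_derivative_product_function:
  fixes a b :: "real \<Rightarrow> complex"
  assumes "\<And>x. (a has_vector_derivative a' x) (at x)" "\<And>x. (b has_vector_derivative b' x) (at x)"
  shows "((\<lambda>x. a (fst x) * b (snd x)) has_derivative
    (\<lambda>v. a (fst x) * (snd v *\<^sub>R b' (snd x)) + (fst v *\<^sub>R a' (fst x)) * b (snd x))) (at x)"
proof -
  have "((\<lambda>x. a (fst x)) has_derivative (\<lambda>v. fst v *\<^sub>R a' (fst x))) (at x)"
    using has_derivative_compose[OF has_derivative_fst[OF has_derivative_ident] assms(1)[unfolded has_vector_derivative_def]] .
  moreover have "((\<lambda>x. b (snd x)) has_derivative (\<lambda>v. snd v *\<^sub>R b' (snd x))) (at x)"
    using has_derivative_compose[OF has_derivative_snd[OF has_derivative_ident] assms(2)[unfolded has_vector_derivative_def]] .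
  ultimately show ?thesis by (rule has_derivative_mult)
qed

lemma dir_deriv_product:
  fixes a b :: "real \<Rightarrow> complex"
  assumes "\<And>x. (a has_vector_derivative a' x) (at x)" "\<And>x. (b has_vector_derivative b' x) (at x)"
  shows "dir_deriv (1, 0) (\<lambda>x. a (fst x) * b (snd x)) = (\<lambda>x. a' (fst x) * b (snd x))"
    "dir_deriv (0, 1) (\<lambda>x. a (fst x) * b (snd x)) = (\<lambda>x. a (fst x) * b' (snd x))"
  unfolding dir_deriv_def frechet_derivative_at[OF has_derivative_product_function[OF assms], symmetric]
  by simp_all

lemma Basis_real_pair: "(Basis :: (real \<times> real) set) = {(1, 0), (0, 1)}"
  by (auto simp: Basis_prod_def)

text \<open>Partial derivatives of a product function are product functions again, so an induction
  over arbitrary factors closes.\<close>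

lemma C_k_product:
  "D_k m a \<Longrightarrow> D_k m b \<Longrightarrow> C_k m (\<lambda>x::real \<times> real. a (fst x) * b (snd x))"
proof (induction m arbitrary: a b)
  case 0
  then show ?case
    by (auto intro!: continuous_intros continuous_on_compose2[of UNIV a] continuous_on_compose2[of UNIV b])
next
  case (Suc m)
  from Suc.prems obtain a' b' where d:
    "\<And>x. (a has_vector_derivative a' x) (at x)" "D_k m a'"
    "\<And>x. (b has_vector_derivative b' x) (at x)" "D_k m b'" by auto
  have "(\<lambda>x. a (fst x) * b (snd x)) differentiable at x" for x
    unfolding differentiable_def using has_derivative_product_function[OF d(1,3)] by blast
  moreover have "C_k m (\<lambda>x. a' (fst x) * b (snd x))" "C_k m (\<lambda>x. a (fst x) * b' (snd x))"
    using Suc.IH d D_k_Suc Suc.prems by blast+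
  ultimately show ?case
    by (simp add: Basis_real_pair dir_deriv_product[OF d(1,3)])
qed

lemma test_function_product:
  assumes "smooth a" "smooth b"
    and "\<And>t. t \<notin> {A..B} \<Longrightarrow> a t = 0" "\<And>t. t \<notin> {C..D} \<Longrightarrow> b t = 0"
  shows "test_function (\<lambda>x::real \<times> real. a (fst x) * b (snd x))"
proof -
  have "{x. a (fst x) * b (snd x) \<noteq> 0} \<subseteq> cbox (A, C) (B, D)"
    using assms(3,4) by (fastforce simp: cbox_Pair_eq)
  then have "closure {x. a (fst x) * b (snd x) \<noteq> 0} \<subseteq> cbox (A, C) (B, D)"
    by (rule closure_minimal) (rule closed_cbox)
  then have "compact (supp (\<lambda>x. a (fst x) * b (snd x)))"
    using bounded_subset[OF bounded_cbox] by (simp add: supp_def compact_eq_bounded_closed)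
  then show ?thesis
    using assms(1,2) C_k_product unfolding test_function_def smooth_def by blast
qed

section \<open>The weak equation on one period cell\<close>

text \<open>On a set of finite measure the bound of |f| by |f|^2 + 1 does the work of the
  Cauchy--Schwarz inequality.\<close>

lemma L2_on_mult_integrable:
  fixes f c :: "'a::euclidean_space \<Rightarrow> complex"
  assumes S: "S \<in> lmeasurable" and f: "L2_on S f"
    and c: "c \<in> borel_measurable (lebesgue_on S)" and B: "\<And>x. x \<in> S \<Longrightarrow> cmod (c x) \<le> B"
  shows "integrable (lebesgue_on S) (\<lambda>x. f x * c x)"
proof (rule Bochner_Integration.integrable_bound)
  interpret finite_measure "lebesgue_on S"
    by (rule finite_measure_lebesgue_on[OF S])
  show "integrable (lebesgue_on S) (\<lambda>x. \<bar>B\<bar> * ((cmod (f x))\<^sup>2 + 1))"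
    using f unfolding L2_on_def by (intro integrable_mult_right Bochner_Integration.integrable_add) auto
  show "(\<lambda>x. f x * c x) \<in> borel_measurable (lebesgue_on S)"
    using f c unfolding L2_on_def by (intro borel_measurable_times) auto
  show "AE x in lebesgue_on S. norm (f x * c x) \<le> norm (\<bar>B\<bar> * ((cmod (f x))\<^sup>2 + 1))"
  proof (rule AE_I2)
    fix x assume "x \<in> space (lebesgue_on S)"
    then have "cmod (c x) \<le> \<bar>B\<bar>" using B[of x] by auto
    moreover have "cmod (f x) \<le> (cmod (f x))\<^sup>2 + 1"
    proof -
      have "2 * cmod (f x) \<le> (cmod (f x))\<^sup>2 + 1" using sum_squares_bound[of "cmod (f x)" 1] by simp
      then show ?thesis using norm_ge_zero[of "f x"] by linarith
    qed
    ultimately have "cmod (c x) * cmod (f x) \<le> \<bar>B\<bar> * ((cmod (f x))\<^sup>2 + 1)"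
      by (intro mult_mono) auto
    then show "norm (f x * c x) \<le> norm (\<bar>B\<bar> * ((cmod (f x))\<^sup>2 + 1))"
      by (simp add: norm_mult mult.commute)
  qed
qed

lemma L2_on_compact_set_integrable:
  fixes f c :: "'a::euclidean_space \<Rightarrow> complex"
  assumes "L2_loc f" "compact K" "continuous_on UNIV c"
  shows "set_integrable lebesgue K (\<lambda>x. f x * c x)"
proof -
  have K: "K \<in> lmeasurable" using assms(2) by (rule lmeasurable_compact)
  have "compact (c ` K)" using assms continuous_on_subset compact_continuous_image by blast
  then obtain B where B: "\<And>x. x \<in> K \<Longrightarrow> cmod (c x) \<le> B"
    by (meson bounded_iff compact_imp_bounded image_eqI)
  have "integrable (lebesgue_on K) (\<lambda>x. f x * c x)"
  proof (rule L2_on_mult_integrable[OF K _ _ B])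
    show "L2_on K f" using assms unfolding L2_loc_def by blast
    show "c \<in> borel_measurable (lebesgue_on K)"
      using borel_measurable_continuous_onI[OF assms(3)]
      by (simp add: measurable_completion measurable_restrict_space1)
  qed
  then show ?thesis
    using fmeasurableD[OF K] by (simp add: integrable_restrict_space set_integrable_def)
qed

lemma L2_loc_mult_integrable:
  fixes f c :: "'a::euclidean_space \<Rightarrow> complex"
  assumes "L2_loc f" "continuous_on UNIV c" "compact K" "\<And>x. x \<notin> K \<Longrightarrow> c x = 0"
  shows "integrable lebesgue (\<lambda>x. f x * c x)"
proof -
  have "indicat_real K x *\<^sub>R (f x * c x) = f x * c x" for x
    using assms(4)[of x] by (cases "x \<in> K") auto
  then show ?thesis
    using L2_on_compact_set_integrable[OF assms(1,3,2)] by (simp add: set_integrable_def)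
qed

lemma smooth_bounded_support_derivative:
  assumes "\<And>x. (f has_vector_derivative f' x) (at x)" "\<And>t. t \<notin> {A..B} \<Longrightarrow> f t = 0"
  shows "t \<notin> {A..B::real} \<Longrightarrow> f' t = (0 :: complex)"
proof -
  assume t: "t \<notin> {A..B}"
  have "(f has_vector_derivative 0) (at t)"
    by (rule has_vector_derivative_transform_within_open[where S = "- {A..B}" and f = "\<lambda>_. 0"])
      (use t assms(2) in auto)
  then show "f' t = 0" using assms(1) vector_derivative_unique_at by blast
qed

lemma continuous_on_product_function:
  fixes a b :: "real \<Rightarrow> complex"
  assumes "continuous_on UNIV a" "continuous_on UNIV b"
  shows "continuous_on UNIV (\<lambda>x. a (fst x) * b (snd x))"
  using assms by (auto intro!: continuous_intros continuous_on_compose2[of UNIV a] continuous_on_compose2[of UNIV b])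

text \<open>The first derivatives of a product test function are test functions themselves.
  Inserting them in the definition of the weak gradient moves the second derivative onto the test
  function and eliminates \<open>g\<close>.\<close>

lemma weak_helmholtz_test:
  fixes a b :: "real \<Rightarrow> complex"
  assumes w: "weak_helmholtz k f F"
    and a: "\<And>x. (a has_vector_derivative a' x) (at x)" "\<And>x. (a' has_vector_derivative a'' x) (at x)"
      "smooth a" "smooth a'" "smooth a''" "\<And>t. t \<notin> {A..B} \<Longrightarrow> a t = 0"
    and b: "\<And>x. (b has_vector_derivative b' x) (at x)" "\<And>x. (b' has_vector_derivative b'' x) (at x)"
      "smooth b" "smooth b'" "smooth b''" "\<And>t. t \<notin> {C..D} \<Longrightarrow> b t = 0"
  shows "(LINT x|lebesgue. f x * (a'' (fst x) * b (snd x) + a (fst x) * b'' (snd x)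
      + of_real (k\<^sup>2) * (a (fst x) * b (snd x)))) = (LINT x|lebesgue. F x * (a (fst x) * b (snd x)))"
proof -
  note a0 = a(6) smooth_bounded_support_derivative[OF a(1,6)]
    smooth_bounded_support_derivative[OF a(2) smooth_bounded_support_derivative[OF a(1,6)]]
  note b0 = b(6) smooth_bounded_support_derivative[OF b(1,6)]
    smooth_bounded_support_derivative[OF b(2) smooth_bounded_support_derivative[OF b(1,6)]]
  let ?\<phi> = "\<lambda>x::real \<times> real. a (fst x) * b (snd x)"
  obtain g where g: "weak_gradient f g" and f: "L2_loc f" and
    eq: "\<And>\<phi>. test_function \<phi> \<Longrightarrow>
         (LINT x|lebesgue. (\<Sum>b\<in>Basis. g b x * dir_deriv b \<phi> x) - of_real (k\<^sup>2) * f x * \<phi> x)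
           = - (LINT x|lebesgue. F x * \<phi> x)"
    using w unfolding weak_helmholtz_def H1_loc_def by blast
  have L2g: "L2_loc (g (1, 0))" "L2_loc (g (0, 1))" and
    wg: "\<And>\<phi>. test_function \<phi> \<Longrightarrow> (LINT x|lebesgue. f x * dir_deriv (1, 0) \<phi> x) = - (LINT x|lebesgue. g (1, 0) x * \<phi> x)"
      "\<And>\<phi>. test_function \<phi> \<Longrightarrow> (LINT x|lebesgue. f x * dir_deriv (0, 1) \<phi> x) = - (LINT x|lebesgue. g (0, 1) x * \<phi> x)"
    using g unfolding weak_gradient_def Basis_real_pair by blast+
  have int: "integrable lebesgue (\<lambda>x. u x * (c (fst x) * d (snd x)))"
    if "L2_loc u" "smooth c" "smooth d" "\<And>t. t \<notin> {A..B} \<Longrightarrow> c t = 0" "\<And>t. t \<notin> {C..D} \<Longrightarrow> d t = 0"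
    for u and c d :: "real \<Rightarrow> complex"
  proof (rule L2_loc_mult_integrable[OF that(1) _ compact_cbox[of "(A, C)" "(B, D)"]])
    show "continuous_on UNIV (\<lambda>x. c (fst x) * d (snd x))"
      using that by (intro continuous_on_product_function smooth_continuous)
    show "c (fst x) * d (snd x) = 0" if "x \<notin> cbox (A, C) (B, D)" for x
      using \<open>x \<notin> cbox (A, C) (B, D)\<close> that(1) \<open>\<And>t. t \<notin> {A..B} \<Longrightarrow> c t = 0\<close>[of "fst x"] \<open>\<And>t. t \<notin> {C..D} \<Longrightarrow> d t = 0\<close>[of "snd x"]
      by (cases x) (auto simp: cbox_Pair_eq)
  qed
  have i1: "integrable lebesgue (\<lambda>x. g (1, 0) x * (a' (fst x) * b (snd x)))"
    by (rule int[OF L2g(1) a(4) b(3) a0(2) b0(1)])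
  have i2: "integrable lebesgue (\<lambda>x. g (0, 1) x * (a (fst x) * b' (snd x)))"
    by (rule int[OF L2g(2) a(3) b(4) a0(1) b0(2)])
  have i3: "integrable lebesgue (\<lambda>x. f x * (a (fst x) * b (snd x)))"
    by (rule int[OF f a(3) b(3) a0(1) b0(1)])
  have i4: "integrable lebesgue (\<lambda>x. f x * (a'' (fst x) * b (snd x)))"
    by (rule int[OF f a(5) b(3) a0(3) b0(1)])
  have i5: "integrable lebesgue (\<lambda>x. f x * (a (fst x) * b'' (snd x)))"
    by (rule int[OF f a(3) b(5) a0(1) b0(3)])
  note t = test_function_product[OF a(3) b(3) a0(1) b0(1)]
    test_function_product[OF a(4) b(3) a0(2) b0(1)] test_function_product[OF a(3) b(4) a0(1) b0(2)]
  have "- (LINT x|lebesgue. F x * ?\<phi> x) =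
      (LINT x|lebesgue. (g (1, 0) x * (a' (fst x) * b (snd x)) + g (0, 1) x * (a (fst x) * b' (snd x)))
        - of_real (k\<^sup>2) * (f x * ?\<phi> x))"
    using eq[OF t(1)] by (simp add: Basis_real_pair dir_deriv_product[OF a(1) b(1)] mult.assoc)
  also have "\<dots> = (LINT x|lebesgue. g (1, 0) x * (a' (fst x) * b (snd x)))
      + (LINT x|lebesgue. g (0, 1) x * (a (fst x) * b' (snd x))) - of_real (k\<^sup>2) * (LINT x|lebesgue. f x * ?\<phi> x)"
    using i1 i2 i3 by (simp del: of_real_power)
  also have "(LINT x|lebesgue. g (1, 0) x * (a' (fst x) * b (snd x))) = - (LINT x|lebesgue. f x * (a'' (fst x) * b (snd x)))"
    using wg(1)[OF t(2)] by (simp add: dir_deriv_product[OF a(2) b(1)])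
  also have "(LINT x|lebesgue. g (0, 1) x * (a (fst x) * b' (snd x))) = - (LINT x|lebesgue. f x * (a (fst x) * b'' (snd x)))"
    using wg(2)[OF t(3)] by (simp add: dir_deriv_product[OF a(1) b(2)])
  finally have e: "(LINT x|lebesgue. F x * ?\<phi> x) = (LINT x|lebesgue. f x * (a'' (fst x) * b (snd x)))
      + (LINT x|lebesgue. f x * (a (fst x) * b'' (snd x))) + of_real (k\<^sup>2) * (LINT x|lebesgue. f x * ?\<phi> x)"
    by (simp add: algebra_simps)
  have "(LINT x|lebesgue. f x * (a'' (fst x) * b (snd x) + a (fst x) * b'' (snd x) + of_real (k\<^sup>2) * ?\<phi> x)) =
      (LINT x|lebesgue. (f x * (a'' (fst x) * b (snd x)) + f x * (a (fst x) * b'' (snd x))) + of_real (k\<^sup>2) * (f x * ?\<phi> x))"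
    by (simp add: algebra_simps)
  also have "\<dots> = (LINT x|lebesgue. F x * ?\<phi> x)"
    unfolding e using i3 i4 i5 by (simp del: of_real_power)
  finally show ?thesis .
qed

section \<open>Folding integrals over the plane to one period cell\<close>

lemma integrable_lebesgue_translation:
  fixes f :: "'a::euclidean_space \<Rightarrow> 'b::{banach, second_countable_topology}"
  assumes "integrable lebesgue f"
  shows "integrable lebesgue (\<lambda>x. f (v + x))" "(LINT x|lebesgue. f (v + x)) = (LINT x|lebesgue. f x)"
proof -
  have T: "(\<lambda>x. v + (\<Sum>j\<in>Basis. (1 * (x \<bullet> j)) *\<^sub>R j)) = ((+) v)"
    by (simp add: euclidean_representation)
  have meas: "(+) v \<in> lebesgue \<rightarrow>\<^sub>M lebesgue"
    using lebesgue_affine_measurable[of "\<lambda>_. 1" v] unfolding T by simp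
  have eq: "distr lebesgue lebesgue ((+) v) = lebesgue"
    using lebesgue_affine_euclidean[of "\<lambda>_. 1" v] unfolding T by (simp add: density_1)
  show "integrable lebesgue (\<lambda>x. f (v + x))"
    using integrable_distr[OF meas, of f] assms eq by simp
  show "(LINT x|lebesgue. f (v + x)) = (LINT x|lebesgue. f x)"
    using integral_distr[OF meas, of f] assms eq by simp
qed

text \<open>Used to exchange the open cell \<open>Omega\<close>, its translates and closed boxes in
  integrals: they differ by vertical lines.\<close>

lemma AE_fst_neq: "AE x in lebesgue. fst (x :: real \<times> real) \<noteq> c"
proof -
  have "negligible {x :: real \<times> real. x \<bullet> (1, 0) = c}"
    by (rule negligible_standard_hyperplane) (simp add: Basis_real_pair)
  then have "{x :: real \<times> real. fst x = c} \<in> null_sets lebesgue"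
    by (simp add: negligible_iff_null_sets inner_prod_def)
  then show ?thesis by (rule AE_I') auto
qed

lemma set_integrable_mult_bounded:
  fixes P r :: "real \<times> real \<Rightarrow> complex"
  assumes "set_integrable lebesgue S P" "r \<in> borel_measurable lebesgue" "\<And>x. cmod (r x) \<le> B"
  shows "set_integrable lebesgue S (\<lambda>x. P x * r x)"
proof -
  have "integrable lebesgue (\<lambda>x. (indicat_real S x *\<^sub>R P x) * r x)"
  proof (rule Bochner_Integration.integrable_bound)
    show "integrable lebesgue (\<lambda>x. B * norm (indicat_real S x *\<^sub>R P x))"
      using assms(1) unfolding set_integrable_def by (intro integrable_mult_right integrable_norm)
    show "(\<lambda>x. (indicat_real S x *\<^sub>R P x) * r x) \<in> borel_measurable lebesgue"
      using assms unfolding set_integrable_def by (intro borel_measurable_times) auto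
    have "B \<ge> 0" using assms(3) norm_ge_zero order_trans by blast
    then show "AE x in lebesgue. norm ((indicat_real S x *\<^sub>R P x) * r x) \<le> norm (B * norm (indicat_real S x *\<^sub>R P x))"
      using mult_left_mono[OF assms(3) norm_ge_zero]
      by (intro AE_I2) (auto simp: norm_mult indicator_def mult.commute[of B])
  qed
  then show ?thesis by (simp add: set_integrable_def)
qed

lemma Omega_borel [measurable]: "Omega \<in> sets borel" "Omega \<in> sets lebesgue"
proof -
  have "open Omega" unfolding Omega_def by (intro open_Times) auto
  then show "Omega \<in> sets borel" by auto
  then show "Omega \<in> sets lebesgue" by auto
qed

text \<open>The support of \<open>r\<close> meets two period cells. Translating the second one back
  by a period leaves \<open>P\<close> unchanged and superposes the two values of
  \<open>r\<close>.\<close>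

lemma LINT_periodic_fold:
  fixes P :: "real \<times> real \<Rightarrow> complex" and r :: "real \<Rightarrow> complex"
  assumes per: "\<And>x1 x2. P (x1 + 2 * pi, x2) = P (x1, x2)"
    and P: "set_integrable lebesgue Omega P"
    and r: "continuous_on UNIV r" "\<And>t. t \<notin> {- pi..3 * pi} \<Longrightarrow> r t = 0"
  shows "(LINT x|lebesgue. P x * r (fst x)) = (LINT x:Omega|lebesgue. P x * (r (fst x) + r (fst x + 2 * pi)))"
proof -
  let ?v = "(2 * pi, 0) :: real \<times> real"
  have "bounded (range r)"
  proof -
    have "compact (r ` {- pi..3 * pi})"
      using r(1) by (intro compact_continuous_image continuous_on_subset[OF r(1)]) auto
    moreover have "range r \<subseteq> insert 0 (r ` {- pi..3 * pi})"
    proof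
      fix w assume "w \<in> range r"
      then obtain t where "w = r t" by blast
      then show "w \<in> insert 0 (r ` {- pi..3 * pi})" using r(2)[of t] by (cases "t \<in> {- pi..3 * pi}") auto
    qed
    ultimately show ?thesis using bounded_subset compact_imp_bounded bounded_insert by metis
  qed
  then obtain B where B: "\<And>t. cmod (r t) \<le> B" unfolding bounded_iff by auto
  have rm: "(\<lambda>x :: real \<times> real. r (fst x + c)) \<in> borel_measurable lebesgue" for c
  proof -
    have "continuous_on UNIV (\<lambda>x :: real \<times> real. r (fst x + c))"
      by (auto intro!: continuous_on_compose2[OF r(1)] continuous_intros)
    from borel_measurable_continuous_onI[OF this] show ?thesis
      by (simp add: measurable_completion)
  qed
  have s0: "set_integrable lebesgue Omega (\<lambda>x. P x * r (fst x))"
    using set_integrable_mult_bounded[OF P rm[of 0] B] by simp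
  have s1: "set_integrable lebesgue Omega (\<lambda>x. P x * r (fst x + 2 * pi))"
    by (rule set_integrable_mult_bounded[OF P rm B])
  define G0 where "G0 = (\<lambda>x. indicat_real Omega x *\<^sub>R (P x * r (fst x)))"
  define G1 where "G1 = (\<lambda>x. indicat_real Omega x *\<^sub>R (P x * r (fst x + 2 * pi)))"
  have G: "integrable lebesgue G0" "integrable lebesgue G1"
    using s0 s1 unfolding set_integrable_def G0_def G1_def by auto
  \<comment> \<open>\<open>G1\<close> lives on \<open>Omega\<close>; its translate lives on the next
    cell, where it restores the original integrand.\<close>
  let ?T = "\<lambda>x. G1 (- ?v + x)"
  have T: "integrable lebesgue ?T" "(LINT x|lebesgue. ?T x) = (LINT x|lebesgue. G1 x)"
    using integrable_lebesgue_translation[OF G(2), of "- ?v"] by auto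
  have AE: "AE x in lebesgue. G0 x + ?T x = P x * r (fst x)"
    using AE_fst_neq[of "- pi"] AE_fst_neq[of pi] AE_fst_neq[of "3 * pi"]
  proof eventually_elim
    case (elim x)
    obtain x1 x2 where x: "x = (x1, x2)" by (cases x)
    have v: "- ?v + x = (x1 - 2 * pi, x2)" by (simp add: x)
    have pv: "P (x1 - 2 * pi, x2) = P (x1, x2)" using per[of "x1 - 2 * pi" x2] by simp
    consider "x1 < - pi" | "- pi < x1" "x1 < pi" | "pi < x1" "x1 < 3 * pi" | "3 * pi < x1"
      using elim x by fastforce
    then show ?case
    proof cases
      case 1
      then show ?thesis unfolding G0_def G1_def v by (simp add: x pv r(2) Omega_def indicator_def)
    next
      case 2
      then show ?thesis unfolding G0_def G1_def v by (simp add: x pv r(2) Omega_def indicator_def)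
    next
      case 3
      then show ?thesis unfolding G0_def G1_def v by (simp add: x pv r(2) Omega_def indicator_def)
    next
      case 4
      then show ?thesis using pi_gt_zero unfolding G0_def G1_def v by (simp add: x pv r(2) Omega_def indicator_def)
    qed
  qed
  have "(LINT x|lebesgue. P x * r (fst x)) = (LINT x|lebesgue. G0 x + ?T x)"
  proof (rule integral_cong_AE)
    show m: "(\<lambda>x. G0 x + ?T x) \<in> borel_measurable lebesgue" using G T by (intro borel_measurable_add) auto
    \<comment> \<open>Measurability in the whole plane is known for \<open>G0\<close> and
      \<open>?T\<close>, and is transferred along the almost everywhere equality.\<close>
    show "(\<lambda>x. P x * r (fst x)) \<in> borel_measurable lebesgue"
      by (rule borel_measurable_AE[OF m AE])
    show "AE x in lebesgue. P x * r (fst x) = G0 x + ?T x"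
      using AE by eventually_elim simp
  qed
  also have "\<dots> = (LINT x|lebesgue. G0 x) + (LINT x|lebesgue. G1 x)"
    using G T by simp
  also have "\<dots> = (LINT x|lebesgue. G0 x + G1 x)" using G by simp
  also have "\<dots> = (LINT x:Omega|lebesgue. P x * (r (fst x) + r (fst x + 2 * pi)))"
    unfolding set_lebesgue_integral_def G0_def G1_def
    by (intro Bochner_Integration.integral_cong refl) (simp add: algebra_simps scaleR_add_right)
  finally show ?thesis .
qed

lemma Im_beta_j_nonneg: "Im (beta_j k \<alpha> j) \<ge> 0"
  by (simp add: beta_j_def)

section \<open>Integrability on the scatterer and the two cutoff functions\<close>

lemma scatterer_bounds:
  assumes "(SUP x\<in>scatterer n. ereal \<bar>snd x\<bar>) < ereal h" "y \<in> scatterer n"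
  shows "\<bar>snd y\<bar> < h" "\<bar>fst y\<bar> < pi"
proof -
  have "ereal \<bar>snd y\<bar> < ereal h" using assms by (metis SUP_upper order.strict_trans1)
  then show "\<bar>snd y\<bar> < h" by simp
  show "\<bar>fst y\<bar> < pi" using assms(2) by (auto simp: scatterer_def Omega_def abs_less_iff)
qed

lemma scatterer_lmeasurable:
  assumes "(SUP x\<in>scatterer n. ereal \<bar>snd x\<bar>) < ereal h"
  shows "scatterer n \<in> lmeasurable"
proof (rule bounded_set_imp_lmeasurable)
  have "scatterer n \<subseteq> cbox (- pi, - h) (pi, h)"
  proof
    fix y assume "y \<in> scatterer n"
    from scatterer_bounds[OF assms this] show "y \<in> cbox (- pi, - h) (pi, h)"
      by (cases y) (auto simp: cbox_Pair_eq)
  qed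
  then show "bounded (scatterer n)" by (rule bounded_subset[OF bounded_cbox])
  have "scatterer n \<in> sets borel" unfolding scatterer_def supp_def
    by (intro sets.Int Omega_borel) auto
  then show "scatterer n \<in> sets lebesgue" by auto
qed

lemma contrast_outside_scatterer:
  assumes "x \<in> Omega" "x \<notin> scatterer n" shows "contrast n x = 0"
  using assms closure_subset unfolding scatterer_def supp_def by fastforce

lemma scatterer_mult_integrable:
  assumes "periodic_medium n" and h: "(SUP x\<in>scatterer n. ereal \<bar>snd x\<bar>) < ereal h"
    and f: "L2_on (scatterer n) f"
    and c: "continuous_on UNIV c"
  shows "integrable (lebesgue_on (scatterer n)) (\<lambda>y. c y * contrast n y * f y)"
proof -
  obtain B where B: "\<And>x. cmod (n x) \<le> B"
    using assms(1) unfolding periodic_medium_def bounded_iff by auto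
  have nm: "n \<in> borel_measurable lebesgue"
    using assms(1) unfolding periodic_medium_def by blast
  have "compact (c ` cbox (- pi, - h) (pi, h))"
    by (intro compact_continuous_image continuous_on_subset[OF c]) auto
  then obtain C where C: "\<And>x. x \<in> cbox (- pi, - h) (pi, h) \<Longrightarrow> cmod (c x) \<le> C"
    by (meson bounded_iff compact_imp_bounded image_eqI)
  have "integrable (lebesgue_on (scatterer n)) (\<lambda>y. f y * (c y * contrast n y))"
  proof (rule L2_on_mult_integrable[OF scatterer_lmeasurable[OF h] f, where B = "C * (B + 1)"])
    have "c \<in> borel_measurable lebesgue"
      using borel_measurable_continuous_onI[OF c] by (simp add: measurable_completion)
    then have "(\<lambda>y. c y * contrast n y) \<in> borel_measurable lebesgue"
      unfolding contrast_def using nm by (intro borel_measurable_times borel_measurable_diff) auto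
    then show "(\<lambda>y. c y * contrast n y) \<in> borel_measurable (lebesgue_on (scatterer n))"
      by (rule measurable_restrict_space1)
    fix y assume "y \<in> scatterer n"
    from scatterer_bounds[OF h this] have "y \<in> cbox (- pi, - h) (pi, h)"
      by (cases y) (auto simp: cbox_Pair_eq)
    then have "cmod (c y) \<le> C" by (rule C)
    moreover have "cmod (contrast n y) \<le> B + 1"
      using norm_triangle_ineq4[of "n y" 1] B[of y] by (simp add: contrast_def)
    moreover have "0 \<le> C" using \<open>cmod (c y) \<le> C\<close> norm_ge_zero order_trans by blast
    ultimately show "cmod (c y * contrast n y) \<le> C * (B + 1)"
      unfolding norm_mult by (intro mult_mono) auto
  qed
  then show ?thesis by (simp add: mult_ac)
qed

text \<open>The difference of two steps one period apart telescopes: the sum of both translates is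
  the step at \<open>t + 3 * pi\<close> minus the step at \<open>t - pi\<close>, that is 1 - 0 on
  the cell.\<close>

lemma periodic_partition_exists:
  obtains \<rho> :: "real \<Rightarrow> complex" where "smooth \<rho>" "\<And>t. t \<notin> {- pi..3 * pi} \<Longrightarrow> \<rho> t = 0"
    "\<And>t. t \<in> {- pi<..<pi} \<Longrightarrow> \<rho> t + \<rho> (t + 2 * pi) = 1"
proof -
  obtain \<Theta> where \<Theta>: "smooth \<Theta>" "\<And>x. x \<le> 0 \<Longrightarrow> \<Theta> x = 0" "\<And>x. x \<ge> 1 \<Longrightarrow> \<Theta> x = 1"
    using smooth_step_exists by blast
  define \<rho> where "\<rho> = (\<lambda>t. \<Theta> (t + pi) + (- 1) * \<Theta> (t + (- pi)))"
  have "smooth \<rho>" unfolding \<rho>_def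
    by (rule smooth_intros(3)[OF smooth_intros(6)[OF \<Theta>(1)] smooth_intros(4)[OF smooth_intros(1) smooth_intros(6)[OF \<Theta>(1)]]])
  moreover have "\<rho> t = 0" if "t \<notin> {- pi..3 * pi}" for t
  proof (cases "t < - pi")
    case True
    then show ?thesis using pi_gt3 by (simp add: \<rho>_def \<Theta>(2))
  next
    case False
    then show ?thesis using that pi_gt3 by (simp add: \<rho>_def \<Theta>(3))
  qed
  moreover have "\<rho> t + \<rho> (t + 2 * pi) = 1" if "t \<in> {- pi<..<pi}" for t
  proof -
    have "t + 2 * pi + (- pi) = t + pi" by simp
    then show ?thesis using that pi_gt3 by (simp add: \<rho>_def \<Theta>(2,3) add.commute)
  qed
  ultimately show ?thesis using that by blast
qed

text \<open>The plateau reaches 1 beyond \<open>h\<close>, so that at \<open>h\<close> and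
  \<open>- h\<close> the derivatives of a cut-off function are those of the function itself.\<close>

lemma smooth_cutoff_exists:
  assumes "h > 0"
  obtains \<eta> :: "real \<Rightarrow> complex" where "smooth \<eta>" "\<And>t. t \<notin> {- h - 2..h + 2} \<Longrightarrow> \<eta> t = 0"
    "\<And>t. \<bar>t\<bar> \<le> h + 1 \<Longrightarrow> \<eta> t = 1"
proof -
  obtain \<Theta> where \<Theta>: "smooth \<Theta>" "\<And>x. x \<le> 0 \<Longrightarrow> \<Theta> x = 0" "\<And>x. x \<ge> 1 \<Longrightarrow> \<Theta> x = 1"
    using smooth_step_exists by blast
  define \<eta> where "\<eta> = (\<lambda>t. \<Theta> (t + (h + 2)) + (- 1) * \<Theta> (t + (- h - 1)))"
  have "smooth \<eta>" unfolding \<eta>_def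
    by (rule smooth_intros(3)[OF smooth_intros(6)[OF \<Theta>(1)] smooth_intros(4)[OF smooth_intros(1) smooth_intros(6)[OF \<Theta>(1)]]])
  moreover have "\<eta> t = 0" if "t \<notin> {- h - 2..h + 2}" for t
  proof (cases "t < - h - 2")
    case True
    then show ?thesis using assms by (simp add: \<eta>_def \<Theta>(2))
  next
    case False
    then show ?thesis using that assms by (simp add: \<eta>_def \<Theta>(3))
  qed
  moreover have "\<eta> t = 1" if "\<bar>t\<bar> \<le> h + 1" for t
    using that by (simp add: \<eta>_def \<Theta>(2,3) abs_le_iff)
  ultimately show ?thesis using that by blast
qed

lemma L2_loc_strip_integrable:
  fixes f c :: "real \<times> real \<Rightarrow> complex"
  assumes "L2_loc f" "continuous_on UNIV c" "\<And>x. snd x \<notin> {C..D} \<Longrightarrow> c x = 0"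
  shows "set_integrable lebesgue Omega (\<lambda>x. f x * c x)"
proof -
  let ?K = "cbox (- pi, C) (pi, D)"
  have "set_integrable lebesgue ?K (\<lambda>x. f x * c x)"
    by (rule L2_on_compact_set_integrable[OF assms(1) compact_cbox assms(2)])
  then have "set_integrable lebesgue (Omega \<inter> ?K) (\<lambda>x. f x * c x)"
    by (rule set_integrable_subset) (use Omega_borel in auto)
  moreover have "indicat_real (Omega \<inter> ?K) x *\<^sub>R (f x * c x) = indicat_real Omega x *\<^sub>R (f x * c x)" for x
    using assms(3)[of x] by (cases x) (auto simp: indicator_def Omega_def cbox_Pair_eq)
  ultimately show ?thesis by (simp add: set_integrable_def)
qed

text \<open>Since \<open>alpha_j \<alpha> j\<close> and \<open>\<alpha>\<close> differ by an
  integer, the plane wave has the inverse quasiperiodicity factor and the product is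
  periodic.\<close>

lemma quasiperiodic_shift:
  fixes f :: "real \<times> real \<Rightarrow> complex"
  assumes f: "\<And>x1 x2. f (x1 + 2 * pi, x2) = exp (\<i> * of_real (2 * pi * \<alpha>)) * f (x1, x2)"
  shows "f (x1 + 2 * pi, x2) * exp (- \<i> * of_real (alpha_j \<alpha> j * (x1 + 2 * pi))) =
    f (x1, x2) * exp (- \<i> * of_real (alpha_j \<alpha> j * x1))"
proof -
  have "exp (\<i> * of_real (2 * pi * \<alpha>)) * exp (- \<i> * of_real (alpha_j \<alpha> j * (x1 + 2 * pi))) =
      exp (- \<i> * of_real (alpha_j \<alpha> j * x1) + of_real (2 * of_int (- j) * pi) * \<i>)"
    unfolding exp_add[symmetric] by (rule arg_cong[where f = exp]) (simp add: alpha_j_def algebra_simps)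
  also have "\<dots> = exp (- \<i> * of_real (alpha_j \<alpha> j * x1))"
    unfolding exp_add using exp_integer_2pi[of "of_int (- j)"] by simp
  finally have e: "exp (\<i> * of_real (2 * pi * \<alpha>)) * exp (- \<i> * of_real (alpha_j \<alpha> j * (x1 + 2 * pi))) =
    exp (- \<i> * of_real (alpha_j \<alpha> j * x1))" .
  show ?thesis unfolding f using e by (metis mult.commute mult.left_commute)
qed

text \<open>\<open>smooth_derivative\<close> yields derivatives without formulas; this recovers
  their values on open sets where the function is known.\<close>

lemma vector_derivative_local:
  fixes f g :: "real \<Rightarrow> complex"
  assumes "(f has_vector_derivative f') (at t)" "(g has_vector_derivative g') (at t)"
    and "open S" "t \<in> S" "\<And>x. x \<in> S \<Longrightarrow> f x = g x"
  shows "f' = g'"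
proof -
  have "(g has_vector_derivative f') (at t)"
    using has_vector_derivative_transform_within_open[OF assms(1,3,4)] assms(5) by blast
  then show ?thesis using assms(2) vector_derivative_unique_at by blast
qed

text \<open>Testing the weak equation with \<open>\<rho>(x\<^sub>1) e\<^bsup>-i\<alpha>\<^sub>jx\<^sub>1\<^esup> b(x\<^sub>2)\<close>, where the \<open>2\<pi>\<close>-translates of
  \<open>\<rho>\<close> sum to one, gives a weak identity on one period cell.\<close>

lemma weak_helmholtz_period_cell:
  fixes f F :: "real \<times> real \<Rightarrow> complex" and b :: "real \<Rightarrow> complex"
  assumes qf: "\<And>x1 x2. f (x1 + 2 * pi, x2) = exp (\<i> * of_real (2 * pi * \<alpha>)) * f (x1, x2)"
    and qF: "\<And>x1 x2. F (x1 + 2 * pi, x2) = exp (\<i> * of_real (2 * pi * \<alpha>)) * F (x1, x2)"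
    and w: "weak_helmholtz k f F"
    and b: "\<And>x. (b has_vector_derivative b' x) (at x)" "\<And>x. (b' has_vector_derivative b'' x) (at x)"
      "smooth b" "smooth b'" "smooth b''" "\<And>t. t \<notin> {C..D} \<Longrightarrow> b t = 0"
    and F: "set_integrable lebesgue Omega (\<lambda>x. F x * (exp (- \<i> * of_real (alpha_j \<alpha> j * fst x)) * b (snd x)))"
  shows "(LINT x:Omega|lebesgue. f x * (exp (- \<i> * of_real (alpha_j \<alpha> j * fst x)) *
        (b'' (snd x) + of_real (k\<^sup>2 - (alpha_j \<alpha> j)\<^sup>2) * b (snd x)))) =
    (LINT x:Omega|lebesgue. F x * (exp (- \<i> * of_real (alpha_j \<alpha> j * fst x)) * b (snd x)))"
proof -
  obtain \<rho> where \<rho>: "smooth \<rho>" "\<And>t. t \<notin> {- pi..3 * pi} \<Longrightarrow> \<rho> t = 0"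
    "\<And>t. t \<in> {- pi<..<pi} \<Longrightarrow> \<rho> t + \<rho> (t + 2 * pi) = 1"
    using periodic_partition_exists by blast
  obtain \<rho>' where \<rho>': "\<And>x. (\<rho> has_vector_derivative \<rho>' x) (at x)" "smooth \<rho>'"
    using smooth_derivative[OF \<rho>(1)] by blast
  obtain \<rho>'' where \<rho>'': "\<And>x. (\<rho>' has_vector_derivative \<rho>'' x) (at x)" "smooth \<rho>''"
    using smooth_derivative[OF \<rho>'(2)] by blast
  have supp': "\<rho>' t = 0" if "t \<notin> {- pi..3 * pi}" for t
    by (rule smooth_bounded_support_derivative[OF \<rho>'(1) _ that]) (rule \<rho>(2))
  have supp'': "\<rho>'' t = 0" if "t \<notin> {- pi..3 * pi}" for t
    by (rule smooth_bounded_support_derivative[OF \<rho>''(1) _ that]) (rule supp')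
  have bsupp': "b' t = 0" if "t \<notin> {C..D}" for t
    by (rule smooth_bounded_support_derivative[OF b(1) _ that]) (rule b(6))
  have bsupp'': "b'' t = 0" if "t \<notin> {C..D}" for t
    by (rule smooth_bounded_support_derivative[OF b(2) _ that]) (rule bsupp')
  have shifted: "((\<lambda>x. g (x + 2 * pi)) has_vector_derivative g' (t + 2 * pi)) (at t)"
    if "\<And>x. (g has_vector_derivative g' x) (at x)" for g g' :: "real \<Rightarrow> complex" and t
  proof -
    have "((\<lambda>x. x + 2 * pi) has_vector_derivative 1) (at t)"
      by (auto intro!: derivative_eq_intros)
    from vector_diff_chain_at[OF this that] show ?thesis by (simp add: o_def)
  qed
  \<comment> \<open>The constant sum of the two translates is differentiated; for this the cell has
    to be open.\<close>
  have sum': "\<rho>' t + \<rho>' (t + 2 * pi) = 0" if "t \<in> {- pi<..<pi}" for t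
    by (rule vector_derivative_local[OF has_vector_derivative_add[OF \<rho>'(1) shifted[OF \<rho>'(1)]]
          has_vector_derivative_const open_greaterThanLessThan that]) (rule \<rho>(3))
  have sum'': "\<rho>'' t + \<rho>'' (t + 2 * pi) = 0" if "t \<in> {- pi<..<pi}" for t
    by (rule vector_derivative_local[OF has_vector_derivative_add[OF \<rho>''(1) shifted[OF \<rho>''(1)]]
          has_vector_derivative_const open_greaterThanLessThan that]) (rule sum')
  define w where "w = - \<i> * of_real (alpha_j \<alpha> j)"
  define e where "e = (\<lambda>t. exp (w * of_real t))"
  have e_eq: "exp (- \<i> * of_real (alpha_j \<alpha> j * t)) = e t" for t
    by (simp add: e_def w_def mult.assoc)
  have e: "(e has_vector_derivative w * e t) (at t)" for t
    unfolding e_def by (rule has_vector_derivative_real_field derivative_eq_intros refl | simp)+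
  have se: "smooth e" unfolding e_def by (rule smooth_intros(2))
  have w2: "w\<^sup>2 = - of_real ((alpha_j \<alpha> j)\<^sup>2)" by (simp add: w_def power_mult_distrib)
  define a where "a = (\<lambda>t. \<rho> t * e t)"
  define a' where "a' = (\<lambda>t. \<rho> t * (w * e t) + \<rho>' t * e t)"
  define a'' where "a'' = (\<lambda>t. \<rho> t * (w * (w * e t)) + \<rho>' t * (w * e t) + (\<rho>' t * (w * e t) + \<rho>'' t * e t))"
  \<comment> \<open>Up to the factor \<open>e\<close>, \<open>r\<close> collects the terms in which
    the partition is differentiated; \<open>W\<close> is what the operator does in the second
    variable. \<open>pointwise\<close> separates the two.\<close>
  define r where "r = (\<lambda>t. \<rho>'' t + 2 * w * \<rho>' t)"
  define W where "W = (\<lambda>t. b'' t + of_real (k\<^sup>2 - (alpha_j \<alpha> j)\<^sup>2) * b t)"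
  have da: "(a has_vector_derivative a' t) (at t)" for t
    unfolding a_def a'_def by (rule has_vector_derivative_mult[OF \<rho>'(1) e])
  have da': "(a' has_vector_derivative a'' t) (at t)" for t
    unfolding a'_def a''_def
    by (intro has_vector_derivative_add has_vector_derivative_mult has_vector_derivative_mult_right \<rho>'(1) \<rho>''(1) e)
  have swe: "smooth (\<lambda>t. w * e t)" by (rule smooth_intros(4)[OF smooth_intros(1) se])
  have swwe: "smooth (\<lambda>t. w * (w * e t))" by (rule smooth_intros(4)[OF smooth_intros(1) swe])
  have sa: "smooth a" unfolding a_def by (rule smooth_intros(4)[OF \<rho>(1) se])
  have sa': "smooth a'" unfolding a'_def
    by (rule smooth_intros(3)[OF smooth_intros(4)[OF \<rho>(1) swe] smooth_intros(4)[OF \<rho>'(2) se]])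
  have sa'': "smooth a''" unfolding a''_def
    by (rule smooth_intros(3)[OF smooth_intros(3)[OF smooth_intros(4)[OF \<rho>(1) swwe] smooth_intros(4)[OF \<rho>'(2) swe]]
          smooth_intros(3)[OF smooth_intros(4)[OF \<rho>'(2) swe] smooth_intros(4)[OF \<rho>''(2) se]]])
  have a0: "a t = 0" if "t \<notin> {- pi..3 * pi}" for t using \<rho>(2)[OF that] by (simp add: a_def)
  have r0: "r t = 0" if "t \<notin> {- pi..3 * pi}" for t using supp'[OF that] supp''[OF that] by (simp add: r_def)
  have cr: "continuous_on UNIV r" unfolding r_def
    by (intro continuous_intros smooth_continuous \<rho>'(2) \<rho>''(2))
  have c\<rho>: "continuous_on UNIV \<rho>" by (rule smooth_continuous[OF \<rho>(1)])
  have ce: "continuous_on UNIV e" by (rule smooth_continuous[OF se])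
  have cb: "continuous_on UNIV b" by (rule smooth_continuous[OF b(3)])
  have cW: "continuous_on UNIV W" unfolding W_def
    by (intro continuous_intros smooth_continuous b)
  have W0: "W t = 0" if "t \<notin> {C..D}" for t using b(6)[OF that] bsupp''[OF that] by (simp add: W_def)
  have f: "L2_loc f" using w unfolding weak_helmholtz_def H1_loc_def by blast
  have int: "integrable lebesgue (\<lambda>x. f x * (c (fst x) * d (snd x)))"
    if "continuous_on UNIV c" "continuous_on UNIV d" and c0: "\<And>t. t \<notin> {- pi..3 * pi} \<Longrightarrow> c t = 0"
      and d0: "\<And>t. t \<notin> {C..D} \<Longrightarrow> d t = 0" for c d
  proof (rule L2_loc_mult_integrable[OF f continuous_on_product_function[OF that(1,2)] compact_cbox[of "(- pi, C)" "(3 * pi, D)"]])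
    fix x :: "real \<times> real" assume "x \<notin> cbox (- pi, C) (3 * pi, D)"
    then show "c (fst x) * d (snd x) = 0"
      using c0[of "fst x"] d0[of "snd x"] by (cases x) (auto simp: cbox_Pair_eq)
  qed
  have i1: "integrable lebesgue (\<lambda>x. f x * (r (fst x) * e (fst x) * b (snd x)))"
    by (rule int[where c = "\<lambda>t. r t * e t"]) (use cr ce cb r0 b(6) in \<open>auto intro: continuous_on_mult\<close>)
  have i2: "integrable lebesgue (\<lambda>x. f x * (\<rho> (fst x) * e (fst x) * W (snd x)))"
    by (rule int[where c = "\<lambda>t. \<rho> t * e t"]) (use c\<rho> ce cW \<rho>(2) W0 in \<open>auto intro: continuous_on_mult\<close>)
  have pointwise: "a'' (fst x) * b (snd x) + a (fst x) * b'' (snd x) + of_real (k\<^sup>2) * (a (fst x) * b (snd x)) =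
      r (fst x) * e (fst x) * b (snd x) + \<rho> (fst x) * e (fst x) * W (snd x)" for x :: "real \<times> real"
  proof -
    have "a'' t = r t * e t + w\<^sup>2 * (\<rho> t * e t)" for t
      unfolding a''_def r_def by (simp add: algebra_simps power2_eq_square)
    then have a''_eq: "a'' t = r t * e t - of_real ((alpha_j \<alpha> j)\<^sup>2) * (\<rho> t * e t)" for t
      unfolding w2 by simp
    show ?thesis unfolding a''_eq W_def a_def by (simp add: algebra_simps)
  qed
  have "(LINT x|lebesgue. F x * (a (fst x) * b (snd x))) =
      (LINT x|lebesgue. f x * (r (fst x) * e (fst x) * b (snd x) + \<rho> (fst x) * e (fst x) * W (snd x)))"
    using weak_helmholtz_test[OF w da da' sa sa' sa'' a0 b] unfolding pointwise by simp
  also have "\<dots> = (LINT x|lebesgue. f x * (r (fst x) * e (fst x) * b (snd x)) + f x * (\<rho> (fst x) * e (fst x) * W (snd x)))"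
    by (simp only: distrib_left)
  also have "\<dots> = (LINT x|lebesgue. f x * (r (fst x) * e (fst x) * b (snd x))) + (LINT x|lebesgue. f x * (\<rho> (fst x) * e (fst x) * W (snd x)))"
    by (rule Bochner_Integration.integral_add[OF i1 i2])
  finally have main: "(LINT x|lebesgue. (F x * (e (fst x) * b (snd x))) * \<rho> (fst x)) =
      (LINT x|lebesgue. (f x * (e (fst x) * b (snd x))) * r (fst x)) + (LINT x|lebesgue. (f x * (e (fst x) * W (snd x))) * \<rho> (fst x))"
    by (simp add: a_def mult_ac)
  have per: "u (x1 + 2 * pi, x2) * (e (fst (x1 + 2 * pi, x2)) * d (snd (x1 + 2 * pi, x2))) =
      u (x1, x2) * (e (fst (x1, x2)) * d (snd (x1, x2)))"
    if "\<And>x1 x2. u (x1 + 2 * pi, x2) = exp (\<i> * of_real (2 * pi * \<alpha>)) * u (x1, x2)"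
    for u :: "real \<times> real \<Rightarrow> complex" and d :: "real \<Rightarrow> complex" and x1 x2 :: real
    using quasiperiodic_shift[where f = u and \<alpha> = \<alpha>, OF that, of x1 x2 j] unfolding e_eq by (simp add: mult.assoc[symmetric])
  have strip: "set_integrable lebesgue Omega (\<lambda>x. f x * (e (fst x) * d (snd x)))"
    if "continuous_on UNIV d" "\<And>t. t \<notin> {C..D} \<Longrightarrow> d t = 0" for d
    by (rule L2_loc_strip_integrable[OF f continuous_on_product_function[OF ce that(1)], of C D]) (simp add: that(2))
  have fold\<rho>: "(LINT x|lebesgue. P x * \<rho> (fst x)) = (LINT x:Omega|lebesgue. P x)"
    if "\<And>x1 x2. P (x1 + 2 * pi, x2) = P (x1, x2)" "set_integrable lebesgue Omega P" for P
  proof -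
    have "(LINT x|lebesgue. P x * \<rho> (fst x)) = (LINT x:Omega|lebesgue. P x * (\<rho> (fst x) + \<rho> (fst x + 2 * pi)))"
      by (rule LINT_periodic_fold[OF that c\<rho>]) (rule \<rho>(2))
    also have "\<dots> = (LINT x:Omega|lebesgue. P x)"
      unfolding set_lebesgue_integral_def
      by (intro Bochner_Integration.integral_cong refl) (auto simp: indicator_def Omega_def \<rho>(3))
    finally show ?thesis .
  qed
  \<comment> \<open>The derivatives of the partition cancel between the two translates, so the
    cutoff in the periodic variable leaves no trace.\<close>
  have foldr: "(LINT x|lebesgue. P x * r (fst x)) = 0"
    if "\<And>x1 x2. P (x1 + 2 * pi, x2) = P (x1, x2)" "set_integrable lebesgue Omega P" for P
  proof -
    have r_sum: "r t + r (t + 2 * pi) = 0" if "t \<in> {- pi<..<pi}" for t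
    proof -
      have "r t + r (t + 2 * pi) = (\<rho>'' t + \<rho>'' (t + 2 * pi)) + 2 * w * (\<rho>' t + \<rho>' (t + 2 * pi))"
        by (simp add: r_def algebra_simps)
      then show ?thesis by (simp only: sum'[OF that] sum''[OF that]) simp
    qed
    have "(LINT x|lebesgue. P x * r (fst x)) = (LINT x:Omega|lebesgue. P x * (r (fst x) + r (fst x + 2 * pi)))"
      by (rule LINT_periodic_fold[OF that cr]) (rule r0)
    moreover have "(LINT x:Omega|lebesgue. P x * (r (fst x) + r (fst x + 2 * pi))) = (LINT x|(lebesgue :: (real \<times> real) measure). 0)"
      unfolding set_lebesgue_integral_def
      by (intro Bochner_Integration.integral_cong refl) (auto simp: indicator_def Omega_def r_sum)
    ultimately show ?thesis by simp
  qed
  have "(LINT x:Omega|lebesgue. F x * (e (fst x) * b (snd x))) = (LINT x:Omega|lebesgue. f x * (e (fst x) * W (snd x)))"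
    using main foldr[where P = "\<lambda>x. f x * (e (fst x) * b (snd x))", OF per[where u = f, OF qf] strip[where d = b, OF cb b(6)]]
      fold\<rho>[where P = "\<lambda>x. f x * (e (fst x) * W (snd x))", OF per[where u = f, OF qf] strip[where d = W, OF cW W0]]
      fold\<rho>[where P = "\<lambda>x. F x * (e (fst x) * b (snd x))", OF per[where u = F, OF qF] F[unfolded e_eq]]
    by simp
  then show ?thesis unfolding e_eq W_def by simp
qed


section \<open>Rayleigh coefficients\<close>

lemma has_integral_exp_int:
  fixes n :: int
  shows "((\<lambda>x. exp (\<i> * of_real (of_int n * x))) has_integral (if n = 0 then of_real (2 * pi) else 0)) {- pi..pi}"
proof (cases "n = 0")
  case True
  then show ?thesis using has_integral_const_real[of "1 :: complex" "- pi" pi] by (simp add: scaleR_conv_of_real)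
next
  case False
  let ?E = "\<lambda>x. exp (\<i> * of_real (of_int n * x)) :: complex"
  let ?k = "\<i> * of_int n :: complex"
  have k: "?k \<noteq> 0" using False by simp
  have "(?E has_integral (?E pi / ?k - ?E (- pi) / ?k)) {- pi..pi}"
  proof (rule fundamental_theorem_of_calculus)
    fix x
    have "((\<lambda>x. exp (?k * of_real x)) has_vector_derivative ?k * exp (?k * of_real x)) (at x within {- pi..pi})"
      by (rule has_vector_derivative_real_field derivative_eq_intros refl | simp)+
    then have "((\<lambda>x. exp (?k * of_real x) / ?k) has_vector_derivative ?k * exp (?k * of_real x) / ?k) (at x within {- pi..pi})"
      by (rule has_vector_derivative_divide)
    then show "((\<lambda>x. ?E x / ?k) has_vector_derivative ?E x) (at x within {- pi..pi})"
      using k by (simp add: mult.assoc)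
  qed simp
  moreover have "?E pi = ?E (- pi)"
  proof -
    have "?E pi = exp (\<i> * of_real (of_int n * (- pi)) + of_real (2 * of_int n * pi) * \<i>)"
      by (rule arg_cong[where f = exp]) (simp add: algebra_simps)
    also have "\<dots> = ?E (- pi)"
      unfolding exp_add using exp_integer_2pi[of "of_int n"] by simp
    finally show ?thesis .
  qed
  ultimately show ?thesis using False by simp
qed

lemma has_integral_product_box:
  fixes f g :: "real \<Rightarrow> complex"
  assumes "continuous_on UNIV f" "continuous_on UNIV g"
  shows "((\<lambda>x. f (fst x) * g (snd x)) has_integral integral {a..b} f * integral {c..d} g) (cbox (a, c) (b, d))"
proof -
  have cont: "continuous_on (cbox (a, c) (b, d)) (\<lambda>x. f (fst x) * g (snd x))"
    using assms by (auto intro!: continuous_intros continuous_on_compose2[of UNIV f] continuous_on_compose2[of UNIV g])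
  have "integral (cbox (a, c) (b, d)) (\<lambda>x. f (fst x) * g (snd x)) =
      integral (cbox a b) (\<lambda>x. integral (cbox c d) (\<lambda>y. f x * g y))"
    using integral_prod_continuous[OF cont] by simp
  also have "\<dots> = integral {a..b} f * integral {c..d} g"
    by (simp add: integral_mult_right)
  finally show ?thesis
    using integrable_integral[OF integrable_continuous[OF cont]] by simp
qed

text \<open>\<open>has_sum\<close> is a limit over the net of finite index sets; dominated
  convergence wants a sequence, and the symmetric intervals provide one.\<close>

lemma filterlim_symmetric_int_intervals:
  "filterlim (\<lambda>M. {- int M..int M}) (finite_subsets_at_top UNIV) sequentially"
  unfolding filterlim_finite_subsets_at_top
proof (intro allI impI)
  fix X :: "int set" assume X: "finite X \<and> X \<subseteq> UNIV"
  then obtain B where B: "\<And>x. x \<in> X \<Longrightarrow> \<bar>x\<bar> \<le> B"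
    by (metis bdd_above_finite bdd_above.unfold finite_imageI imageI)
  show "\<forall>\<^sub>F M in sequentially. finite {- int M..int M} \<and> X \<subseteq> {- int M..int M} \<and> {- int M..int M} \<subseteq> UNIV"
  proof (rule eventually_sequentiallyI[of "nat B"])
    fix M assume "nat B \<le> M"
    then have "\<bar>x\<bar> \<le> int M" if "x \<in> X" for x using B[OF that] by linarith
    then show "finite {- int M..int M} \<and> X \<subseteq> {- int M..int M} \<and> {- int M..int M} \<subseteq> UNIV"
      by (auto simp: abs_le_iff) (metis minus_le_iff)
  qed
qed

text \<open>One statement for both half planes: \<open>q m\<close> is the vertical factor of a mode,
  bounded by 1 because the imaginary part of \<open>beta_j\<close> is nonnegative. Orthogonality
  over a period selects the index \<open>j\<close>; absolute summability of the coefficients gives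
  the dominating constant.\<close>

lemma has_integral_mode_projection:
  fixes U :: "int \<Rightarrow> complex" and q :: "int \<Rightarrow> real \<Rightarrow> complex" and v :: "real \<times> real \<Rightarrow> complex"
  assumes v: "\<And>x1 x2. x2 \<in> {c..d} \<Longrightarrow>
      ((\<lambda>m. U m * exp (\<i> * of_real (alpha_j \<alpha> m * x1)) * q m x2) has_sum v (x1, x2)) UNIV"
    and q: "\<And>m. continuous_on UNIV (q m)" "\<And>m t. t \<in> {c..d} \<Longrightarrow> cmod (q m t) \<le> 1"
    and U: "(\<lambda>m. cmod (U m)) summable_on UNIV"
    and W: "continuous_on UNIV W"
  shows "((\<lambda>x. v x * exp (- \<i> * of_real (alpha_j \<alpha> j * fst x)) * W (snd x)) has_integral
    2 * of_real pi * U j * integral {c..d} (\<lambda>t. q j t * W t)) (cbox (- pi, c) (pi, d))"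
proof -
  define T where "T = (\<lambda>m x. U m * (exp (\<i> * of_real (of_int (m - j) * fst x)) * (q m (snd x) * W (snd x))) :: complex)"
  define Y where "Y = (\<lambda>m. U m * ((if m - j = 0 then of_real (2 * pi) else 0) * integral {c..d} (\<lambda>t. q m t * W t)))"
  have T: "(T m has_integral Y m) (cbox (- pi, c) (pi, d))" for m
  proof -
    have "((\<lambda>x. exp (\<i> * of_real (of_int (m - j) * fst x)) * (q m (snd x) * W (snd x))) has_integral
      integral {- pi..pi} (\<lambda>t. exp (\<i> * of_real (of_int (m - j) * t))) * integral {c..d} (\<lambda>t. q m t * W t))
      (cbox (- pi, c) (pi, d))"
      by (rule has_integral_product_box) (intro continuous_intros q W)+
    then show ?thesis
      unfolding T_def Y_def integral_unique[OF has_integral_exp_int] by (rule has_integral_mult_right)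
  qed
  have Teq: "T m x = U m * exp (\<i> * of_real (alpha_j \<alpha> m * fst x)) * q m (snd x) * (exp (- \<i> * of_real (alpha_j \<alpha> j * fst x)) * W (snd x))" for m x
  proof -
    have "exp (\<i> * of_real (of_int (m - j) * fst x)) =
        exp (\<i> * of_real (alpha_j \<alpha> m * fst x)) * (exp (- \<i> * of_real (alpha_j \<alpha> j * fst x)) :: complex)"
      unfolding exp_add[symmetric] by (rule arg_cong[where f = exp]) (simp add: alpha_j_def algebra_simps)
    then show ?thesis unfolding T_def by simp
  qed
  have "compact (W ` {c..d})" by (intro compact_continuous_image continuous_on_subset[OF W]) auto
  then obtain K where K: "\<And>t. t \<in> {c..d} \<Longrightarrow> cmod (W t) \<le> K"
    by (meson bounded_iff compact_imp_bounded image_eqI)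
  show ?thesis
  proof (rule has_integral_dominated_convergence[where f = "\<lambda>M x. \<Sum>m\<in>{- int M..int M}. T m x"
        and y = "\<lambda>M. \<Sum>m\<in>{- int M..int M}. Y m" and h = "\<lambda>_. infsum (\<lambda>m. cmod (U m)) UNIV * K"])
    show "((\<lambda>x. \<Sum>m\<in>{- int M..int M}. T m x) has_integral (\<Sum>m\<in>{- int M..int M}. Y m)) (cbox (- pi, c) (pi, d))" for M
      by (intro has_integral_sum T) auto
    show "(\<lambda>_. infsum (\<lambda>m. cmod (U m)) UNIV * K) integrable_on cbox (- pi, c) (pi, d)"
      by (rule integrable_const)
    show "\<forall>x\<in>cbox (- pi, c) (pi, d). norm (\<Sum>m\<in>{- int M..int M}. T m x) \<le> infsum (\<lambda>m. cmod (U m)) UNIV * K" for M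
    proof
      fix x assume "x \<in> cbox (- pi, c) (pi, d)"
      then have x: "snd x \<in> {c..d}" by (cases x) (auto simp: cbox_Pair_eq)
      have K0: "0 \<le> K" using K[OF x] norm_ge_zero order_trans by blast
      have "norm (\<Sum>m\<in>{- int M..int M}. T m x) \<le> (\<Sum>m\<in>{- int M..int M}. cmod (U m) * K)"
      proof (rule sum_norm_le)
        fix m
        have "cmod (q m (snd x)) * cmod (W (snd x)) \<le> 1 * K"
          using q(2)[OF x] K[OF x] by (intro mult_mono) auto
        then have "cmod (U m) * (cmod (q m (snd x)) * cmod (W (snd x))) \<le> cmod (U m) * K"
          by (intro mult_left_mono) auto
        then show "norm (T m x) \<le> cmod (U m) * K"
          unfolding T_def norm_mult norm_exp_i_times by simp
      qed
      also have "\<dots> = (\<Sum>m\<in>{- int M..int M}. cmod (U m)) * K" by (simp add: sum_distrib_right)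
      also have "\<dots> \<le> infsum (\<lambda>m. cmod (U m)) UNIV * K"
        using K0 U by (intro mult_right_mono finite_sum_le_infsum) auto
      finally show "norm (\<Sum>m\<in>{- int M..int M}. T m x) \<le> infsum (\<lambda>m. cmod (U m)) UNIV * K" .
    qed
    show "\<forall>x\<in>cbox (- pi, c) (pi, d). (\<lambda>M. \<Sum>m\<in>{- int M..int M}. T m x)
        \<longlonglongrightarrow> v x * exp (- \<i> * of_real (alpha_j \<alpha> j * fst x)) * W (snd x)"
    proof
      fix x assume "x \<in> cbox (- pi, c) (pi, d)"
      then have x: "snd x \<in> {c..d}" by (cases x) (auto simp: cbox_Pair_eq)
      have "(\<lambda>M. \<Sum>m\<in>{- int M..int M}. U m * exp (\<i> * of_real (alpha_j \<alpha> m * fst x)) * q m (snd x)) \<longlonglongrightarrow> v x"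
        using filterlim_compose[OF v[OF x, of "fst x", unfolded has_sum_def] filterlim_symmetric_int_intervals] by simp
      then have "(\<lambda>M. (\<Sum>m\<in>{- int M..int M}. U m * exp (\<i> * of_real (alpha_j \<alpha> m * fst x)) * q m (snd x)) *
          (exp (- \<i> * of_real (alpha_j \<alpha> j * fst x)) * W (snd x)))
          \<longlonglongrightarrow> v x * (exp (- \<i> * of_real (alpha_j \<alpha> j * fst x)) * W (snd x))"
        by (intro tendsto_mult tendsto_const)
      then show "(\<lambda>M. \<Sum>m\<in>{- int M..int M}. T m x)
        \<longlonglongrightarrow> v x * exp (- \<i> * of_real (alpha_j \<alpha> j * fst x)) * W (snd x)"
        unfolding Teq sum_distrib_right[symmetric] mult.assoc[of "v x"] .
    qed
    \<comment> \<open>Only the index \<open>j\<close> contributes, so the integrals are constant in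
      \<open>M\<close> once the range contains \<open>j\<close>.\<close>
    have "(\<Sum>m\<in>{- int M..int M}. Y m) = 2 * of_real pi * U j * integral {c..d} (\<lambda>t. q j t * W t)" if "nat \<bar>j\<bar> \<le> M" for M
    proof -
      have "(\<Sum>m\<in>{- int M..int M}. Y m) = (\<Sum>m\<in>{j}. Y m)"
      proof (rule sum.mono_neutral_right)
        show "{j} \<subseteq> {- int M..int M}" using that by auto
      qed (auto simp: Y_def)
      then show ?thesis by (simp add: Y_def)
    qed
    then show "(\<lambda>M. \<Sum>m\<in>{- int M..int M}. Y m) \<longlonglongrightarrow> 2 * of_real pi * U j * integral {c..d} (\<lambda>t. q j t * W t)"
      by (intro tendsto_eventually eventually_sequentiallyI[of "nat \<bar>j\<bar>"])
  qed
qed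

text \<open>As the second derivative of \<open>q\<close> is \<open>w\<^sup>2\<close> times
  \<open>q\<close>, the integrand is the derivative of the Wronskian of \<open>q\<close> and
  \<open>b\<close>. The offset \<open>d\<close> admits phases measured from \<open>h\<close> or
  \<open>- h\<close>.\<close>

lemma integral_wronskian:
  fixes b :: "real \<Rightarrow> complex" and w d :: complex
  assumes "A \<le> B" and b: "\<And>x. (b has_vector_derivative b' x) (at x)" "\<And>x. (b' has_vector_derivative b'' x) (at x)"
  defines "q \<equiv> \<lambda>x. exp (w * of_real x + d)"
  shows "integral {A..B} (\<lambda>x. q x * (b'' x - w\<^sup>2 * b x)) =
    (b' B * q B - w * (b B * q B)) - (b' A * q A - w * (b A * q A))"
proof (rule integral_unique, rule fundamental_theorem_of_calculus[OF \<open>A \<le> B\<close>])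
  fix x
  have q: "(q has_vector_derivative w * q x) (at x within {A..B})"
    unfolding q_def by (rule has_vector_derivative_real_field derivative_eq_intros refl | simp)+
  note d = has_vector_derivative_at_within[OF b(1)] has_vector_derivative_at_within[OF b(2)]
  have "((\<lambda>x. b' x * q x - w * (b x * q x)) has_vector_derivative
      (b' x * (w * q x) + b'' x * q x) - w * (b x * (w * q x) + b' x * q x)) (at x within {A..B})"
    by (intro has_vector_derivative_diff has_vector_derivative_mult_right has_vector_derivative_mult d q)
  then show "((\<lambda>x. b' x * q x - w * (b x * q x)) has_vector_derivative q x * (b'' x - w\<^sup>2 * b x)) (at x within {A..B})"
    by (simp add: algebra_simps power2_eq_square)
qed

lemma rayleigh_plus_box:
  assumes "rayleigh_expansion k \<alpha> h v up um" "continuous_on UNIV W" "h \<le> d"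
  shows "((\<lambda>x. v x * exp (- \<i> * of_real (alpha_j \<alpha> j * fst x)) * W (snd x)) has_integral
    2 * of_real pi * up j * integral {h..d} (\<lambda>t. exp (\<i> * beta_j k \<alpha> j * of_real (t - h)) * W t))
    (cbox (- pi, h) (pi, d))"
proof (rule has_integral_mode_projection[where q = "\<lambda>m t. exp (\<i> * beta_j k \<alpha> m * of_real (t - h))"])
  have v: "((\<lambda>m. up m * exp (\<i> * of_real (alpha_j \<alpha> m * x1) + \<i> * beta_j k \<alpha> m * of_real (x2 - h))) has_sum v (x1, x2)) UNIV"
    if "x2 \<ge> h" for x1 x2
    using assms(1) that unfolding rayleigh_expansion_def by blast
  then show "((\<lambda>m. up m * exp (\<i> * of_real (alpha_j \<alpha> m * x1)) * exp (\<i> * beta_j k \<alpha> m * of_real (x2 - h))) has_sum v (x1, x2)) UNIV"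
    if "x2 \<in> {h..d}" for x1 x2 using that by (simp add: exp_add mult.assoc)
  \<comment> \<open>At the point \<open>(0, h)\<close> all exponentials equal 1, so the expansion
    there is the sum of the coefficients, and unconditional convergence of complex numbers is
    absolute.\<close>
  show "(\<lambda>m. cmod (up m)) summable_on UNIV"
    using has_sum_imp_summable[OF v[of h 0]] by (simp add: summable_on_iff_abs_summable_on_complex)
  show "cmod (exp (\<i> * beta_j k \<alpha> m * of_real (t - h))) \<le> 1" if "t \<in> {h..d}" for m t
    using that Im_beta_j_nonneg[of k \<alpha> m] by (simp add: mult_nonneg_nonneg)
qed (intro continuous_intros assms)+

lemma rayleigh_minus_box:
  assumes "rayleigh_expansion k \<alpha> h v up um" "continuous_on UNIV W" "c \<le> - h"
  shows "((\<lambda>x. v x * exp (- \<i> * of_real (alpha_j \<alpha> j * fst x)) * W (snd x)) has_integral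
    2 * of_real pi * um j * integral {c..- h} (\<lambda>t. exp (- \<i> * beta_j k \<alpha> j * of_real (t + h)) * W t))
    (cbox (- pi, c) (pi, - h))"
proof (rule has_integral_mode_projection[where q = "\<lambda>m t. exp (- \<i> * beta_j k \<alpha> m * of_real (t + h))"])
  have v: "((\<lambda>m. um m * exp (\<i> * of_real (alpha_j \<alpha> m * x1) - \<i> * beta_j k \<alpha> m * of_real (x2 + h))) has_sum v (x1, x2)) UNIV"
    if "x2 \<le> - h" for x1 x2
    using assms(1) that unfolding rayleigh_expansion_def by blast
  show "((\<lambda>m. um m * exp (\<i> * of_real (alpha_j \<alpha> m * x1)) * exp (- \<i> * beta_j k \<alpha> m * of_real (x2 + h))) has_sum v (x1, x2)) UNIV"
    if "x2 \<in> {c..- h}" for x1 x2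
  proof -
    have "exp (\<i> * of_real (alpha_j \<alpha> m * x1) - \<i> * beta_j k \<alpha> m * of_real (x2 + h)) =
        exp (\<i> * of_real (alpha_j \<alpha> m * x1)) * exp (- \<i> * beta_j k \<alpha> m * of_real (x2 + h))" for m
      unfolding exp_add[symmetric] by simp
    with v[of x2 x1] that show ?thesis by (simp add: mult.assoc)
  qed
  show "(\<lambda>m. cmod (um m)) summable_on UNIV"
    using has_sum_imp_summable[OF v[of "- h" 0]] by (simp add: summable_on_iff_abs_summable_on_complex)
  show "cmod (exp (- \<i> * beta_j k \<alpha> m * of_real (t + h))) \<le> 1" if "t \<in> {c..- h}" for m t
    using that Im_beta_j_nonneg[of k \<alpha> m] by (simp add: mult_nonneg_nonpos)
qed (intro continuous_intros assms)+

text \<open>\<open>f\<close> lives in the two strips above \<open>h\<close> and below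
  \<open>- h\<close>; \<open>0 < h\<close> keeps them disjoint, and the lateral boundary of the cell
  is a null set.\<close>

lemma strip_integral_split:
  fixes f :: "real \<times> real \<Rightarrow> complex"
  assumes "0 < h" and f: "set_integrable lebesgue (cbox (- pi, h) (pi, d)) f"
      "set_integrable lebesgue (cbox (- pi, - d) (pi, - h)) f"
    and f0: "\<And>x. \<bar>snd x\<bar> < h \<Longrightarrow> f x = 0" "\<And>x. d < \<bar>snd x\<bar> \<Longrightarrow> f x = 0"
    and Om: "set_integrable lebesgue Omega f"
  shows "(LINT x:Omega|lebesgue. f x) = integral (cbox (- pi, h) (pi, d)) f + integral (cbox (- pi, - d) (pi, - h)) f"
proof -
  let ?p = "cbox (- pi, h) (pi, d)" and ?m = "cbox (- pi, - d) (pi, - h)"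
  have "(LINT x:Omega|lebesgue. f x) = (LINT x|lebesgue. indicat_real ?p x *\<^sub>R f x + indicat_real ?m x *\<^sub>R f x)"
    unfolding set_lebesgue_integral_def
  proof (rule integral_cong_AE)
    show "AE x in lebesgue. indicat_real Omega x *\<^sub>R f x = indicat_real ?p x *\<^sub>R f x + indicat_real ?m x *\<^sub>R f x"
      using AE_fst_neq[of "- pi"] AE_fst_neq[of pi]
    proof eventually_elim
      case (elim x)
      obtain x1 x2 where x: "x = (x1, x2)" by (cases x)
      consider "\<bar>x2\<bar> < h" | "d < \<bar>x2\<bar>" | "h \<le> x2" "x2 \<le> d" | "- d \<le> x2" "x2 \<le> - h" by linarith
      then show ?case
        using elim \<open>0 < h\<close> f0[of x]
        by cases (auto simp: x indicator_def Omega_def cbox_Pair_eq)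
    qed
    show "(\<lambda>x. indicat_real Omega x *\<^sub>R f x) \<in> borel_measurable lebesgue"
      "(\<lambda>x. indicat_real ?p x *\<^sub>R f x + indicat_real ?m x *\<^sub>R f x) \<in> borel_measurable lebesgue"
      using f Om unfolding set_integrable_def by (auto intro!: borel_measurable_add)
  qed
  also have "\<dots> = (LINT x:?p|lebesgue. f x) + (LINT x:?m|lebesgue. f x)"
    using f unfolding set_integrable_def set_lebesgue_integral_def by simp
  also have "\<dots> = integral ?p f + integral ?m f"
    using f by (simp add: set_lebesgue_integral_eq_integral)
  finally show ?thesis .
qed

section \<open>Rayleigh coefficients as integrals over the scatterer\<close>

text \<open>The wave with exponents \<open>- \<i> * alpha_j \<alpha> j\<close> and \<open>v\<close>
  solves the homogeneous Helmholtz equation. After the cutoff, the operator applied to it lives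
  above \<open>h\<close> and below \<open>- h\<close>, where the Rayleigh expansions hold, while the
  source still sees the uncut wave. Keeping \<open>v\<close> general lets one computation serve both
  roots.\<close>

lemma rayleigh_coefficient_identity:
  assumes "k > 0" "h > 0" and n: "periodic_medium n"
    and sup: "(SUP x\<in>scatterer n. ereal \<bar>snd x\<bar>) < ereal h"
    and ui: "quasiperiodic \<alpha> ui" and sol: "scattering_solution k \<alpha> h n ui us up um"
    and j: "j \<in> propagating k \<alpha>"
    and v: "v\<^sup>2 = - (beta_j k \<alpha> j)\<^sup>2"
  shows "2 * of_real pi * up j * ((\<i> * beta_j k \<alpha> j - v) * exp (v * of_real h)) +
      2 * of_real pi * um j * ((\<i> * beta_j k \<alpha> j + v) * exp (- v * of_real h)) =
    - of_real (k\<^sup>2) * (LINT y|lebesgue_on (scatterer n).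
      exp (- \<i> * of_real (alpha_j \<alpha> j * fst y)) * exp (v * of_real (snd y)) * contrast n y * (ui y + us y))"
proof -
  define \<beta> where "\<beta> = beta_j k \<alpha> j"
  have \<beta>2: "of_real (k\<^sup>2 - (alpha_j \<alpha> j)\<^sup>2) = \<beta>\<^sup>2"
    using beta_j_propagating[OF \<open>k > 0\<close> j] by (simp add: \<beta>_def flip: of_real_power)
  define F where "F = (\<lambda>x. - of_real (k\<^sup>2) * contrast n x * (ui x + us x))"
  have us: "quasiperiodic \<alpha> us" and L2: "L2_on (scatterer n) (\<lambda>x. ui x + us x)"
    and w: "weak_helmholtz k us F" and ray: "rayleigh_expansion k \<alpha> h us up um"
    using sol unfolding scattering_solution_def F_def by auto
  have us_loc: "L2_loc us" using w unfolding weak_helmholtz_def H1_loc_def by blast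
  have shift: "f (x1 + 2 * pi, x2) = exp (\<i> * of_real (2 * pi * \<alpha>)) * f (x1, x2)"
    if "quasiperiodic \<alpha> f" for f x1 x2
    using that unfolding quasiperiodic_def by (metis mult.right_neutral of_int_1)
  have F_shift: "F (x1 + 2 * pi, x2) = exp (\<i> * of_real (2 * pi * \<alpha>)) * F (x1, x2)" for x1 x2
  proof -
    have "contrast n (x1 + 2 * pi, x2) = contrast n (x1, x2)"
      using n unfolding periodic_medium_def contrast_def by simp
    then show ?thesis unfolding F_def shift[OF us] shift[OF ui] by (simp add: algebra_simps)
  qed
  obtain \<eta> where \<eta>: "smooth \<eta>" "\<And>t. t \<notin> {- h - 2..h + 2} \<Longrightarrow> \<eta> t = 0" "\<And>t. \<bar>t\<bar> \<le> h + 1 \<Longrightarrow> \<eta> t = 1"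
    using smooth_cutoff_exists[OF \<open>h > 0\<close>] by blast
  define E where "E = (\<lambda>t. exp (v * of_real t))"
  have E: "(E has_vector_derivative v * E t) (at t)" for t
    unfolding E_def by (rule has_vector_derivative_real_field derivative_eq_intros refl | simp)+
  define b where "b = (\<lambda>t. \<eta> t * E t)"
  have sb: "smooth b" unfolding b_def E_def by (rule smooth_intros(4)[OF \<eta>(1) smooth_intros(2)])
  obtain b' where b': "\<And>x. (b has_vector_derivative b' x) (at x)" "smooth b'"
    using smooth_derivative[OF sb] by blast
  obtain b'' where b'': "\<And>x. (b' has_vector_derivative b'' x) (at x)" "smooth b''"
    using smooth_derivative[OF b'(2)] by blast
  have b0: "b t = 0" if "t \<notin> {- h - 2..h + 2}" for t using \<eta>(2)[OF that] by (simp add: b_def)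
  have b'0: "b' t = 0" if "t \<notin> {- h - 2..h + 2}" for t
    by (rule smooth_bounded_support_derivative[OF b'(1) _ that]) (rule b0)
  have b''0: "b'' t = 0" if "t \<notin> {- h - 2..h + 2}" for t
    by (rule smooth_bounded_support_derivative[OF b''(1) _ that]) (rule b'0)
  let ?S = "{- h - 1<..<h + 1}"
  have b_in: "b t = E t" if "t \<in> ?S" for t using \<eta>(3)[of t] that by (simp add: b_def abs_le_iff)
  have b'_in: "b' t = v * E t" if "t \<in> ?S" for t
    by (rule vector_derivative_local[OF b'(1) E open_greaterThanLessThan that]) (rule b_in)
  have b''_in: "b'' t = v * (v * E t)" if "t \<in> ?S" for t
    by (rule vector_derivative_local[OF b''(1) has_vector_derivative_mult_right[OF E] open_greaterThanLessThan that]) (rule b'_in)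
  define W where "W = (\<lambda>t. b'' t + of_real (k\<^sup>2 - (alpha_j \<alpha> j)\<^sup>2) * b t)"
  \<comment> \<open>Where the cutoff is 1, \<open>b\<close> is an exponential annihilated by the
    one-dimensional operator, as \<open>v\<^sup>2 + \<beta>\<^sup>2 = 0\<close>.\<close>
  have W0: "W t = 0" if "\<bar>t\<bar> < h" for t
  proof -
    have t: "t \<in> ?S" using that by auto
    have "W t = (v\<^sup>2 + \<beta>\<^sup>2) * E t"
      unfolding W_def \<beta>2 b_in[OF t] b''_in[OF t] by (simp add: algebra_simps power2_eq_square)
    then show ?thesis using v by (simp add: \<beta>_def)
  qed
  \<comment> \<open>The cutoff ends at \<open>h + 2\<close>; at the height \<open>h + 3\<close>,
    strictly outside, \<open>b\<close> and \<open>b'\<close> vanish and the Wronskian has no outer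
    boundary term.\<close>
  have W0': "W t = 0" if "h + 3 < \<bar>t\<bar>" for t
  proof -
    have "t \<notin> {- h - 2..h + 2}" using that by auto
    then show ?thesis using b0 b''0 by (simp add: W_def)
  qed
  have cW: "continuous_on UNIV W" unfolding W_def
    by (intro continuous_intros smooth_continuous sb b'')
  define e where "e = (\<lambda>x :: real \<times> real. exp (- \<i> * of_real (alpha_j \<alpha> j * fst x)))"
  have ce: "continuous_on UNIV e" unfolding e_def by (intro continuous_intros)
  have csnd: "continuous_on UNIV (\<lambda>x :: real \<times> real. g (snd x))" if "continuous_on UNIV g" for g :: "real \<Rightarrow> complex"
    by (auto intro!: continuous_on_compose2[OF that] continuous_intros)
  define c where "c = (\<lambda>x. - of_real (k\<^sup>2) * (e x * b (snd x)))"
  have cc: "continuous_on UNIV c" unfolding c_def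
    by (intro continuous_intros ce csnd smooth_continuous sb)
  have iD: "integrable (lebesgue_on (scatterer n)) (\<lambda>y. c y * contrast n y * (ui y + us y))"
    by (rule scatterer_mult_integrable[OF n sup L2 cc])
  have Dm: "scatterer n \<in> sets lebesgue" using scatterer_lmeasurable[OF sup] by (rule fmeasurableD)
  \<comment> \<open>The contrast is 0 at every point of the cell off the scatterer, so the equality
    holds everywhere and can be used for rewriting.\<close>
  have ind: "indicat_real (scatterer n) x *\<^sub>R (c x * contrast n x * (ui x + us x)) =
      indicat_real Omega x *\<^sub>R (F x * (e x * b (snd x)))" for x
  proof -
    have "scatterer n \<subseteq> Omega" by (auto simp: scatterer_def)
    then show ?thesis
      using contrast_outside_scatterer[of x n] by (auto simp: indicator_def F_def c_def)
  qed
  have FOm: "set_integrable lebesgue Omega (\<lambda>x. F x * (e x * b (snd x)))"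
    unfolding set_integrable_def ind[symmetric] using iD Dm by (simp add: integrable_restrict_space)
  have "(LINT x:Omega|lebesgue. F x * (e x * b (snd x))) =
      (LINT y|lebesgue_on (scatterer n). c y * contrast n y * (ui y + us y))"
    unfolding set_lebesgue_integral_def ind[symmetric] using Dm by (simp add: integral_restrict_space)
  also have "\<dots> = (LINT y|lebesgue_on (scatterer n). - of_real (k\<^sup>2) * (e y * E (snd y) * contrast n y * (ui y + us y)))"
  proof (rule Bochner_Integration.integral_cong[OF refl])
    fix y assume "y \<in> space (lebesgue_on (scatterer n))"
    then have "\<bar>snd y\<bar> < h" using scatterer_bounds(1)[OF sup] by simp
    then have "b (snd y) = E (snd y)" by (intro b_in) auto
    then show "c y * contrast n y * (ui y + us y) = - of_real (k\<^sup>2) * (e y * E (snd y) * contrast n y * (ui y + us y))"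
      by (simp add: c_def)
  qed
  also have "\<dots> = - of_real (k\<^sup>2) * (LINT y|lebesgue_on (scatterer n). e y * E (snd y) * contrast n y * (ui y + us y))"
    by (rule integral_mult_right_zero)
  finally have rhs: "(LINT x:Omega|lebesgue. F x * (e x * b (snd x))) =
      - of_real (k\<^sup>2) * (LINT y|lebesgue_on (scatterer n). e y * E (snd y) * contrast n y * (ui y + us y))" .
  let ?P = "\<lambda>x. us x * (e x * W (snd x))"
  have cell: "(LINT x:Omega|lebesgue. ?P x) = (LINT x:Omega|lebesgue. F x * (e x * b (snd x)))"
    unfolding e_def W_def
  proof (rule weak_helmholtz_period_cell[where C = "- h - 2" and D = "h + 2"])
    show "us (x1 + 2 * pi, x2) = exp (\<i> * of_real (2 * pi * \<alpha>)) * us (x1, x2)" for x1 x2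
      by (rule shift[OF us])
    show "set_integrable lebesgue Omega (\<lambda>x. F x * (exp (- \<i> * of_real (alpha_j \<alpha> j * fst x)) * b (snd x)))"
      using FOm unfolding e_def .
  qed (rule F_shift w b'(1) b''(1) sb b'(2) b''(2) b0, assumption?)+
  have P_eq: "?P = (\<lambda>x. us x * exp (- \<i> * of_real (alpha_j \<alpha> j * fst x)) * W (snd x))"
    by (simp add: e_def mult.assoc)
  have cP: "continuous_on UNIV (\<lambda>x. e x * W (snd x))"
    by (intro continuous_intros ce csnd cW)
  have "(LINT x:Omega|lebesgue. ?P x) =
      integral (cbox (- pi, h) (pi, h + 3)) ?P + integral (cbox (- pi, - (h + 3)) (pi, - h)) ?P"
  proof (rule strip_integral_split[OF \<open>h > 0\<close>])
    show "set_integrable lebesgue Omega ?P"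
      by (rule L2_loc_strip_integrable[OF us_loc cP, of "- (h + 3)" "h + 3"]) (use W0' in auto)
  qed (use W0 W0' in \<open>auto intro!: L2_on_compact_set_integrable us_loc cP\<close>)
  also have "integral (cbox (- pi, h) (pi, h + 3)) ?P =
      2 * of_real pi * up j * integral {h..h + 3} (\<lambda>t. exp (\<i> * \<beta> * of_real (t - h)) * W t)"
    unfolding P_eq \<beta>_def by (rule integral_unique, rule rayleigh_plus_box[OF ray cW]) simp
  also have "integral (cbox (- pi, - (h + 3)) (pi, - h)) ?P =
      2 * of_real pi * um j * integral {- (h + 3)..- h} (\<lambda>t. exp (- \<i> * \<beta> * of_real (t + h)) * W t)"
    unfolding P_eq \<beta>_def by (rule integral_unique, rule rayleigh_minus_box[OF ray cW]) simp
  \<comment> \<open>Only the lower end contributes; there the exponential factor is 1 and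
    \<open>b' h = v * E h\<close>.\<close>
  also have "integral {h..h + 3} (\<lambda>t. exp (\<i> * \<beta> * of_real (t - h)) * W t) = (\<i> * \<beta> - v) * E h"
  proof -
    have "exp (\<i> * \<beta> * of_real (t - h)) * W t = exp (\<i> * \<beta> * of_real t + - \<i> * \<beta> * of_real h) * (b'' t - (\<i> * \<beta>)\<^sup>2 * b t)" for t
      unfolding W_def \<beta>2 by (simp add: power_mult_distrib algebra_simps)
    then have "integral {h..h + 3} (\<lambda>t. exp (\<i> * \<beta> * of_real (t - h)) * W t) =
        - (b' h - \<i> * \<beta> * b h)"
      using integral_wronskian[of h "h + 3" b b' b'' "\<i> * \<beta>" "- \<i> * \<beta> * of_real h", OF _ b'(1) b''(1)]
        b0[of "h + 3"] b'0[of "h + 3"] by simp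
    then show ?thesis using b_in[of h] b'_in[of h] \<open>h > 0\<close> by (simp add: algebra_simps)
  qed
  \<comment> \<open>Here only the upper end contributes, and the exponent has the opposite
    sign.\<close>
  also have "integral {- (h + 3)..- h} (\<lambda>t. exp (- \<i> * \<beta> * of_real (t + h)) * W t) = (\<i> * \<beta> + v) * E (- h)"
  proof -
    have "exp (- \<i> * \<beta> * of_real (t + h)) * W t = exp (- \<i> * \<beta> * of_real t + - \<i> * \<beta> * of_real h) * (b'' t - (- \<i> * \<beta>)\<^sup>2 * b t)" for t
      unfolding W_def \<beta>2 by (simp add: power_mult_distrib algebra_simps)
    then have "integral {- (h + 3)..- h} (\<lambda>t. exp (- \<i> * \<beta> * of_real (t + h)) * W t) =
        b' (- h) + \<i> * \<beta> * b (- h)"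
      using integral_wronskian[of "- (h + 3)" "- h" b b' b'' "- \<i> * \<beta>" "- \<i> * \<beta> * of_real h", OF _ b'(1) b''(1)]
        b0[of "- (h + 3)"] b'0[of "- (h + 3)"] by simp
    then show ?thesis using b_in[of "- h"] b'_in[of "- h"] \<open>h > 0\<close> by (simp add: algebra_simps)
  qed
  finally have "2 * of_real pi * up j * ((\<i> * \<beta> - v) * E h) + 2 * of_real pi * um j * ((\<i> * \<beta> + v) * E (- h)) =
      - of_real (k\<^sup>2) * (LINT y|lebesgue_on (scatterer n). e y * E (snd y) * contrast n y * (ui y + us y))"
    unfolding cell rhs by simp
  then show ?thesis by (simp add: E_def e_def \<beta>_def)
qed

text \<open>The root \<open>v = - \<i> * \<beta>\<close> annihilates the factor of
  \<open>um j\<close>, the root \<open>v = \<i> * \<beta>\<close> that of \<open>up j\<close>. The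
  surviving factor is 2 i beta; with 2 pi and the sign of the source it is inverted to i / (4 pi
  beta), the prefactor of \<open>g_plus\<close> and \<open>g_minus\<close>.\<close>

lemma rayleigh_coefficients:
  assumes "k > 0" "h > 0" "periodic_medium n"
    and sup: "(SUP x\<in>scatterer n. ereal \<bar>snd x\<bar>) < ereal h"
    and "quasiperiodic \<alpha> ui" "scattering_solution k \<alpha> h n ui us up um"
    and j: "j \<in> propagating k \<alpha>"
  shows "up j = of_real (k\<^sup>2) * (LINT y|lebesgue_on (scatterer n). g_plus k \<alpha> h j y * contrast n y * (ui y + us y))"
    and "um j = of_real (k\<^sup>2) * (LINT y|lebesgue_on (scatterer n). g_minus k \<alpha> h j y * contrast n y * (ui y + us y))"
proof -
  note id = rayleigh_coefficient_identity[OF assms]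
  define \<beta> where "\<beta> = beta_j k \<alpha> j"
  have "\<beta> \<noteq> 0" using beta_j_propagating[OF \<open>k > 0\<close> j] by (simp add: \<beta>_def)
  define J where "J = (\<lambda>v. LINT y|lebesgue_on (scatterer n).
      exp (- \<i> * of_real (alpha_j \<alpha> j * fst y)) * exp (v * of_real (snd y)) * contrast n y * (ui y + us y))"
  have idJ: "2 * of_real pi * up j * ((\<i> * \<beta> - v) * exp (v * of_real h)) +
      2 * of_real pi * um j * ((\<i> * \<beta> + v) * exp (- v * of_real h)) = - (of_real (k\<^sup>2) * J v)"
    if "v\<^sup>2 = - \<beta>\<^sup>2" for v
    using id[of v] that unfolding J_def \<beta>_def by simp
  have split_exp: "exp (\<i> * \<beta> * of_real h) * exp (- (\<i> * \<beta> * of_real h)) = 1"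
    by (simp add: exp_minus)
  have J: "of_real (k\<^sup>2) * (LINT y|lebesgue_on (scatterer n). g y * contrast n y * (ui y + us y)) =
      \<i> / (4 * of_real pi * \<beta>) * exp (\<i> * \<beta> * of_real h) * (of_real (k\<^sup>2) * J v)"
    if "\<And>y. g y = \<i> / (4 * of_real pi * \<beta>) * exp (\<i> * \<beta> * of_real h) *
        (exp (- \<i> * of_real (alpha_j \<alpha> j * fst y)) * exp (v * of_real (snd y)))" for g v
  proof -
    have "(LINT y|lebesgue_on (scatterer n). g y * contrast n y * (ui y + us y)) =
        \<i> / (4 * of_real pi * \<beta>) * exp (\<i> * \<beta> * of_real h) * J v"
      unfolding that J_def integral_mult_right_zero[symmetric] by (simp only: mult.assoc)
    then show ?thesis by (simp add: mult_ac)
  qed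
  have "g_plus k \<alpha> h j y = \<i> / (4 * of_real pi * \<beta>) * exp (\<i> * \<beta> * of_real h) *
        (exp (- \<i> * of_real (alpha_j \<alpha> j * fst y)) * exp (- \<i> * \<beta> * of_real (snd y)))" for y
  proof -
    have "exp (- \<i> * of_real (alpha_j \<alpha> j * fst y) - \<i> * \<beta> * of_real (snd y - h)) = exp (\<i> * \<beta> * of_real h) *
        (exp (- \<i> * of_real (alpha_j \<alpha> j * fst y)) * exp (- \<i> * \<beta> * of_real (snd y)))"
      unfolding exp_add[symmetric] by (rule arg_cong[where f = exp]) (simp add: algebra_simps)
    then show ?thesis unfolding g_plus_def \<beta>_def[symmetric] by simp
  qed
  note Jp = J[OF this]
  have "g_minus k \<alpha> h j y = \<i> / (4 * of_real pi * \<beta>) * exp (\<i> * \<beta> * of_real h) *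
        (exp (- \<i> * of_real (alpha_j \<alpha> j * fst y)) * exp (\<i> * \<beta> * of_real (snd y)))" for y
  proof -
    have "exp (- \<i> * of_real (alpha_j \<alpha> j * fst y) + \<i> * \<beta> * of_real (snd y + h)) = exp (\<i> * \<beta> * of_real h) *
        (exp (- \<i> * of_real (alpha_j \<alpha> j * fst y)) * exp (\<i> * \<beta> * of_real (snd y)))"
      unfolding exp_add[symmetric] by (rule arg_cong[where f = exp]) (simp add: algebra_simps)
    then show ?thesis unfolding g_minus_def \<beta>_def[symmetric] by simp
  qed
  note Jm = J[OF this]
  have "of_real (k\<^sup>2) * J (- \<i> * \<beta>) = - (4 * of_real pi * \<i> * \<beta> * exp (- (\<i> * \<beta> * of_real h)) * up j)"
  proof -
    have "- (of_real (k\<^sup>2) * J (- \<i> * \<beta>)) = 4 * of_real pi * \<i> * \<beta> * exp (- (\<i> * \<beta> * of_real h)) * up j"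
      using idJ[of "- \<i> * \<beta>", symmetric] by (simp add: power_mult_distrib)
    then show ?thesis by (metis minus_minus)
  qed
  then have "of_real (k\<^sup>2) * (LINT y|lebesgue_on (scatterer n). g_plus k \<alpha> h j y * contrast n y * (ui y + us y)) =
      (exp (\<i> * \<beta> * of_real h) * exp (- (\<i> * \<beta> * of_real h))) * up j"
    unfolding Jp using \<open>\<beta> \<noteq> 0\<close> by (simp add: field_simps)
  then show "up j = of_real (k\<^sup>2) * (LINT y|lebesgue_on (scatterer n). g_plus k \<alpha> h j y * contrast n y * (ui y + us y))"
    unfolding split_exp by simp
  have "of_real (k\<^sup>2) * J (\<i> * \<beta>) = - (4 * of_real pi * \<i> * \<beta> * exp (- (\<i> * \<beta> * of_real h)) * um j)"
  proof -
    have "- (of_real (k\<^sup>2) * J (\<i> * \<beta>)) = 4 * of_real pi * \<i> * \<beta> * exp (- (\<i> * \<beta> * of_real h)) * um j"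
      using idJ[of "\<i> * \<beta>", symmetric] by (simp add: power_mult_distrib)
    then show ?thesis by (metis minus_minus)
  qed
  then have "of_real (k\<^sup>2) * (LINT y|lebesgue_on (scatterer n). g_minus k \<alpha> h j y * contrast n y * (ui y + us y)) =
      (exp (\<i> * \<beta> * of_real h) * exp (- (\<i> * \<beta> * of_real h))) * um j"
    unfolding Jm using \<open>\<beta> \<noteq> 0\<close> by (simp add: field_simps)
  then show "um j = of_real (k\<^sup>2) * (LINT y|lebesgue_on (scatterer n). g_minus k \<alpha> h j y * contrast n y * (ui y + us y))"
    unfolding split_exp by simp
qed

section \<open>The imaging kernel and the indicator function\<close>

text \<open>For a propagating index \<open>beta_j\<close> is real, so conjugation reverses phases:
  \<open>h\<close> cancels, and the two products have opposite phases in
  \<open>snd z - snd y\<close>, which add up to a cosine. For an evanescent mode they would depend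
  on \<open>snd z + snd y\<close> instead.\<close>

lemma g_pair_kernel:
  assumes "k > 0" and j: "j \<in> propagating k \<alpha>"
  shows "beta_j k \<alpha> j * (g_plus k \<alpha> h j y * cnj (g_plus k \<alpha> h j z) + g_minus k \<alpha> h j y * cnj (g_minus k \<alpha> h j z)) =
    1 / (8 * of_real pi) * (exp (\<i> * of_real (alpha_j \<alpha> j * (fst z - fst y))) *
      cos (beta_j k \<alpha> j * of_real (snd z - snd y)) / (of_real pi * beta_j k \<alpha> j))"
proof -
  define \<beta> where "\<beta> = sqrt (k\<^sup>2 - (alpha_j \<alpha> j)\<^sup>2)"
  have b: "beta_j k \<alpha> j = of_real \<beta>" and "\<beta> \<noteq> 0"
    using beta_j_propagating[OF assms] by (auto simp: \<beta>_def)
  let ?a = "\<i> * of_real (alpha_j \<alpha> j * (fst z - fst y))" and ?s = "of_real \<beta> * of_real (snd z - snd y) :: complex"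
  let ?c = "\<i> / (4 * of_real pi * of_real \<beta>)"
  have c: "?c * cnj ?c = 1 / (16 * (of_real pi)\<^sup>2 * (of_real \<beta>)\<^sup>2)"
    using \<open>\<beta> \<noteq> 0\<close> by (simp add: power2_eq_square field_simps)
  have p: "g_plus k \<alpha> h j y * cnj (g_plus k \<alpha> h j z) = ?c * cnj ?c * (exp ?a * exp (\<i> * ?s))"
  proof -
    have "exp (- \<i> * of_real (alpha_j \<alpha> j * fst y) - \<i> * of_real \<beta> * of_real (snd y - h)) *
        cnj (exp (- \<i> * of_real (alpha_j \<alpha> j * fst z) - \<i> * of_real \<beta> * of_real (snd z - h))) = exp ?a * exp (\<i> * ?s)"
      unfolding exp_cnj exp_add[symmetric] by (rule arg_cong[where f = exp]) (simp add: algebra_simps)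
    note e = this[symmetric]
    show ?thesis unfolding g_plus_def b complex_cnj_mult e by (simp only: mult_ac)
  qed
  have m: "g_minus k \<alpha> h j y * cnj (g_minus k \<alpha> h j z) = ?c * cnj ?c * (exp ?a * exp (- (\<i> * ?s)))"
  proof -
    have "exp (- \<i> * of_real (alpha_j \<alpha> j * fst y) + \<i> * of_real \<beta> * of_real (snd y + h)) *
        cnj (exp (- \<i> * of_real (alpha_j \<alpha> j * fst z) + \<i> * of_real \<beta> * of_real (snd z + h))) = exp ?a * exp (- (\<i> * ?s))"
      unfolding exp_cnj exp_add[symmetric] by (rule arg_cong[where f = exp]) (simp add: algebra_simps)
    note e = this[symmetric]
    show ?thesis unfolding g_minus_def b complex_cnj_mult e by (simp only: mult_ac)
  qed
  have cos: "exp (\<i> * ?s) + exp (- (\<i> * ?s)) = 2 * cos ?s"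
    by (simp add: cos_exp_eq)
  have "beta_j k \<alpha> j * (g_plus k \<alpha> h j y * cnj (g_plus k \<alpha> h j z) + g_minus k \<alpha> h j y * cnj (g_minus k \<alpha> h j z)) =
      of_real \<beta> * (?c * cnj ?c * exp ?a * (exp (\<i> * ?s) + exp (- (\<i> * ?s))))"
    unfolding p m b by (simp only: distrib_left mult.assoc)
  also have "\<dots> = of_real \<beta> * (1 / (16 * (of_real pi)\<^sup>2 * (of_real \<beta>)\<^sup>2) * exp ?a * (2 * cos ?s))"
    unfolding cos c ..
  also have "\<dots> = 1 / (8 * of_real pi) * (exp ?a * cos ?s / (of_real pi * of_real \<beta>))"
  proof -
    have alg: "B * (1 / (16 * P\<^sup>2 * B\<^sup>2) * X * (2 * Y)) = 1 / (8 * P) * (X * Y / (P * B))" if "B \<noteq> 0" "P \<noteq> 0" for B P X Y :: complex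
      using that by (simp add: power2_eq_square field_simps)
    show ?thesis by (rule alg) (use \<open>\<beta> \<noteq> 0\<close> in simp_all)
  qed
  finally show ?thesis unfolding b .
qed

text \<open>Both \<open>lim\<close> and the integral are total functions. Convergence of the series
  and integrability belong to the conclusion so that the identity speaks of true values and not of
  defaults.\<close>

theorem theorem1:
  fixes k \<alpha> h :: real and p N :: nat
    and n :: "real \<times> real \<Rightarrow> complex"
    and u_in u_sc :: "nat \<Rightarrow> real \<times> real \<Rightarrow> complex"
    and up um :: "int \<Rightarrow> nat \<Rightarrow> complex"
    and z :: "real \<times> real"
  assumes "k > 0" and "p \<ge> 1" and "N \<ge> 1" and "h > 0"
    and "\<And>j. beta_j k \<alpha> j \<noteq> 0"
    and "periodic_medium n"
    and "(SUP x\<in>scatterer n. ereal \<bar>snd x\<bar>) < ereal h"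
    and "\<And>l. l \<in> {1..N} \<Longrightarrow> quasiperiodic \<alpha> (u_in l)"
    and "\<And>l. l \<in> {1..N} \<Longrightarrow>
           scattering_solution k \<alpha> h n (u_in l) (u_sc l) (\<lambda>j. up j l) (\<lambda>j. um j l)"
    and "z \<in> Omega"
  shows "(\<forall>y\<in>scatterer n. convergent (w_partial k \<alpha> z y)) \<and>
    (\<forall>l\<in>{1..N}. integrable (lebesgue_on (scatterer n))
       (\<lambda>y. (of_real (bessel_J 0 (k * norm (z - y))) + w_alpha k \<alpha> z y) * contrast n y * (u_in l y + u_sc l y))) \<and>
    imaging_indicator k \<alpha> h p N up um z =
      (k\<^sup>2 / (8 * pi)) ^ p *
      (\<Sum>l=1..N. cmod (LINT y|lebesgue_on (scatterer n).
         (of_real (bessel_J 0 (k * norm (z - y))) + w_alpha k \<alpha> z y) * contrast n y * (u_in l y + u_sc l y)) ^ p)"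
proof -
  let ?M = "lebesgue_on (scatterer n)"
  let ?P = "propagating k \<alpha>"
  define K where "K = (\<lambda>y. \<Sum>j\<in>?P. exp (\<i> * of_real (alpha_j \<alpha> j * (fst z - fst y))) *
    cos (beta_j k \<alpha> j * of_real (snd z - snd y)) / (of_real pi * beta_j k \<alpha> j))"
  \<comment> \<open>From here on the kernel is a trigonometric sum, continuous in \<open>y\<close>,
    which settles integrability.\<close>
  have K: "of_real (bessel_J 0 (k * norm (z - y))) + w_alpha k \<alpha> z y = K y" for y
    unfolding K_def by (rule w_partial_limit(2)[OF assms(1,5)])
  have cK: "continuous_on UNIV K" unfolding K_def
    by (intro continuous_intros) (use assms(5) in auto)
  have cg: "continuous_on UNIV (g_plus k \<alpha> h j)" "continuous_on UNIV (g_minus k \<alpha> h j)" for j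
    unfolding g_plus_def[abs_def] g_minus_def[abs_def] by (intro continuous_intros)+
  have L2: "L2_on (scatterer n) (\<lambda>x. u_in l x + u_sc l x)" if "l \<in> {1..N}" for l
    using assms(9)[OF that] unfolding scattering_solution_def by blast
  have int: "integrable ?M (\<lambda>y. c y * contrast n y * (u_in l y + u_sc l y))"
    if "l \<in> {1..N}" "continuous_on UNIV c" for l c
    by (rule scatterer_mult_integrable[OF assms(6,7) L2[OF that(1)] that(2)])
  have term_eq: "cmod (\<Sum>j\<in>?P. beta_j k \<alpha> j * (up j l * cnj (g_plus k \<alpha> h j z) + um j l * cnj (g_minus k \<alpha> h j z))) =
      k\<^sup>2 / (8 * pi) * cmod (LINT y|?M. K y * contrast n y * (u_in l y + u_sc l y))" if l: "l \<in> {1..N}" for l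
  proof -
    let ?u = "\<lambda>y. contrast n y * (u_in l y + u_sc l y)"
    let ?G = "\<lambda>j y. g_plus k \<alpha> h j y * cnj (g_plus k \<alpha> h j z) + g_minus k \<alpha> h j y * cnj (g_minus k \<alpha> h j z)"
    have intu: "integrable ?M (\<lambda>y. c y * ?u y)" if "continuous_on UNIV c" for c
      using int[OF l that] by (simp add: mult.assoc)
    \<comment> \<open>The conjugated factors depend on \<open>z\<close> only, so they can be moved
      into the integrals that represent the coefficients.\<close>
    have "(\<Sum>j\<in>?P. beta_j k \<alpha> j * (up j l * cnj (g_plus k \<alpha> h j z) + um j l * cnj (g_minus k \<alpha> h j z))) =
        (\<Sum>j\<in>?P. of_real (k\<^sup>2) * (LINT y|?M. (beta_j k \<alpha> j * ?G j y) * ?u y))"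
    proof (rule sum.cong[OF refl])
      fix j assume j: "j \<in> ?P"
      have c: "up j l = of_real (k\<^sup>2) * (LINT y|?M. g_plus k \<alpha> h j y * ?u y)"
        "um j l = of_real (k\<^sup>2) * (LINT y|?M. g_minus k \<alpha> h j y * ?u y)"
        using rayleigh_coefficients[OF assms(1,4,6,7) assms(8)[OF l] assms(9)[OF l] j] by (simp_all add: mult.assoc)
      have "(LINT y|?M. (beta_j k \<alpha> j * ?G j y) * ?u y) =
          (LINT y|?M. beta_j k \<alpha> j * (cnj (g_plus k \<alpha> h j z) * (g_plus k \<alpha> h j y * ?u y) + cnj (g_minus k \<alpha> h j z) * (g_minus k \<alpha> h j y * ?u y)))"
        by (rule arg_cong[where f = "integral\<^sup>L ?M"]) (simp add: fun_eq_iff algebra_simps)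
      also have "\<dots> = beta_j k \<alpha> j * (cnj (g_plus k \<alpha> h j z) * (LINT y|?M. g_plus k \<alpha> h j y * ?u y)
          + cnj (g_minus k \<alpha> h j z) * (LINT y|?M. g_minus k \<alpha> h j y * ?u y))"
        by (simp only: integral_mult_right_zero
            Bochner_Integration.integral_add[OF integrable_mult_right[OF intu[OF cg(1)]] integrable_mult_right[OF intu[OF cg(2)]]])
      finally show "beta_j k \<alpha> j * (up j l * cnj (g_plus k \<alpha> h j z) + um j l * cnj (g_minus k \<alpha> h j z)) =
          of_real (k\<^sup>2) * (LINT y|?M. (beta_j k \<alpha> j * ?G j y) * ?u y)"
        unfolding c by (simp add: algebra_simps)
    qed
    also have "\<dots> = of_real (k\<^sup>2) * (\<Sum>j\<in>?P. (LINT y|?M. (beta_j k \<alpha> j * ?G j y) * ?u y))"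
      by (simp only: sum_distrib_left)
    also have "(\<Sum>j\<in>?P. (LINT y|?M. (beta_j k \<alpha> j * ?G j y) * ?u y)) = (LINT y|?M. (\<Sum>j\<in>?P. (beta_j k \<alpha> j * ?G j y) * ?u y))"
      by (rule Bochner_Integration.integral_sum[symmetric], rule intu) (intro continuous_intros cg)
    also have "\<dots> = (LINT y|?M. 1 / (8 * of_real pi) * (K y * ?u y))"
    proof (rule Bochner_Integration.integral_cong[OF refl])
      fix y
      have "(\<Sum>j\<in>?P. (beta_j k \<alpha> j * ?G j y) * ?u y) = (\<Sum>j\<in>?P. beta_j k \<alpha> j * ?G j y) * ?u y"
        by (simp only: sum_distrib_right)
      also have "(\<Sum>j\<in>?P. beta_j k \<alpha> j * ?G j y) = 1 / (8 * of_real pi) * K y"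
        unfolding K_def sum_distrib_left by (rule sum.cong[OF refl]) (rule g_pair_kernel[OF assms(1)])
      finally show "(\<Sum>j\<in>?P. (beta_j k \<alpha> j * ?G j y) * ?u y) = 1 / (8 * of_real pi) * (K y * ?u y)"
        by (simp only: mult.assoc)
    qed
    also have "\<dots> = 1 / (8 * of_real pi) * (LINT y|?M. K y * ?u y)"
      by (rule integral_mult_right_zero)
    finally show ?thesis
      by (simp add: norm_mult norm_divide norm_power mult.assoc)
  qed
  have "imaging_indicator k \<alpha> h p N up um z = (\<Sum>l=1..N. (k\<^sup>2 / (8 * pi)) ^ p *
      cmod (LINT y|?M. K y * contrast n y * (u_in l y + u_sc l y)) ^ p)"
    unfolding imaging_indicator_def by (rule sum.cong[OF refl]) (simp only: term_eq power_mult_distrib)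
  then have "imaging_indicator k \<alpha> h p N up um z = (k\<^sup>2 / (8 * pi)) ^ p *
      (\<Sum>l=1..N. cmod (LINT y|?M. K y * contrast n y * (u_in l y + u_sc l y)) ^ p)"
    by (simp only: sum_distrib_left)
  then show ?thesis
    unfolding K using w_partial_limit(1)[OF assms(1,5)] int[OF _ cK] by blast
qed

end
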